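(* Let $k>0$ be sufficiently large, $\varphi(p)=e^{kp^0}$, let the inflow profile $f_{LR}=f_L\mathbf 1_{p_1>0}+f_R\mathbf 1_{p_1<0}$ satisfy the boundary condition (B) of the context, and let $f=f(x_1,p)\ge0$ be the corresponding steady state, i.e. the unique non-negative solution, with $\|f\|<\infty$ and $\|f\|_{-1}<\infty$, of the mild formulation $$\begin{aligned}f(x_1,p)=\;&\mathbf 1_{\{p_1>0\}}\Big[f_L(p)\,e^{-\frac1{\hat p_1}\int_0^{x_1}\mathcal{L}f(z,p)\,dz}+\frac1{\hat p_1}\int_0^{x_1}e^{-\frac1{\hat p_1}\int_z^{x_1}\mathcal{L}f(z',p)\,dz'}Q^+(f,f)(z,p)\,dz\Big]\\&+\mathbf 1_{\{p_1<0\}}\Big[f_R(p)\,e^{\frac1{\hat p_1}\int_{x_1}^1\mathcal{L}f(z,p)\,dz}-\frac1{\hat p_1}\int_{x_1}^1e^{\frac1{\hat p_1}\int_{x_1}^z\mathcal{L}f(z',p)\,dz'}Q^+(f,f)(z,p)\,dz\Big],\end{aligned}$$ for $x_1\in[0,1]$, $p\in\mathbb{R}^3$. Assume in addition that $\|f_{LR}\|_{\mathrm{hyp}}<\infty$. Then $$\|f\|_{\mathrm{hyp}}=\sup_E\int_E(p^0)^{1/2}\varphi(p)\,\|f(\cdot,p)\|_{L^\infty_{x_1}([0,1])}\,d\sigma_E(p)<\infty,$$ where the supremum is over all two-dimensional planes $E\subset\mathbb{R}^3$ passing through the origin and $d\sigma_E$ is the two-dimensional Lebesgue measure on $E$.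
   Context: Notation. For $p=(p_1,p_2,p_3)\in\mathbb{R}^3$: $p^0=\sqrt{1+|p|^2}$, $\hat p_1=p_1/p^0$. For $p,q\in\mathbb{R}^3$: $g=g(p,q)=\sqrt{|p-q|^2-(p^0-q^0)^2}$, $s=s(p,q)=g^2+4$, and $v_{\o}=\dfrac{g\sqrt s}{p^0q^0}$. Collisions. For $\omega\in\mathbb{S}^2$ and $\gamma=(p^0+q^0)/\sqrt s$, $$p'=\tfrac{p+q}2+\tfrac g2\Big(\omega+(\gamma-1)(p+q)\tfrac{(p+q)\cdot\omega}{|p+q|^2}\Big),\qquad q'=\tfrac{p+q}2-\tfrac g2\Big(\omega+(\gamma-1)(p+q)\tfrac{(p+q)\cdot\omega}{|p+q|^2}\Big),$$ and the scattering angle $\theta$ is given by $\cos\theta=g^{-2}\big[-(p^0-q^0)(p'^0-q'^0)+(p-q)\cdot(p'-q')\big]$. Scattering kernel (hard spheres). $\sigma(g,\theta)\ge0$ is measurable with $\sigma(g,\theta)\approx g\,\sigma_0(\theta)$ (two-sided bounds with fixed positive constants), where $0\le\sigma_0(\theta)\le\frac1{4\pi}$ is measurable and $c_0=\int_{\mathbb{S}^2}\sigma_0(\theta)\,d\omega\in(0,1]$. Operators. $Q^+(f,h)(x_1,p)=\int_{\mathbb{R}^3}\int_{\mathbb{S}^2}v_{\o}\,\sigma(g,\theta)f(x_1,p')h(x_1,q')\,d\omega\,dq$ and $\mathcal{L}f(x_1,p)=\int_{\mathbb{R}^3}\int_{\mathbb{S}^2}v_{\o}\,\sigma(g,\theta)f(x_1,q)\,d\omega\,dq$.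 Norms. With $\|f(\cdot,p)\|_{L^\infty_{x_1}}=\operatorname{ess\,sup}_{x_1\in[0,1]}|f(x_1,p)|$, $$\|f\|=\int_{\mathbb{R}^3}(p^0)^{1/2}\varphi(p)\|f(\cdot,p)\|_{L^\infty_{x_1}}dp,\qquad \|f\|_{-1}=\sup_{a\in\mathbb{R}^3}\int_{\mathbb{R}^3}\frac{(p^0)^{1/2}\varphi(p)}{|p-a|}\|f(\cdot,p)\|_{L^\infty_{x_1}}dp,$$ and $\|f\|_{\mathrm{hyp}}$ is the quantity displayed in the claim. For functions of $p$ alone, such as $f_{LR}$, the same formulas are used with $\|f(\cdot,p)\|_{L^\infty_{x_1}}$ replaced by $|f_{LR}(p)|$. Boundary condition (B). For some $0<r_1<r_2<\infty$ put $Q_{r_1,r_2}=\{q: q_1\ge r_1,\ r_1\le|q|\le r_2\}$ and $\bar Q_{r_1,r_2}=\{q: q_1\le -r_1,\ r_1\le|q|\le r_2\}$. Then $f_L\in L^1(Q_{r_1,r_2})$, $f_R\in L^1(\bar Q_{r_1,r_2})$, and there exists $M>0$ such that $f_{LR}\ge0$, $\int_{Q_{r_1,r_2}}f_L\,dq>0$, $\int_{\bar Q_{r_1,r_2}}f_R\,dq>0$, $\|f_{LR}\|\le M$, $\|f_{LR}\|_{-1}\le M$. Standing fact. The paper's existence theorem asserts that, under (B) and for $k$ sufficiently large, a unique non-negative solution of the mild formulation with $\|f\|<\infty$ and $\|f\|_{-1}<\infty$ exists; the present statement is about that solution. *)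

theory Defs
  imports "HOL-Probability.Essential_Supremum"
begin

type_synonym momentum = "real ^ 3"


subsection \<open>Relativistic kinematics\<close>

definition energy :: "momentum \<Rightarrow> real" where
  "energy p = sqrt (1 + (norm p)\<^sup>2)"

definition phat1 :: "momentum \<Rightarrow> real" where
  "phat1 p = p $ 1 / energy p"

definition rel_momentum :: "momentum \<Rightarrow> momentum \<Rightarrow> real" where
  "rel_momentum p q = sqrt ((norm (p - q))\<^sup>2 - (energy p - energy q)\<^sup>2)"

definition s_inv :: "momentum \<Rightarrow> momentum \<Rightarrow> real" where
  "s_inv p q = (rel_momentum p q)\<^sup>2 + 4"

definition moller :: "momentum \<Rightarrow> momentum \<Rightarrow> real" where
  "moller p q = rel_momentum p q * sqrt (s_inv p q) / (energy p * energy q)"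

definition gamma_cm :: "momentum \<Rightarrow> momentum \<Rightarrow> real" where
  "gamma_cm p q = (energy p + energy q) / sqrt (s_inv p q)"

text \<open>For \<open>p + q = 0\<close> the quotient below is \<open>0\<close> in HOL; this agrees with the formula, as the vector
  it multiplies vanishes and \<open>gamma_cm p q = 1\<close>.\<close>

definition deflection :: "momentum \<Rightarrow> momentum \<Rightarrow> momentum \<Rightarrow> momentum" where
  "deflection p q \<omega> =
     \<omega> + ((gamma_cm p q - 1) * (((p + q) \<bullet> \<omega>) / (norm (p + q))\<^sup>2)) *\<^sub>R (p + q)"

definition post_p :: "momentum \<Rightarrow> momentum \<Rightarrow> momentum \<Rightarrow> momentum" where
  "post_p p q \<omega> = (1 / 2) *\<^sub>R (p + q) + (rel_momentum p q / 2) *\<^sub>R deflection p q \<omega>"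

definition post_q :: "momentum \<Rightarrow> momentum \<Rightarrow> momentum \<Rightarrow> momentum" where
  "post_q p q \<omega> = (1 / 2) *\<^sub>R (p + q) - (rel_momentum p q / 2) *\<^sub>R deflection p q \<omega>"

definition cos_scatter :: "momentum \<Rightarrow> momentum \<Rightarrow> momentum \<Rightarrow> real" where
  "cos_scatter p q \<omega> =
     (- (energy p - energy q) * (energy (post_p p q \<omega>) - energy (post_q p q \<omega>))
        + (p - q) \<bullet> (post_p p q \<omega> - post_q p q \<omega>)) / (rel_momentum p q)\<^sup>2"

definition scatter_angle :: "momentum \<Rightarrow> momentum \<Rightarrow> momentum \<Rightarrow> real" where
  "scatter_angle p q \<omega> = arccos (cos_scatter p q \<omega>)"


subsection \<open>Surface measure on the unit sphere\<close>

text \<open>The measure of \<open>A\<close> is \<open>3\<close> times the volume of the cone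
  \<open>{x. 0 < norm x < 1 and x / norm x \<in> A}\<close>, which is the surface measure on the sphere;
  note that \<open>sgn x = x /\<^sub>R norm x\<close>. It is a measure on the ambient space that is carried by the
  sphere.\<close>

definition sphere_measure :: "momentum measure" where
  "sphere_measure = distr (density lborel (\<lambda>x. 3 * indicator (ball 0 1) x)) borel sgn"

lemma emeasure_sphere_measure:
  assumes A: "A \<in> sets borel"
  shows "emeasure sphere_measure A = 3 * emeasure lborel (ball 0 1 \<inter> sgn -` A)"
proof -
  have m: "(sgn :: momentum \<Rightarrow> momentum) \<in> borel_measurable borel"
    unfolding sgn_div_norm by measurable
  have V: "sgn -` A \<in> sets borel"
    using measurable_sets[OF m A] by simp
  have d: "(\<lambda>x. 3 * indicator (ball 0 1) x :: ennreal) \<in> borel_measurable (borel :: momentum measure)"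
    by (intro borel_measurable_times_ennreal borel_measurable_indicator) auto
  have "emeasure sphere_measure A = (\<integral>\<^sup>+ x. 3 * indicator (ball 0 1) x * indicator (sgn -` A) x \<partial>lborel)"
    unfolding sphere_measure_def using m A V d
    by (subst emeasure_distr, simp, simp, subst emeasure_density) simp_all
  also have "\<dots> = (\<integral>\<^sup>+ x. 3 * indicator (ball 0 1 \<inter> sgn -` A) x \<partial>lborel)"
    by (intro nn_integral_cong) (auto simp: indicator_def)
  also have "\<dots> = 3 * emeasure lborel (ball 0 1 \<inter> sgn -` A)"
    using V by (subst nn_integral_cmult_indicator) auto
  finally show ?thesis .
qed

lemma emeasure_sphere_measure_UNIV: "emeasure sphere_measure UNIV = ennreal (4 * pi)"
proof -
  have "emeasure lborel (ball (0::momentum) 1) = ennreal (4 / 3 * pi)"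
    by (simp add: emeasure_ball unit_ball_vol_3)
  then have "emeasure sphere_measure UNIV = ennreal 3 * ennreal (4 / 3 * pi)"
    by (subst emeasure_sphere_measure) auto
  also have "\<dots> = ennreal (4 * pi)"
    by (subst ennreal_mult[symmetric]) auto
  finally show ?thesis .
qed

lemma AE_sphere_measure: "AE \<omega> in sphere_measure. norm \<omega> = 1"
proof (rule AE_I)
  let ?N = "- sphere (0::momentum) 1"
  show "{\<omega> \<in> space sphere_measure. norm \<omega> \<noteq> 1} \<subseteq> ?N" by auto
  show "?N \<in> sets sphere_measure" by (simp add: sphere_measure_def)
  have "ball 0 1 \<inter> sgn -` ?N = {0::momentum}" by (auto simp: norm_sgn split: if_splits)
  then show "emeasure sphere_measure ?N = 0"
    by (subst emeasure_sphere_measure) auto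
qed


subsection \<open>Hard-sphere kernels\<close>

text \<open>In \<open>c\<^sub>0 = \<integral> \<sigma>0(\<theta>) d\<omega>\<close> the angle \<open>\<theta>\<close> is the polar angle of \<open>\<omega>\<close> with respect to a fixed axis, here the
  third one; by rotation invariance the choice of the axis is immaterial.\<close>

definition hard_sphere_kernel :: "(real \<Rightarrow> real \<Rightarrow> real) \<Rightarrow> (real \<Rightarrow> real) \<Rightarrow> bool" where
  "hard_sphere_kernel \<sigma> \<sigma>0 \<longleftrightarrow>
     (\<lambda>(g, \<theta>). \<sigma> g \<theta>) \<in> borel_measurable (restrict_space borel ({0..} \<times> {0..pi})) \<and>
     \<sigma>0 \<in> borel_measurable (restrict_space borel {0..pi}) \<and>
     (\<forall>g\<ge>0. \<forall>\<theta>\<in>{0..pi}. 0 \<le> \<sigma> g \<theta>) \<and>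
     (\<exists>A>0. \<exists>B>0. \<forall>g\<ge>0. \<forall>\<theta>\<in>{0..pi}.
        A * (g * \<sigma>0 \<theta>) \<le> \<sigma> g \<theta> \<and> \<sigma> g \<theta> \<le> B * (g * \<sigma>0 \<theta>)) \<and>
     (\<forall>\<theta>\<in>{0..pi}. 0 \<le> \<sigma>0 \<theta> \<and> \<sigma>0 \<theta> \<le> 1 / (4 * pi)) \<and>
     (\<exists>c0. 0 < c0 \<and> c0 \<le> 1 \<and>
        (LINT \<omega>:sphere 0 1|sphere_measure. \<sigma>0 (arccos (\<omega> $ 3))) = c0)"


subsection \<open>Collision operators and the mild formulation\<close>

text \<open>Densities take values in \<open>[0, \<infinity>]\<close>. All integrands are non-negative, so every integral is
  meaningful in \<open>[0, \<infinity>]\<close> and the mild formulation can be imposed at every point. Real-valued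
  densities are the special case of finite values.\<close>

definition Q_plus ::
  "(real \<Rightarrow> real \<Rightarrow> real) \<Rightarrow> (real \<Rightarrow> momentum \<Rightarrow> ennreal) \<Rightarrow> (real \<Rightarrow> momentum \<Rightarrow> ennreal)
     \<Rightarrow> real \<Rightarrow> momentum \<Rightarrow> ennreal" where
  "Q_plus \<sigma> f h x p =
     (\<integral>\<^sup>+ q. (\<integral>\<^sup>+ \<omega>\<in>sphere 0 1. ennreal (moller p q * \<sigma> (rel_momentum p q) (scatter_angle p q \<omega>))
        * f x (post_p p q \<omega>) * h x (post_q p q \<omega>) \<partial>sphere_measure) \<partial>lborel)"

definition coll_freq ::
  "(real \<Rightarrow> real \<Rightarrow> real) \<Rightarrow> (real \<Rightarrow> momentum \<Rightarrow> ennreal) \<Rightarrow> real \<Rightarrow> momentum \<Rightarrow> ennreal" where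
  "coll_freq \<sigma> f x p =
     (\<integral>\<^sup>+ q. (\<integral>\<^sup>+ \<omega>\<in>sphere 0 1. ennreal (moller p q * \<sigma> (rel_momentum p q) (scatter_angle p q \<omega>))
        * f x q \<partial>sphere_measure) \<partial>lborel)"

definition exp_neg :: "ennreal \<Rightarrow> ennreal" where
  "exp_neg t = (if t = \<infinity> then 0 else ennreal (exp (- enn2real t)))"

text \<open>For \<open>p $ 1 < 0\<close> the factor \<open>1 / phat1 p\<close> is negative; its sign is moved so that only
  non-negative quantities occur.\<close>

definition mild_rhs ::
  "(real \<Rightarrow> real \<Rightarrow> real) \<Rightarrow> (momentum \<Rightarrow> real) \<Rightarrow> (momentum \<Rightarrow> real)
     \<Rightarrow> (real \<Rightarrow> momentum \<Rightarrow> ennreal) \<Rightarrow> real \<Rightarrow> momentum \<Rightarrow> ennreal" where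
  "mild_rhs \<sigma> fL fR f x p =
     indicator {p. 0 < p $ 1} p *
       (ennreal (fL p) * exp_neg (ennreal (1 / phat1 p) * (\<integral>\<^sup>+ z\<in>{0..x}. coll_freq \<sigma> f z p \<partial>lborel))
        + ennreal (1 / phat1 p) *
          (\<integral>\<^sup>+ z\<in>{0..x}.
             exp_neg (ennreal (1 / phat1 p) * (\<integral>\<^sup>+ z'\<in>{z..x}. coll_freq \<sigma> f z' p \<partial>lborel))
             * Q_plus \<sigma> f f z p \<partial>lborel))
     + indicator {p. p $ 1 < 0} p *
       (ennreal (fR p) * exp_neg (ennreal (- (1 / phat1 p)) * (\<integral>\<^sup>+ z\<in>{x..1}. coll_freq \<sigma> f z p \<partial>lborel))
        + ennreal (- (1 / phat1 p)) *
          (\<integral>\<^sup>+ z\<in>{x..1}.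
             exp_neg (ennreal (- (1 / phat1 p)) * (\<integral>\<^sup>+ z'\<in>{x..z}. coll_freq \<sigma> f z' p \<partial>lborel))
             * Q_plus \<sigma> f f z p \<partial>lborel))"


subsection \<open>Norms\<close>

definition Linf_x :: "(real \<Rightarrow> momentum \<Rightarrow> ennreal) \<Rightarrow> momentum \<Rightarrow> ennreal" where
  "Linf_x f p = esssup (restrict_space lborel {0..1}) (\<lambda>x. f x p)"

definition phi :: "real \<Rightarrow> momentum \<Rightarrow> real" where
  "phi k p = exp (k * energy p)"

text \<open>The norms are functions of the profile \<open>F\<close>, which is \<open>Linf_x f\<close> for a function of \<open>(x\<^sub>1, p)\<close> and
  the absolute value for a function of \<open>p\<close> alone.\<close>

definition norm_w :: "real \<Rightarrow> (momentum \<Rightarrow> ennreal) \<Rightarrow> ennreal" where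
  "norm_w k F = (\<integral>\<^sup>+ p. ennreal (energy p powr (1 / 2) * phi k p) * F p \<partial>lborel)"

definition norm_m1 :: "real \<Rightarrow> (momentum \<Rightarrow> ennreal) \<Rightarrow> ennreal" where
  "norm_m1 k F =
     (SUP a. \<integral>\<^sup>+ p. ennreal (energy p powr (1 / 2) * phi k p / norm (p - a)) * F p \<partial>lborel)"

definition orthonormal_frame :: "momentum set \<Rightarrow> momentum \<times> momentum \<Rightarrow> bool" where
  "orthonormal_frame E = (\<lambda>(u, v). norm u = 1 \<and> norm v = 1 \<and> u \<bullet> v = 0 \<and> span {u, v} = E)"

definition frame_measure :: "momentum \<times> momentum \<Rightarrow> momentum measure" where
  "frame_measure = (\<lambda>(u, v). distr (lborel :: (real ^ 2) measure) borel (\<lambda>y. y $ 1 *\<^sub>R u + y $ 2 *\<^sub>R v))"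

text \<open>Two-dimensional Lebesgue measure on a plane \<open>E\<close> through the origin, as a measure on the ambient
  space carried by \<open>E\<close>: the image of Lebesgue measure under the isometric parametrization of \<open>E\<close> by
  an orthonormal frame. It does not depend on the frame (\<open>plane_measure_eq\<close>).\<close>

definition plane_measure :: "momentum set \<Rightarrow> momentum measure" where
  "plane_measure E = frame_measure (SOME b. orthonormal_frame E b)"

definition planes :: "momentum set set" where
  "planes = {E. subspace E \<and> dim E = 2}"

definition norm_hyp :: "real \<Rightarrow> (momentum \<Rightarrow> ennreal) \<Rightarrow> ennreal" where
  "norm_hyp k F =
     (SUP E\<in>planes. \<integral>\<^sup>+ p. ennreal (energy p powr (1 / 2) * phi k p) * F p \<partial>plane_measure E)"

lemma distr_lborel_orthogonal:
  fixes T :: "real ^ 2 \<Rightarrow> real ^ 2"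
  assumes T: "orthogonal_transformation T"
  shows "distr lborel borel T = lborel"
proof (rule lborel_eqI[symmetric])
  have lin: "linear T" using T by (rule orthogonal_transformation_linear)
  then have "continuous_on UNIV T" by (intro linear_continuous_on) (simp add: linear_linear)
  then have Tm: "T \<in> borel_measurable borel" by (rule borel_measurable_continuous_onI)
  show "sets (distr lborel borel T) = sets borel" by simp
  fix l u :: "real ^ 2"
  assume lu: "\<And>b. b \<in> Basis \<Longrightarrow> l \<bullet> b \<le> u \<bullet> b"
  let ?S = "T -` box l u"
  have T': "orthogonal_transformation (inv T)"
    using T by (rule orthogonal_transformation_inv)
  have eq: "?S = inv T ` box l u"
    using T by (simp add: bij_vimage_eq_inv_image orthogonal_transformation_bij)
  have Sm: "?S \<in> sets borel" using measurable_sets[OF Tm, of "box l u"] by simp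
  have "inv T ` box l u \<in> lmeasurable"
    by (rule measurable_orthogonal_image[OF T']) simp
  then have "emeasure lebesgue ?S = ennreal (measure lebesgue ?S)"
    unfolding eq by (simp add: emeasure_eq_measure2 fmeasurableD2)
  also have "measure lebesgue ?S = measure lebesgue (box l u)"
    unfolding eq by (rule measure_orthogonal_image[OF T']) simp
  also have "\<dots> = (\<Prod>b\<in>Basis. (u - l) \<bullet> b)"
    using lu by (simp add: measure_lborel_box_eq inner_diff_left)
  finally have "emeasure lborel ?S = ennreal (\<Prod>b\<in>Basis. (u - l) \<bullet> b)"
    using Sm by simp
  then show "emeasure (distr lborel borel T) (box l u) = ennreal (\<Prod>b\<in>Basis. (u - l) \<bullet> b)"
    using Tm by (subst emeasure_distr) auto
qed

lemma frame_measure_unique: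
  assumes "orthonormal_frame E b" and "orthonormal_frame E b'"
  shows "frame_measure b = frame_measure b'"
proof -
  obtain u v where b: "b = (u, v)" by (cases b)
  obtain u' v' where b': "b' = (u', v')" by (cases b')
  have uv: "norm u = 1" "norm v = 1" "u \<bullet> v = 0" "span {u, v} = E"
    and uv': "norm u' = 1" "norm v' = 1" "u' \<bullet> v' = 0" "span {u', v'} = E"
    using assms by (auto simp: b b' orthonormal_frame_def)
  define P where "P = (\<lambda>y::real^2. y $ 1 *\<^sub>R u + y $ 2 *\<^sub>R v)"
  define P' where "P' = (\<lambda>y::real^2. y $ 1 *\<^sub>R u' + y $ 2 *\<^sub>R v')"
  define T where "T = (\<lambda>y. \<chi> i::2. if i = 1 then P' y \<bullet> u else P' y \<bullet> v)"
  have one: "u \<bullet> u = 1" "v \<bullet> v = 1" "u' \<bullet> u' = 1" "v' \<bullet> v' = 1" "v \<bullet> u = 0" "v' \<bullet> u' = 0"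
    using uv uv' by (simp_all add: dot_square_norm inner_commute)
  have PT: "P (T y) = P' y" for y
  proof -
    have "P' y \<in> E" unfolding P'_def uv'(4)[symmetric]
      by (intro span_add span_scale span_base) auto
    then obtain a c where ac: "P' y = a *\<^sub>R u + c *\<^sub>R v"
      unfolding uv(4)[symmetric] span_insert by (auto simp: span_singleton algebra_simps)
    have "P' y \<bullet> u = a" "P' y \<bullet> v = c"
      unfolding ac using one uv(3) by (simp_all add: inner_add_left)
    then show ?thesis by (simp add: P_def T_def ac)
  qed
  have yy: "y \<bullet> y = y $ 1 * y $ 1 + y $ 2 * y $ 2" for y :: "real^2"
    by (simp add: inner_vec_def sum_2)
  have nP: "norm (P y) = norm y" for y
  proof -
    have "P y \<bullet> P y = y \<bullet> y"
      using one uv(3) by (simp add: P_def inner_add_left inner_add_right yy)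
    then show ?thesis by (simp add: norm_eq_sqrt_inner)
  qed
  have nP': "norm (P' y) = norm y" for y
  proof -
    have "P' y \<bullet> P' y = y \<bullet> y"
      using one uv'(3) by (simp add: P'_def inner_add_left inner_add_right yy)
    then show ?thesis by (simp add: norm_eq_sqrt_inner)
  qed
  have "linear T"
    by (rule linearI) (simp_all add: T_def P'_def vec_eq_iff algebra_simps inner_add_left)
  moreover have "norm (T y) = norm y" for y
    using PT nP nP' by metis
  ultimately have T: "orthogonal_transformation T"
    by (simp add: orthogonal_transformation)
  have Tm: "T \<in> borel_measurable borel"
    using \<open>linear T\<close> by (intro borel_measurable_continuous_onI linear_continuous_on) (simp add: linear_linear)
  have Pm: "P \<in> borel_measurable borel" unfolding P_def by measurable
  have "frame_measure b' = distr lborel borel (\<lambda>y. P (T y))"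
    by (simp add: frame_measure_def b' PT P'_def)
  also have "\<dots> = distr (distr lborel borel T) borel P"
    using Tm Pm by (subst distr_distr) (auto simp: comp_def)
  also have "\<dots> = frame_measure b"
    by (simp add: distr_lborel_orthogonal[OF T] frame_measure_def b P_def)
  finally show ?thesis by simp
qed

lemma ex_orthonormal_frame:
  assumes "E \<in> planes"
  shows "\<exists>b. orthonormal_frame E b"
proof -
  have E: "subspace E" "dim E = 2" using assms by (auto simp: planes_def)
  from orthonormal_basis_subspace[OF E(1)] obtain B where
    B: "B \<subseteq> E" "pairwise orthogonal B" "\<And>x. x \<in> B \<Longrightarrow> norm x = 1" "card B = dim E" "span B = E"
    by metis
  then obtain u v where "B = {u, v}" "u \<noteq> v"
    using E(2) by (auto simp: card_2_iff)
  with B have "orthonormal_frame E (u, v)"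
    by (auto simp: orthonormal_frame_def pairwise_def orthogonal_def)
  then show ?thesis ..
qed

lemma plane_measure_eq:
  assumes "orthonormal_frame E b"
  shows "plane_measure E = frame_measure b"
  unfolding plane_measure_def using assms
  by (intro frame_measure_unique[where E = E]) (auto intro: someI)


subsection \<open>Boundary data and steady states\<close>

definition inflow :: "(momentum \<Rightarrow> real) \<Rightarrow> (momentum \<Rightarrow> real) \<Rightarrow> momentum \<Rightarrow> real" where
  "inflow fL fR p = fL p * indicator {p. 0 < p $ 1} p + fR p * indicator {p. p $ 1 < 0} p"

definition Q_right :: "real \<Rightarrow> real \<Rightarrow> momentum set" where
  "Q_right r1 r2 = {q. r1 \<le> q $ 1 \<and> r1 \<le> norm q \<and> norm q \<le> r2}"

definition Q_left :: "real \<Rightarrow> real \<Rightarrow> momentum set" where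
  "Q_left r1 r2 = {q. q $ 1 \<le> - r1 \<and> r1 \<le> norm q \<and> norm q \<le> r2}"

definition boundary_condition :: "real \<Rightarrow> (momentum \<Rightarrow> real) \<Rightarrow> (momentum \<Rightarrow> real) \<Rightarrow> bool" where
  "boundary_condition k fL fR \<longleftrightarrow>
     inflow fL fR \<in> borel_measurable borel \<and>
     (\<exists>r1 r2. 0 < r1 \<and> r1 < r2 \<and>
        set_integrable lborel (Q_right r1 r2) fL \<and>
        set_integrable lborel (Q_left r1 r2) fR \<and>
        0 < (LINT q:Q_right r1 r2|lborel. fL q) \<and>
        0 < (LINT q:Q_left r1 r2|lborel. fR q)) \<and>
     (\<forall>p. 0 \<le> inflow fL fR p) \<and>
     (\<exists>M>0. norm_w k (\<lambda>p. ennreal \<bar>inflow fL fR p\<bar>) \<le> ennreal M \<and>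
             norm_m1 k (\<lambda>p. ennreal \<bar>inflow fL fR p\<bar>) \<le> ennreal M)"

definition steady_state ::
  "(real \<Rightarrow> real \<Rightarrow> real) \<Rightarrow> real \<Rightarrow> (momentum \<Rightarrow> real) \<Rightarrow> (momentum \<Rightarrow> real)
     \<Rightarrow> (real \<Rightarrow> momentum \<Rightarrow> ennreal) \<Rightarrow> bool" where
  "steady_state \<sigma> k fL fR f \<longleftrightarrow>
     (\<lambda>(x, p). f x p) \<in> borel_measurable (restrict_space borel ({0..1} \<times> UNIV)) \<and>
     norm_w k (Linf_x f) < \<infinity> \<and> norm_m1 k (Linf_x f) < \<infinity> \<and>
     (\<forall>x\<in>{0..1}. \<forall>p. f x p = mild_rhs \<sigma> fL fR f x p)"

end

theory Submission
  imports Defs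
begin

text \<open>Let \<open>F\<close> be the profile \<open>Linf_x f\<close>. The inflow at velocities with \<open>q $ 1 \<ge> r\<^sub>1\<close> survives in the
  steady state up to a factor, so the collision frequency is bounded below by some \<open>\<nu> > 0\<close>. Hence the
  mild formulation gives \<open>F \<le> \<bar>f\<^sub>L\<^sub>R\<bar> + C / \<nu> * gain F\<close>, where \<open>gain F\<close> is the gain term with kernel
  \<open>g v\<close>, \<open>v = moller p q\<close>. It remains to integrate \<open>gain F\<close> over a plane \<open>E\<close>.

  For this consider the image of \<open>g v d\<sigma>\<^sub>E(p) dq d\<omega>\<close> under \<open>(p, q, \<omega>) \<mapsto> (p', q')\<close>. Thickening \<open>E\<close> to a
  slab of width \<open>\<epsilon>\<close> and exchanging pre- and post-collisional momenta, its mass on an open set is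
  controlled by the measure of those \<open>\<omega>\<close> for which \<open>p'\<close> lies in the slab. By the theorem of Archimedes on
  spherical zones this measure is at most of order \<open>\<epsilon> / g\<close>, and \<open>v\<close> is bounded. So the image measure is
  dominated by a multiple of Lebesgue measure, and as \<open>energy p \<le> energy p' + energy q'\<close> the weighted
  integral of \<open>gain F\<close> over \<open>E\<close> is at most a multiple of the square of \<open>norm_w k F\<close>.

  The exchange of pre- and post-collisional momenta is done in the coordinates \<open>P = p + q\<close> and
  \<open>\<xi> = (g / 2) k\<close>, where \<open>k\<close> is the direction of \<open>p\<close> in the centre-of-mass frame: a collision only
  rotates \<open>\<xi>\<close>.\<close>

subsection \<open>Kinematics of a collision\<close>

text \<open>A plane is a null set of momentum space, so finiteness of \<open>norm_w\<close> says
  nothing about \<open>F\<close> on \<open>E\<close>, and a bound valid for almost every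
  \<open>p\<close> would be worthless there. The inequality for \<open>F\<close> is therefore proved
  at every \<open>p\<close>, with exceptional null sets in the space variable only, and the gain
  term has to supply the regularity. It can do so because a point of \<open>E\<close>, a momentum
  \<open>q\<close> and a direction \<open>\<omega>\<close> are seven parameters, mapped to the six
  dimensions of \<open>(p', q')\<close>. Two singular factors have to disappear: the
  \<open>1 / g\<close> of the zone estimate, against the factor \<open>g\<close> of the hard-sphere
  kernel, and \<open>1 / phat1 p\<close>, against the exponential damping with rate at least
  \<open>\<nu> / \<bar>phat1 p\<bar>\<close>. The passage from slabs to the plane is delicate, since
  averages over slabs say nothing about one particular plane. On open sets, however, the integrand
  is lower semicontinuous under translation of the plane, and Fatou's lemma transfers the bound;
  outer regularity of Lebesgue measure then reaches all Borel sets.\<close>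

lemma energy_sq: "(energy p)\<^sup>2 = 1 + (norm p)\<^sup>2"
  by (simp add: energy_def add_nonneg_nonneg)

lemma energy_ge_1: "1 \<le> energy p"
  by (simp add: energy_def)

lemma energy_pos [simp]: "0 < energy p"
  using energy_ge_1[of p] by linarith

lemma norm_le_energy: "norm p \<le> energy p"
  by (simp add: energy_def real_le_rsqrt)

text \<open>Cauchy-Schwarz and \<open>2 * a * b \<le> a\<^sup>2 + b\<^sup>2\<close>. It makes the
  radicand in \<open>rel_momentum\<close> nonnegative, so that \<open>sqrt\<close> is a genuine root
  there.\<close>

lemma abs_inner_energy: "\<bar>p \<bullet> q\<bar> + 1 \<le> energy p * energy q"
proof -
  have "\<bar>p \<bullet> q\<bar> \<le> norm p * norm q" by (rule Cauchy_Schwarz_ineq2)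
  moreover have "(norm p * norm q + 1)\<^sup>2 \<le> (energy p * energy q)\<^sup>2"
    using sum_squares_bound[of "norm p" "norm q"]
    by (simp add: power_mult_distrib energy_sq) (simp add: power2_eq_square algebra_simps)
  then have "norm p * norm q + 1 \<le> energy p * energy q"
    by (rule power2_le_imp_le) (simp add: less_imp_le)
  ultimately show ?thesis by linarith
qed

lemma rel_momentum_radicand:
  "(norm (p - q))\<^sup>2 - (energy p - energy q)\<^sup>2 = 2 * (energy p * energy q - p \<bullet> q - 1)"
  using energy_sq[of p] energy_sq[of q]
  by (simp add: power2_norm_eq_inner inner_diff_left inner_diff_right inner_commute power2_diff)

lemma rel_momentum_sq: "(rel_momentum p q)\<^sup>2 = 2 * (energy p * energy q - p \<bullet> q - 1)"
  using abs_inner_energy[of p q] by (simp add: rel_momentum_def rel_momentum_radicand)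

lemma rel_momentum_nonneg [simp]: "0 \<le> rel_momentum p q"
  using abs_inner_energy[of p q] by (simp add: rel_momentum_def rel_momentum_radicand)

lemma s_inv_ge_4: "4 \<le> s_inv p q"
  by (simp add: s_inv_def)

text \<open>The Lorentz square of the total four-momentum. A collision preserves total energy and
  momentum, hence also this quantity.\<close>

lemma s_inv_eq: "s_inv p q = (energy p + energy q)\<^sup>2 - (norm (p + q))\<^sup>2"
  using energy_sq[of p] energy_sq[of q]
  by (simp add: s_inv_def rel_momentum_sq power2_norm_eq_inner inner_add_left inner_add_right
      inner_commute power2_sum)

lemma rel_momentum_sq_le: "(rel_momentum p q)\<^sup>2 \<le> 4 * (energy p * energy q)"
  using abs_inner_energy[of p q] by (simp add: rel_momentum_sq)

lemma s_inv_le: "s_inv p q \<le> 4 * (energy p * energy q)"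
  using abs_inner_energy[of p q] by (simp add: s_inv_def rel_momentum_sq)

lemma moller_nonneg [simp]: "0 \<le> moller p q"
  using s_inv_ge_4[of p q] by (simp add: moller_def less_imp_le)

lemma moller_le: "moller p q \<le> 4"
proof -
  have pos: "0 < energy p * energy q" by simp
  have "rel_momentum p q * sqrt (s_inv p q) \<le> sqrt (4 * (energy p * energy q)) * sqrt (4 * (energy p * energy q))"
    using rel_momentum_sq_le[of p q] s_inv_le[of p q] s_inv_ge_4[of p q] pos
    by (intro mult_mono real_le_rsqrt) auto
  then show ?thesis
    using pos by (simp add: moller_def pos_divide_le_eq)
qed

text \<open>The growth is that of the square root of each energy; the factor in \<open>q\<close> is
  absorbed by the weight of \<open>norm_w\<close> when the collision frequency is bounded from
  above.\<close>

lemma moller_rel_momentum_le: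
  "moller p q * rel_momentum p q \<le> 8 * (sqrt (energy p) * sqrt (energy q))"
proof -
  have "rel_momentum p q \<le> 2 * sqrt (energy p * energy q)"
    using real_le_rsqrt[OF rel_momentum_sq_le[of p q]] by (simp add: real_sqrt_mult)
  then have "moller p q * rel_momentum p q \<le> 4 * (2 * sqrt (energy p * energy q))"
    by (intro mult_mono moller_le) auto
  then show ?thesis by (simp add: real_sqrt_mult)
qed

text \<open>Cauchy-Schwarz in \<open>(energy p - energy q) * (energy p + energy q) = (p - q)
  \<bullet> (p + q)\<close> bounds \<open>rel_momentum p q\<close> from below. Up to powers of the
  energies the bound degenerates only on the diagonal.\<close>

lemma moller_rel_momentum_ge:
  "2 * (norm (p - q))\<^sup>2 / (energy p * energy q) ^ 3 \<le> moller p q * rel_momentum p q"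
proof -
  let ?P0 = "energy p + energy q"
  have P0: "?P0 > 0" using energy_pos[of p] energy_pos[of q] by linarith
  have "(energy p - energy q) * ?P0 = (p - q) \<bullet> (p + q)"
    using energy_sq[of p] energy_sq[of q]
    by (simp add: power2_norm_eq_inner inner_diff_left inner_add_right inner_commute[of q p])
      (simp add: power2_eq_square algebra_simps)
  then have "((energy p - energy q) * ?P0)\<^sup>2 \<le> (norm (p - q) * norm (p + q))\<^sup>2"
    using Cauchy_Schwarz_ineq2[of "p - q" "p + q"] by (intro power2_le_iff_abs_le[THEN iffD2]) auto
  then have "(norm (p - q))\<^sup>2 * s_inv p q \<le> (rel_momentum p q)\<^sup>2 * ?P0\<^sup>2"
    unfolding s_inv_eq rel_momentum_sq rel_momentum_radicand[symmetric] power_mult_distrib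
    by (simp add: algebra_simps)
  moreover have "?P0\<^sup>2 \<le> (2 * (energy p * energy q))\<^sup>2"
  proof (rule power_mono)
    have "energy p * 1 \<le> energy p * energy q" "1 * energy q \<le> energy p * energy q"
      using energy_ge_1[of p] energy_ge_1[of q] by (intro mult_mono; simp)+
    then show "?P0 \<le> 2 * (energy p * energy q)" by linarith
  qed (use P0 in simp)
  moreover have "(norm (p - q))\<^sup>2 * 4 \<le> (norm (p - q))\<^sup>2 * s_inv p q"
    using s_inv_ge_4 by (intro mult_left_mono) auto
  ultimately have "(norm (p - q))\<^sup>2 * 4 \<le> (rel_momentum p q)\<^sup>2 * (2 * (energy p * energy q))\<^sup>2"
    by (meson mult_left_mono order_trans zero_le_power2)
  then have a: "(norm (p - q))\<^sup>2 \<le> (rel_momentum p q)\<^sup>2 * (energy p * energy q)\<^sup>2"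
    by (simp add: power_mult_distrib)
  have b: "2 \<le> sqrt (s_inv p q)"
    using s_inv_ge_4[of p q] by (intro real_le_rsqrt) auto
  have "(norm (p - q))\<^sup>2 * 2 \<le> (rel_momentum p q)\<^sup>2 * (energy p * energy q)\<^sup>2 * sqrt (s_inv p q)"
    using a b by (intro mult_mono) auto
  moreover have "moller p q * rel_momentum p q * (energy p * energy q) ^ 3 =
      (rel_momentum p q)\<^sup>2 * (energy p * energy q)\<^sup>2 * sqrt (s_inv p q)"
    using energy_pos[of p] energy_pos[of q]
    by (simp add: moller_def power2_eq_square power3_eq_cube)
  ultimately show ?thesis
    by (subst pos_divide_le_eq) (auto simp: mult.commute)
qed

section \<open>Centre-of-mass coordinates\<close>

definition cm_s :: "real \<Rightarrow> real" where
  "cm_s r = 4 + 4 * r\<^sup>2"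

definition cm_energy :: "momentum \<Rightarrow> real \<Rightarrow> real" where
  "cm_energy P r = sqrt (cm_s r + (norm P)\<^sup>2)"

text \<open>With \<open>P = p + q\<close> and \<open>r = rel_momentum p q / 2\<close>,
  \<open>cm_s r\<close> is \<open>s_inv p q\<close> and \<open>cm_energy P r\<close> is the total
  energy. The coefficient is \<open>(\<gamma> - 1) / |P|\<^sup>2\<close> with the denominator
  rationalised, a form that stays regular at \<open>P = 0\<close>.\<close>

definition cm_coeff :: "momentum \<Rightarrow> real \<Rightarrow> real" where
  "cm_coeff P r = 1 / (sqrt (cm_s r) * (cm_energy P r + sqrt (cm_s r)))"

text \<open>The spatial part of the Lorentz boost of the vector with momentum \<open>\<xi>\<close>
  and energy \<open>sqrt (cm_s (norm \<xi>)) / 2\<close> into the frame where the pair has total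
  momentum \<open>P\<close>. The partner \<open>P - cm_map P \<xi>\<close> is the boost of
  \<open>- \<xi>\<close>.\<close>

definition cm_map :: "momentum \<Rightarrow> momentum \<Rightarrow> momentum" where
  "cm_map P \<xi> = (1 / 2) *\<^sub>R P + \<xi> + (cm_coeff P (norm \<xi>) * (P \<bullet> \<xi>)) *\<^sub>R P"

lemma cm_s_ge: "4 \<le> cm_s r"
  by (simp add: cm_s_def)

lemma cm_s_pos [simp]: "0 < cm_s r"
  using cm_s_ge[of r] by linarith

lemma cm_s_nonneg [simp]: "0 \<le> cm_s r"
  using cm_s_ge[of r] by linarith

lemma cm_energy_sq: "(cm_energy P r)\<^sup>2 = cm_s r + (norm P)\<^sup>2"
  by (simp add: cm_energy_def)

lemma cm_energy_pos [simp]: "0 < cm_energy P r"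
  unfolding cm_energy_def by (intro real_sqrt_gt_zero add_pos_nonneg) auto

lemma cm_coeff_pos [simp]: "0 < cm_coeff P r"
  unfolding cm_coeff_def by (intro divide_pos_pos mult_pos_pos add_pos_pos) auto

lemma cm_coeff_gamma: "1 + cm_coeff P r * (norm P)\<^sup>2 = cm_energy P r / sqrt (cm_s r)"
proof -
  let ?e = "cm_energy P r" and ?t = "sqrt (cm_s r)"
  have p: "?t > 0" "?e > 0" by simp_all
  have "(norm P)\<^sup>2 = ?e\<^sup>2 - ?t\<^sup>2" by (simp add: cm_energy_sq less_imp_le)
  then have "(norm P)\<^sup>2 = (?e - ?t) * (?e + ?t)" by (simp add: power2_eq_square algebra_simps)
  moreover have "1 + 1 / (t * (e + t)) * ((e - t) * (e + t)) = e / t" if "t > 0" "e > 0" for t e :: real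
  proof -
    have "e + t \<noteq> 0" using that by linarith
    then have "1 + 1 / (t * (e + t)) * ((e - t) * (e + t)) = 1 + (e - t) / t" by simp
    then show ?thesis using that by (simp add: field_simps)
  qed
  ultimately show ?thesis
    unfolding cm_coeff_def using p by metis
qed

text \<open>The relation \<open>\<gamma>\<^sup>2 = 1 + |P|\<^sup>2 / s\<close> after division by
  \<open>|P|\<^sup>2\<close>. It evaluates inner products of boosted vectors: for
  \<open>\<xi>\<close> and \<open>\<eta>\<close> of equal length the stretching along
  \<open>P\<close> adds \<open>(P \<bullet> \<xi>) * (P \<bullet> \<eta>) / s\<close> to
  \<open>\<xi> \<bullet> \<eta>\<close>.\<close>

lemma cm_coeff_quadratic: "2 * cm_coeff P r + (cm_coeff P r)\<^sup>2 * (norm P)\<^sup>2 = 1 / cm_s r"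
proof -
  let ?e = "cm_energy P r" and ?t = "sqrt (cm_s r)"
  have p: "?t > 0" "?e > 0" "?e + ?t \<noteq> 0" by (simp_all add: add_pos_pos less_imp_neq[symmetric])
  have "2 * cm_coeff P r + (cm_coeff P r)\<^sup>2 * (norm P)\<^sup>2 =
      cm_coeff P r * (1 + (1 + cm_coeff P r * (norm P)\<^sup>2))"
    by (simp add: power2_eq_square algebra_simps)
  also have "\<dots> = cm_coeff P r * (1 + ?e / ?t)" by (simp add: cm_coeff_gamma)
  also have "\<dots> = 1 / (?t * ?t)"
  proof -
    have "1 / (t * (e + t)) * (1 + e / t) = 1 / (t * t)" if "t > 0" "e > 0" for t e :: real
    proof -
      have "e + t \<noteq> 0" using that by linarith
      moreover have "1 + e / t = (e + t) / t" using that by (simp add: field_simps)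
      ultimately show ?thesis by simp
    qed
    then show ?thesis unfolding cm_coeff_def using p by metis
  qed
  finally show ?thesis by (simp add: less_imp_le)
qed

lemma cm_inner_le: "\<bar>P \<bullet> \<xi>\<bar> / sqrt (cm_s (norm \<xi>)) \<le> cm_energy P (norm \<xi>) / 2"
proof -
  have a: "norm P \<le> cm_energy P (norm \<xi>)"
    unfolding cm_energy_def by (intro real_le_rsqrt) (simp add: less_imp_le)
  have b: "2 * norm \<xi> \<le> sqrt (cm_s (norm \<xi>))"
    by (intro real_le_rsqrt) (simp add: cm_s_def power_mult_distrib)
  have "\<bar>P \<bullet> \<xi>\<bar> \<le> norm P * norm \<xi>" by (rule Cauchy_Schwarz_ineq2)
  also have "\<dots> \<le> cm_energy P (norm \<xi>) * (sqrt (cm_s (norm \<xi>)) / 2)"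
    using a b by (intro mult_mono) (auto simp: less_imp_le)
  finally show ?thesis
    by (simp add: pos_divide_le_eq)
qed

text \<open>The right side is the time component of the boosted vector. Its square is
  \<open>1 + (norm (cm_map P \<xi>))\<^sup>2\<close>, and \<open>cm_inner_le\<close> fixes the sign
  of the root.\<close>

lemma energy_cm_map:
  "energy (cm_map P \<xi>) = cm_energy P (norm \<xi>) / 2 + P \<bullet> \<xi> / sqrt (cm_s (norm \<xi>))"
proof -
  let ?e = "cm_energy P (norm \<xi>)" and ?t = "sqrt (cm_s (norm \<xi>))" and ?c = "cm_coeff P (norm \<xi>)"
  define x where "x = P \<bullet> \<xi>"
  have x': "\<xi> \<bullet> P = x" by (simp add: x_def inner_commute)
  have "(norm (cm_map P \<xi>))\<^sup>2 =
      (norm P)\<^sup>2 / 4 + (norm \<xi>)\<^sup>2 + x * (1 + ?c * (norm P)\<^sup>2) + x\<^sup>2 * (2 * ?c + ?c\<^sup>2 * (norm P)\<^sup>2)"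
    unfolding power2_norm_eq_inner cm_map_def
    by (simp add: inner_add_left inner_add_right x' x_def[symmetric] power2_eq_square field_simps)
  also have "\<dots> = (norm P)\<^sup>2 / 4 + (norm \<xi>)\<^sup>2 + x * (?e / ?t) + x\<^sup>2 * (1 / cm_s (norm \<xi>))"
    by (simp add: cm_coeff_gamma cm_coeff_quadratic)
  also have "1 + \<dots> = (?e / 2 + x / ?t)\<^sup>2"
    by (simp add: power2_sum power_divide cm_energy_sq less_imp_le) (simp add: cm_s_def add_divide_distrib)
  finally have "1 + (norm (cm_map P \<xi>))\<^sup>2 = (?e / 2 + x / ?t)\<^sup>2" .
  moreover have "\<bar>x\<bar> / ?t = \<bar>x / ?t\<bar>" by (simp add: abs_divide less_imp_le)
  then have "0 \<le> ?e / 2 + x / ?t"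
    using cm_inner_le[of P \<xi>] unfolding x_def by linarith
  ultimately show ?thesis by (simp add: energy_def x_def)
qed

lemma cm_map_minus: "P - cm_map P \<xi> = cm_map P (- \<xi>)"
proof -
  have "P = (1/2) *\<^sub>R P + (1/2) *\<^sub>R P" by (simp flip: scaleR_left_distrib)
  then show ?thesis by (simp add: cm_map_def algebra_simps)
qed

lemma s_inv_cm_map: "s_inv (cm_map P \<xi>) (P - cm_map P \<xi>) = cm_s (norm \<xi>)"
  using energy_cm_map[of P \<xi>] energy_cm_map[of P "- \<xi>"]
  by (simp add: s_inv_eq cm_map_minus[symmetric] cm_energy_sq)

lemma rel_momentum_cm_map: "rel_momentum (cm_map P \<xi>) (P - cm_map P \<xi>) = 2 * norm \<xi>"
proof (rule power2_eq_imp_eq)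
  show "(rel_momentum (cm_map P \<xi>) (P - cm_map P \<xi>))\<^sup>2 = (2 * norm \<xi>)\<^sup>2"
    using s_inv_cm_map[of P \<xi>] by (simp add: s_inv_def cm_s_def power_mult_distrib)
qed simp_all

lemma gamma_cm_cm_map:
  "gamma_cm (cm_map P \<xi>) (P - cm_map P \<xi>) = cm_energy P (norm \<xi>) / sqrt (cm_s (norm \<xi>))"
  using energy_cm_map[of P \<xi>] energy_cm_map[of P "- \<xi>"]
  by (simp add: gamma_cm_def s_inv_cm_map cm_map_minus[symmetric])

lemma post_p_cm_map:
  assumes "norm \<omega> = 1"
  shows "post_p (cm_map P \<xi>) (P - cm_map P \<xi>) \<omega> = cm_map P (norm \<xi> *\<^sub>R \<omega>)"
proof -
  let ?c = "cm_coeff P (norm \<xi>)"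
  \<comment> \<open>For \<open>P = 0\<close> both sides vanish together with
    \<open>P \<bullet> \<omega>\<close>, so the division by zero in \<open>deflection\<close> does
    no harm.\<close>
  have "(cm_energy P (norm \<xi>) / sqrt (cm_s (norm \<xi>)) - 1) * ((P \<bullet> \<omega>) / (norm P)\<^sup>2) = ?c * (P \<bullet> \<omega>)"
    by (cases "P = 0") (simp_all add: cm_coeff_gamma[symmetric])
  then have "deflection (cm_map P \<xi>) (P - cm_map P \<xi>) \<omega> = \<omega> + (?c * (P \<bullet> \<omega>)) *\<^sub>R P"
    by (simp add: deflection_def gamma_cm_cm_map)
  then show ?thesis
    using assms
    by (simp add: post_p_def rel_momentum_cm_map) (simp add: cm_map_def scaleR_right_distrib mult_ac)
qed

lemma post_q_eq: "post_q p q \<omega> = p + q - post_p p q \<omega>"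
  by (simp add: post_p_def post_q_def vec_eq_iff field_simps)

text \<open>The image determines \<open>norm \<xi>\<close> through
  \<open>rel_momentum_cm_map\<close>, and at fixed length the formula is affine with a positive
  definite linear part.\<close>

lemma cm_map_inj: "inj (cm_map P)"
proof (rule injI)
  fix \<xi> \<eta> assume eq: "cm_map P \<xi> = cm_map P \<eta>"
  have n: "norm \<xi> = norm \<eta>"
    using rel_momentum_cm_map[of P \<xi>] rel_momentum_cm_map[of P \<eta>] by (simp add: eq)
  let ?c = "cm_coeff P (norm \<eta>)"
  have e: "\<xi> - \<eta> + (?c * (P \<bullet> (\<xi> - \<eta>))) *\<^sub>R P = 0"
    using eq by (simp add: cm_map_def n algebra_simps inner_diff_right)
  then have "(\<xi> - \<eta> + (?c * (P \<bullet> (\<xi> - \<eta>))) *\<^sub>R P) \<bullet> (\<xi> - \<eta>) = 0" by simp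
  then have "(\<xi> - \<eta>) \<bullet> (\<xi> - \<eta>) + ?c * (P \<bullet> (\<xi> - \<eta>))\<^sup>2 = 0"
    by (simp only: inner_add_left inner_scaleR_left power2_eq_square mult.assoc)
  moreover have "0 \<le> ?c * (P \<bullet> (\<xi> - \<eta>))\<^sup>2" by (simp add: less_imp_le)
  ultimately have "(\<xi> - \<eta>) \<bullet> (\<xi> - \<eta>) = 0"
    by (smt (verit) inner_ge_zero)
  then show "\<xi> = \<eta>" by simp
qed

text \<open>A preimage must have length \<open>rel_momentum p q / 2\<close>. With this value
  inserted in the coefficient the equation becomes linear; it is solved, and the solution is then
  checked to have the presumed length.\<close>

lemma cm_map_surj: "surj (cm_map P)"
proof (unfold surj_def, intro allI)
  fix p
  define q where "q = P - p"
  have P: "P = p + q" by (simp add: q_def)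
  define r where "r = rel_momentum p q / 2"
  define c where "c = cm_coeff P r"
  have s: "cm_s r = s_inv p q" by (simp add: cm_s_def r_def s_inv_def power_divide)
  have e: "cm_energy P r = energy p + energy q"
    using energy_pos[of p] energy_pos[of q]
    by (simp add: cm_energy_def s s_inv_eq P add_nonneg_nonneg less_imp_le)
  define g where "g = cm_energy P r / sqrt (cm_s r)"
  have g: "1 + c * (norm P)\<^sup>2 = g" by (simp add: c_def g_def cm_coeff_gamma)
  have gpos: "g > 0" by (simp add: g_def)
  have c2: "c * (1 + g) = 1 / cm_s r"
    using cm_coeff_quadratic[of P r] g
    by (simp add: c_def[symmetric] power2_eq_square distrib_left flip: g)
  \<comment> \<open>Sherman-Morrison: the inverse of
    \<open>x \<mapsto> x + c (P \<bullet> x) P\<close> is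
    \<open>x \<mapsto> x - k (P \<bullet> x) P\<close> with
    \<open>k = c / (1 + c |P|\<^sup>2)\<close>.\<close>
  define k where "k = c / g"
  have k: "k * (norm P)\<^sup>2 = (g - 1) / g"
    using g by (simp add: k_def)
  have g1: "1 - (g - 1) / g = 1 / g" "2 - (g - 1) / g = (1 + g) / g"
    using gpos by (simp_all add: field_simps)
  define d where "d = (1/2) *\<^sub>R (p - q)"
  define \<xi> where "\<xi> = d - (k * (P \<bullet> d)) *\<^sub>R P"
  have "(energy p - energy q) * (energy p + energy q) = (p - q) \<bullet> P"
    using energy_sq[of p] energy_sq[of q]
    by (simp add: P power2_norm_eq_inner inner_diff_left inner_add_right inner_commute[of q p])
      (simp add: power2_eq_square algebra_simps)
  then have Pd: "P \<bullet> d = (energy p - energy q) * cm_energy P r / 2"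
    by (simp add: d_def e inner_commute)
  have "(norm \<xi>)\<^sup>2 = (norm d)\<^sup>2 - (P \<bullet> d)\<^sup>2 * k * (2 - k * (norm P)\<^sup>2)"
    unfolding power2_norm_eq_inner \<xi>_def
    by (simp add: inner_diff_left inner_diff_right inner_commute[of d P] power2_eq_square algebra_simps)
  also have "(P \<bullet> d)\<^sup>2 * k * (2 - k * (norm P)\<^sup>2) = (P \<bullet> d)\<^sup>2 * (c * (1 + g)) / g\<^sup>2"
    unfolding k g1 by (simp add: k_def power2_eq_square)
  also have "\<dots> = (energy p - energy q)\<^sup>2 / 4"
  proof -
    have "(P \<bullet> d)\<^sup>2 * (c * (1 + g)) / g\<^sup>2 = (P \<bullet> d)\<^sup>2 * (1 / cm_s r) / ((cm_energy P r)\<^sup>2 / cm_s r)"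
      unfolding c2 by (simp add: g_def power_divide less_imp_le)
    also have "\<dots> = (P \<bullet> d)\<^sup>2 / (cm_energy P r)\<^sup>2" using cm_s_pos[of r] by (simp add: less_imp_neq[symmetric])
    finally show ?thesis using cm_energy_pos[of P r] by (simp add: Pd power_divide power_mult_distrib)
  qed
  also have "(norm d)\<^sup>2 - \<dots> = r\<^sup>2"
  proof -
    have "norm d = norm (p - q) / 2" by (simp add: d_def)
    then have "(norm d)\<^sup>2 = (norm (p - q))\<^sup>2 / 4" by (simp only: power_divide) simp
    moreover have "r\<^sup>2 = (rel_momentum p q)\<^sup>2 / 4"
      by (simp add: r_def power_divide)
    ultimately show ?thesis
      using rel_momentum_radicand[of p q] rel_momentum_sq[of p q] by linarith
  qed
  finally have n: "norm \<xi> = r"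
    by (rule power2_eq_imp_eq) (simp_all add: r_def)
  have "P \<bullet> \<xi> = P \<bullet> d * (1 - k * (norm P)\<^sup>2)"
    by (simp add: \<xi>_def inner_diff_right power2_norm_eq_inner algebra_simps)
  also have "\<dots> = (P \<bullet> d) / g"
    by (simp add: k g1)
  finally have "c * (P \<bullet> \<xi>) = k * (P \<bullet> d)" by (simp add: k_def)
  then have "cm_map P \<xi> = (1/2) *\<^sub>R P + d"
    by (simp add: cm_map_def n c_def[symmetric]) (simp add: \<xi>_def)
  also have "\<dots> = p"
    by (simp add: P d_def vec_eq_iff field_simps)
  finally show "\<exists>\<xi>. p = cm_map P \<xi>" by metis
qed

lemma cm_map_cases:
  obtains P \<xi> where "p = cm_map P \<xi>" "q = P - cm_map P \<xi>" "P = p + q"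
    "norm \<xi> = rel_momentum p q / 2"
proof -
  obtain \<xi> where "p = cm_map (p + q) \<xi>" using cm_map_surj[of "p + q"] by (metis surjD)
  then show ?thesis
    using that[of "p + q" \<xi>] rel_momentum_cm_map[of "p + q" \<xi>] by simp
qed

section \<open>Energy conservation and the scattering angle\<close>

lemma energy_post:
  assumes "norm \<omega> = 1"
  shows "energy (post_p p q \<omega>) + energy (post_q p q \<omega>) = energy p + energy q"
proof -
  obtain P \<xi> where P: "p = cm_map P \<xi>" "q = P - cm_map P \<xi>"
    by (rule cm_map_cases)
  show ?thesis
    using assms
    by (simp add: P post_q_eq post_p_cm_map) (simp add: cm_map_minus energy_cm_map)
qed

text \<open>The numerator is the Lorentz product of \<open>p - q\<close> and \<open>p' - q'\<close>.
  It equals its value in the centre-of-mass frame, four times the Euclidean product of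
  \<open>\<xi>\<close> and \<open>norm \<xi> *\<^sub>R \<omega>\<close>, so the witness is the
  direction of \<open>\<xi>\<close> and the scattering angle is the ordinary angle between
  \<open>\<xi>\<close> and \<open>\<omega>\<close>.\<close>

lemma cos_scatter_eq:
  assumes "p \<noteq> q"
  obtains k where "norm k = 1" "\<And>\<omega>. norm \<omega> = 1 \<Longrightarrow> cos_scatter p q \<omega> = k \<bullet> \<omega>"
proof -
  obtain P \<xi> where P: "p = cm_map P \<xi>" "q = P - cm_map P \<xi>" "norm \<xi> = rel_momentum p q / 2"
    by (rule cm_map_cases)
  define r where "r = norm \<xi>"
  have "cm_map P 0 = P - cm_map P 0" by (simp add: cm_map_minus)
  then have "\<xi> \<noteq> 0" using P assms by auto
  then have r: "r > 0" by (simp add: r_def)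
  show ?thesis
  proof
    show "norm ((1 / r) *\<^sub>R \<xi>) = 1" using r by (simp add: r_def)
    fix \<omega> :: momentum assume \<omega>: "norm \<omega> = 1"
    let ?\<eta> = "r *\<^sub>R \<omega>"
    let ?c = "cm_coeff P r"
    have n: "norm ?\<eta> = r" using \<omega> r by simp
    have pp: "post_p p q \<omega> = cm_map P ?\<eta>"
      using \<omega> by (simp add: P post_p_cm_map r_def)
    have pq: "post_q p q \<omega> = cm_map P (- ?\<eta>)"
      by (simp add: post_q_eq pp) (simp add: P cm_map_minus[symmetric])
    have q: "q = cm_map P (- \<xi>)" by (simp add: P cm_map_minus)
    have d: "cm_map P x - cm_map P (- x) = 2 *\<^sub>R (x + (cm_coeff P (norm x) * (P \<bullet> x)) *\<^sub>R P)" for x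
      by (simp add: cm_map_def vec_eq_iff algebra_simps)
    have ed: "energy (cm_map P x) - energy (cm_map P (- x)) = 2 * (P \<bullet> x) / sqrt (cm_s (norm x))" for x
      by (simp add: energy_cm_map)
    have "(p - q) \<bullet> (post_p p q \<omega> - post_q p q \<omega>) =
        4 * (\<xi> \<bullet> ?\<eta> + (P \<bullet> \<xi>) * (P \<bullet> ?\<eta>) * (2 * ?c + ?c\<^sup>2 * (norm P)\<^sup>2))"
      unfolding pp pq unfolding q unfolding P(1) d power2_norm_eq_inner n r_def[symmetric]
      by (simp add: inner_add_left inner_add_right inner_commute[of \<xi> P] power2_eq_square algebra_simps)
    also have "\<dots> = 4 * (\<xi> \<bullet> ?\<eta> + (P \<bullet> \<xi>) * (P \<bullet> ?\<eta>) / cm_s r)"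
      by (simp add: cm_coeff_quadratic)
    moreover have "(energy p - energy q) * (energy (post_p p q \<omega>) - energy (post_q p q \<omega>)) =
        4 * ((P \<bullet> \<xi>) * (P \<bullet> ?\<eta>) / cm_s r)"
      unfolding pp pq unfolding q unfolding P(1) ed n r_def[symmetric] by (simp add: less_imp_le)
    moreover have "rel_momentum p q = 2 * r" using P(3) by (simp add: r_def)
    ultimately have "cos_scatter p q \<omega> = 4 * (\<xi> \<bullet> ?\<eta>) / (2 * r)\<^sup>2"
      unfolding cos_scatter_def by (simp only: minus_mult_left[symmetric] distrib_left) simp
    then show "cos_scatter p q \<omega> = (1 / r) *\<^sub>R \<xi> \<bullet> \<omega>"
      using r by (simp add: power2_eq_square)
  qed
qed

lemma abs_cos_scatter_le:
  assumes "norm \<omega> = 1"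
  shows "\<bar>cos_scatter p q \<omega>\<bar> \<le> 1"
proof (cases "p = q")
  case True
  \<comment> \<open>The denominator is 0 here and the quotient takes its default value.\<close>
  then have "cos_scatter p q \<omega> = 0" by (simp add: cos_scatter_def rel_momentum_def)
  then show ?thesis by simp
next
  case False
  then obtain k where "norm k = 1" "cos_scatter p q \<omega> = k \<bullet> \<omega>"
    using cos_scatter_eq assms by metis
  then show ?thesis using Cauchy_Schwarz_ineq2[of k \<omega>] assms by simp
qed

lemma scatter_angle_range:
  assumes "norm \<omega> = 1"
  shows "scatter_angle p q \<omega> \<in> {0..pi}"
proof -
  have "- 1 \<le> cos_scatter p q \<omega>" "cos_scatter p q \<omega> \<le> 1"
    using abs_cos_scatter_le[OF assms, of p q] by linarith+
  from arccos_bounded[OF this] show ?thesis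
    unfolding scatter_angle_def atLeastAtMost_iff .
qed

subsection \<open>Sphere measure and change of variables\<close>

lemma distr_lborel_orthogonal3:
  fixes T :: "momentum \<Rightarrow> momentum"
  assumes T: "orthogonal_transformation T"
  shows "distr lborel borel T = lborel"
proof (rule lborel_eqI[symmetric])
  have lin: "linear T" using T by (rule orthogonal_transformation_linear)
  then have "continuous_on UNIV T" by (intro linear_continuous_on) (simp add: linear_linear)
  then have Tm: "T \<in> borel_measurable borel" by (rule borel_measurable_continuous_onI)
  show "sets (distr lborel borel T) = sets borel" by simp
  fix l u :: momentum
  assume lu: "\<And>b. b \<in> Basis \<Longrightarrow> l \<bullet> b \<le> u \<bullet> b"
  have T': "orthogonal_transformation (inv T)"
    using T by (rule orthogonal_transformation_inv)
  have eq: "T -` box l u = inv T ` box l u"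
    using T by (simp add: bij_vimage_eq_inv_image orthogonal_transformation_bij)
  have "T -` box l u \<in> sets borel" using measurable_sets[OF Tm, of "box l u"] by simp
  then have "emeasure lborel (T -` box l u) = emeasure lebesgue (inv T ` box l u)"
    by (simp add: eq)
  also have "\<dots> = ennreal (measure lebesgue (inv T ` box l u))"
    using measurable_orthogonal_image[OF T', of "box l u"]
    by (simp add: emeasure_eq_measure2 fmeasurableD2)
  also have "measure lebesgue (inv T ` box l u) = (\<Prod>b\<in>Basis. (u - l) \<bullet> b)"
    using lu by (subst measure_orthogonal_image[OF T']) (simp_all add: measure_lborel_box_eq inner_diff_left)
  finally show "emeasure (distr lborel borel T) (box l u) = ennreal (\<Prod>b\<in>Basis. (u - l) \<bullet> b)"
    using Tm by (subst emeasure_distr) auto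
qed

lemma borel_measurable_orthogonal:
  fixes T :: "'a::euclidean_space \<Rightarrow> 'a"
  assumes "orthogonal_transformation T"
  shows "T \<in> borel_measurable borel"
  using orthogonal_transformation_linear[OF assms]
  by (intro borel_measurable_continuous_onI linear_continuous_on) (simp add: linear_linear)

lemma borel_measurable_sgn [measurable]: "(sgn :: momentum \<Rightarrow> momentum) \<in> borel_measurable borel"
  unfolding sgn_div_norm by measurable

lemma sets_sphere_measure [simp, measurable_cong]: "sets sphere_measure = sets borel"
  by (simp add: sphere_measure_def)

lemma space_sphere_measure [simp]: "space sphere_measure = UNIV"
  by (simp add: sphere_measure_def)

lemma finite_measure_sphere_measure: "finite_measure sphere_measure"
  by (rule finite_measureI) (simp add: emeasure_sphere_measure_UNIV)

interpretation sphere_measure: finite_measure sphere_measure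
  by (rule finite_measure_sphere_measure)

lemma distr_sphere_measure_orthogonal:
  assumes T: "orthogonal_transformation T"
  shows "distr sphere_measure borel T = sphere_measure"
proof (rule measure_eqI)
  fix A assume "A \<in> sets (distr sphere_measure borel T)"
  then have A: "A \<in> sets borel" by simp
  note Tm = borel_measurable_orthogonal[OF T]
  have TA: "T -` A \<in> sets borel" using measurable_sets[OF Tm A] by simp
  have nT: "norm (T x) = norm x" for x
    using T by (simp add: orthogonal_transformation)
  have sT: "sgn (T x) = T (sgn x)" for x
    using linear_scale[OF orthogonal_transformation_linear[OF T]] by (simp add: sgn_div_norm nT)
  have "emeasure sphere_measure A = 3 * emeasure (distr lborel borel T) (ball 0 1 \<inter> sgn -` A)"
    by (simp add: emeasure_sphere_measure[OF A] distr_lborel_orthogonal3[OF T])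
  also have "emeasure (distr lborel borel T) (ball 0 1 \<inter> sgn -` A) = emeasure lborel (ball 0 1 \<inter> sgn -` (T -` A))"
    using measurable_sets[OF borel_measurable_sgn A] Tm
    by (subst emeasure_distr) (auto intro!: arg_cong2[where f=emeasure] simp: nT sT)
  also have "3 * \<dots> = emeasure (distr sphere_measure borel T) A"
    using Tm A TA by (simp add: emeasure_distr emeasure_sphere_measure)
  finally show "emeasure (distr sphere_measure borel T) A = emeasure sphere_measure A" ..
qed simp

text \<open>Some orthogonal map carries \<open>k\<close> to \<open>l\<close>. This later replaces
  the direction in \<open>cos_scatter_eq\<close>, which varies with \<open>p\<close> and
  \<open>q\<close>, by the third axis.\<close>

lemma nn_integral_sphere_measure_inner:
  fixes h :: "real \<Rightarrow> ennreal"
  assumes [measurable]: "h \<in> borel_measurable borel" and "norm k = 1" "norm l = 1"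
  shows "(\<integral>\<^sup>+\<omega>. h (k \<bullet> \<omega>) \<partial>sphere_measure) = (\<integral>\<^sup>+\<omega>. h (l \<bullet> \<omega>) \<partial>sphere_measure)"
proof -
  obtain T where T: "orthogonal_transformation T" "T k = l"
    using orthogonal_transformation_exists[of k l] assms by auto
  have [measurable]: "T \<in> borel_measurable borel" by (rule borel_measurable_orthogonal[OF T(1)])
  have "(\<integral>\<^sup>+\<omega>. h (l \<bullet> \<omega>) \<partial>sphere_measure) = (\<integral>\<^sup>+\<omega>. h (l \<bullet> \<omega>) \<partial>distr sphere_measure borel T)"
    by (simp add: distr_sphere_measure_orthogonal[OF T(1)])
  also have "\<dots> = (\<integral>\<^sup>+\<omega>. h (T k \<bullet> T \<omega>) \<partial>sphere_measure)"
    by (subst nn_integral_distr) (auto simp: T(2))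
  also have "\<dots> = (\<integral>\<^sup>+\<omega>. h (k \<bullet> \<omega>) \<partial>sphere_measure)"
    using T(1) by (simp add: orthogonal_transformation_def)
  finally show ?thesis ..
qed

section \<open>Polar coordinates\<close>

lemma emeasure_cone:
  assumes A: "A \<in> sets borel" and r: "0 \<le> r"
  shows "emeasure lborel {x. norm x < r \<and> sgn x \<in> A} = ennreal (r ^ 3 / 3) * emeasure sphere_measure A"
proof (cases "r = 0")
  case False
  with r have r: "r > 0" by simp
  have V[measurable]: "sgn -` A \<in> sets borel"
    using measurable_sets[OF borel_measurable_sgn A] by simp
  have B: "{x. norm x < r \<and> sgn x \<in> A} \<in> sets borel"
  proof -
    have "{x. norm x < r \<and> sgn x \<in> A} = ball 0 r \<inter> sgn -` A" by auto
    then show ?thesis by simp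
  qed
  have "emeasure lborel {x. norm x < r \<and> sgn x \<in> A} =
     emeasure (density (distr lborel borel (\<lambda>x. 0 + r *\<^sub>R x)) (\<lambda>_. \<bar>r\<bar>^DIM(momentum))) {x. norm x < r \<and> sgn x \<in> A}"
    using r by (subst lborel_affine[of r 0]) auto
  also have "\<dots> = ennreal (r ^ 3) * emeasure lborel ((\<lambda>x. r *\<^sub>R x) -` {x. norm x < r \<and> sgn x \<in> A})"
    using r B by (simp add: emeasure_density nn_integral_cmult_indicator emeasure_distr ennreal_power)
  also have "(\<lambda>x. r *\<^sub>R x) -` {x. norm x < r \<and> sgn x \<in> A} = ball 0 1 \<inter> sgn -` A"
    using r by (auto simp: sgn_scaleR sgn_if)
  also have "ennreal (r ^ 3) * emeasure lborel (ball 0 1 \<inter> sgn -` A) =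
     ennreal (r ^ 3 / 3) * (ennreal 3 * emeasure lborel (ball 0 1 \<inter> sgn -` A))"
    using r by (simp add: mult.assoc[symmetric] flip: ennreal_mult del: ennreal_numeral)
  finally show ?thesis by (simp add: emeasure_sphere_measure[OF A])
qed simp

text \<open>This is \<open>r\<^sup>2 dr\<close> on the half-line: the law of the norm under
  \<open>lborel\<close>, divided by the area of the unit sphere.\<close>

definition radial_measure :: "real measure" where
  "radial_measure = density (distr lborel borel (norm :: momentum \<Rightarrow> real)) (\<lambda>_. ennreal (1 / (4 * pi)))"

lemma emeasure_radial_measure_lessThan:
  assumes "0 \<le> r"
  shows "emeasure radial_measure {..<r} = ennreal (r ^ 3 / 3)"
proof -
  have "emeasure radial_measure {..<r} = ennreal (1 / (4 * pi)) * emeasure lborel {x::momentum. norm x < r}"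
    by (simp add: radial_measure_def emeasure_density nn_integral_cmult_indicator emeasure_distr vimage_def)
  also have "\<dots> = ennreal (1 / (4 * pi)) * (ennreal (r ^ 3 / 3) * ennreal (4 * pi))"
    using emeasure_cone[of UNIV r] assms by (simp add: emeasure_sphere_measure_UNIV)
  also have "\<dots> = ennreal (r ^ 3 / 3)"
    using assms by (simp flip: ennreal_mult)
  finally show ?thesis .
qed

lemma sigma_finite_radial_measure: "sigma_finite_measure radial_measure"
proof
  show "\<exists>A. countable A \<and> A \<subseteq> sets radial_measure \<and> \<Union> A = space radial_measure \<and>
      (\<forall>a\<in>A. emeasure radial_measure a \<noteq> \<infinity>)"
  proof (intro exI conjI)
    show "\<Union> (range (\<lambda>n. {..<real n})) = space radial_measure"
      using reals_Archimedean2 by (auto simp: radial_measure_def)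
    show "\<forall>a\<in>range (\<lambda>n. {..<real n}). emeasure radial_measure a \<noteq> \<infinity>"
      by (auto simp: emeasure_radial_measure_lessThan)
  qed (auto simp: radial_measure_def)
qed

interpretation radial_measure: sigma_finite_measure radial_measure
  by (rule sigma_finite_radial_measure)

lemma sets_radial_measure [simp, measurable_cong]: "sets radial_measure = sets borel"
  by (simp add: radial_measure_def)

lemma borel_eq_lessThan_real: "borel = sigma UNIV (range (lessThan :: real \<Rightarrow> _))"
  using borel_eq_lessThan[where 'a=real] by (simp add: eucl_less_def lessThan_def)

text \<open>For a fixed set \<open>A\<close> of directions both sides are measures in the radial
  set. They agree on half-lines by \<open>emeasure_cone\<close>, and half-lines form an
  intersection-stable generator.\<close>

lemma polar_measure:
  "radial_measure \<Otimes>\<^sub>M sphere_measure = distr lborel (borel \<Otimes>\<^sub>M borel) (\<lambda>x. (norm x, sgn x))"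
proof (rule pair_measure_eqI)
  show "sigma_finite_measure sphere_measure" ..
  fix B A assume "B \<in> sets radial_measure" "A \<in> sets sphere_measure"
  then have B[measurable]: "B \<in> sets borel" and A[measurable]: "A \<in> sets borel" by simp_all
  have V[measurable]: "sgn -` A \<in> sets borel"
    using measurable_sets[OF borel_measurable_sgn A] by simp
  define M where "M = distr (density lborel (indicator (sgn -` A))) borel (norm :: momentum \<Rightarrow> real)"
  define N where "N = density radial_measure (\<lambda>_. emeasure sphere_measure A)"
  have M: "emeasure M X = emeasure lborel {x. norm x \<in> X \<and> sgn x \<in> A}" if [measurable]: "X \<in> sets borel" for X
  proof -
    have "norm -` X \<in> sets (borel :: momentum measure)"
      using measurable_sets[of norm borel borel X] by simp
    then show ?thesis
      using that by (simp add: M_def emeasure_distr emeasure_density flip: indicator_inter_arith)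
        (auto intro!: arg_cong2[where f=emeasure])
  qed
  have N: "emeasure N X = emeasure radial_measure X * emeasure sphere_measure A" if "X \<in> sets borel" for X
  proof -
    have "emeasure N X = (\<integral>\<^sup>+x. emeasure sphere_measure A * indicator X x \<partial>radial_measure)"
      unfolding N_def using that by (subst emeasure_density) auto
    also have "\<dots> = emeasure sphere_measure A * emeasure radial_measure X"
      using that by (subst nn_integral_cmult_indicator) auto
    finally show ?thesis by (simp add: mult.commute)
  qed
  have eq: "emeasure M {..<r} = emeasure N {..<r}" for r
  proof (cases "0 \<le> r")
    case True
    then show ?thesis using emeasure_cone[OF A True]
      by (simp add: M N emeasure_radial_measure_lessThan)
  next
    case False
    then have "emeasure radial_measure {..<r} \<le> emeasure radial_measure {..<0}"
      by (intro emeasure_mono) auto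
    then have "emeasure radial_measure {..<r} = 0"
      by (simp add: emeasure_radial_measure_lessThan)
    moreover have "{x. norm x < r \<and> sgn x \<in> A} = {}" using False by (auto simp: not_le) (smt (verit) norm_ge_zero)
    then have "emeasure M {..<r} = 0" by (subst M) (simp, simp only: lessThan_iff emeasure_empty)
    ultimately show ?thesis by (simp add: N)
  qed
  have "M = N"
  proof (rule measure_eqI_generator_eq[where E = "range lessThan" and \<Omega> = UNIV and A = "\<lambda>n. {..<real n}"])
    show "Int_stable (range (lessThan :: real \<Rightarrow> _))"
    proof -
      have "{..<a} \<inter> {..<b} = {..<min a b}" for a b :: real by auto
      then show ?thesis by (auto simp: Int_stable_def)
    qed
    show "sets M = sigma_sets UNIV (range lessThan)" "sets N = sigma_sets UNIV (range lessThan)"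
      by (simp_all add: M_def N_def) (simp_all add: borel_eq_lessThan_real)
    show "(\<Union>i. {..<real i}) = UNIV" using reals_Archimedean2 by auto
    show "emeasure M {..<real i} \<noteq> \<infinity>" for i
      by (simp add: eq N emeasure_radial_measure_lessThan ennreal_mult_eq_top_iff)
  qed (auto simp: eq)
  then have "emeasure M B = emeasure N B" by simp
  then show "emeasure radial_measure B * emeasure sphere_measure A =
      emeasure (distr lborel (borel \<Otimes>\<^sub>M borel) (\<lambda>x. (norm x, sgn x))) (B \<times> A)"
    by (subst emeasure_distr) (auto simp: M N vimage_def)
qed (auto intro: sigma_finite_radial_measure cong: sets_pair_measure_cong)

lemma nn_integral_polar:
  fixes h :: "real \<Rightarrow> momentum \<Rightarrow> ennreal"
  assumes [measurable]: "(\<lambda>(r, \<omega>). h r \<omega>) \<in> borel_measurable (borel \<Otimes>\<^sub>M borel)"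
  shows "(\<integral>\<^sup>+x. h (norm x) (sgn x) \<partial>lborel) = (\<integral>\<^sup>+r. \<integral>\<^sup>+\<omega>. h r \<omega> \<partial>sphere_measure \<partial>radial_measure)"
proof -
  have "(\<integral>\<^sup>+r. \<integral>\<^sup>+\<omega>. h r \<omega> \<partial>sphere_measure \<partial>radial_measure) =
      (\<integral>\<^sup>+z. (\<lambda>(r, \<omega>). h r \<omega>) z \<partial>(radial_measure \<Otimes>\<^sub>M sphere_measure))"
    by (subst sphere_measure.nn_integral_fst[symmetric]) auto
  also have "\<dots> = (\<integral>\<^sup>+x. h (norm x) (sgn x) \<partial>lborel)"
    unfolding polar_measure by (subst nn_integral_distr) auto
  finally show ?thesis ..
qed

text \<open>In polar coordinates the direction of \<open>\<xi>\<close> and the vector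
  \<open>\<omega>\<close> are independent points of the sphere with the same law, so Fubini
  exchanges them. The symmetry between pre- and post-collisional momenta rests on this.\<close>

lemma nn_integral_swap_direction:
  fixes h :: "real \<Rightarrow> momentum \<Rightarrow> momentum \<Rightarrow> ennreal"
  assumes h: "(\<lambda>(r, k, \<omega>). h r k \<omega>) \<in> borel_measurable (borel \<Otimes>\<^sub>M borel \<Otimes>\<^sub>M borel)"
  shows "(\<integral>\<^sup>+\<xi>. \<integral>\<^sup>+\<omega>. h (norm \<xi>) (sgn \<xi>) \<omega> \<partial>sphere_measure \<partial>lborel) =
         (\<integral>\<^sup>+\<xi>. \<integral>\<^sup>+\<omega>. h (norm \<xi>) \<omega> (sgn \<xi>) \<partial>sphere_measure \<partial>lborel)"
proof -
  interpret SS: pair_sigma_finite sphere_measure sphere_measure ..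
  have [measurable (raw)]: "(\<lambda>x. h (a x) (b x) (c x)) \<in> borel_measurable M"
    if "a \<in> borel_measurable M" "b \<in> borel_measurable M" "c \<in> borel_measurable M" for a b c and M :: "'z measure"
    using measurable_compose[OF measurable_Pair[OF that(1) measurable_Pair[OF that(2,3)]] h] by simp
  have "(\<integral>\<^sup>+\<xi>. \<integral>\<^sup>+\<omega>. h (norm \<xi>) (sgn \<xi>) \<omega> \<partial>sphere_measure \<partial>lborel) =
      (\<integral>\<^sup>+r. \<integral>\<^sup>+k. \<integral>\<^sup>+\<omega>. h r k \<omega> \<partial>sphere_measure \<partial>sphere_measure \<partial>radial_measure)"
    by (rule nn_integral_polar) measurable
  also have "\<dots> = (\<integral>\<^sup>+r. \<integral>\<^sup>+k. \<integral>\<^sup>+\<omega>. h r \<omega> k \<partial>sphere_measure \<partial>sphere_measure \<partial>radial_measure)"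
    by (intro nn_integral_cong SS.Fubini') measurable
  also have "\<dots> = (\<integral>\<^sup>+\<xi>. \<integral>\<^sup>+\<omega>. h (norm \<xi>) \<omega> (sgn \<xi>) \<partial>sphere_measure \<partial>lborel)"
    by (rule nn_integral_polar[symmetric]) measurable
  finally show ?thesis .
qed

section \<open>Orthonormal coordinates and slices of the sphere\<close>

lemma borel_measurable_frame3:
  fixes u v n :: momentum
  shows "(\<lambda>(y :: real ^ 2, t). y $ 1 *\<^sub>R u + y $ 2 *\<^sub>R v + t *\<^sub>R n) \<in> borel_measurable (borel \<Otimes>\<^sub>M borel)"
  unfolding borel_prod case_prod_beta by (intro borel_measurable_continuous_onI continuous_intros)

lemma distr_lborel_frame3:
  fixes u v n :: momentum
  assumes "norm u = 1" "norm v = 1" "norm n = 1" "u \<bullet> v = 0" "u \<bullet> n = 0" "v \<bullet> n = 0"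
  shows "distr (lborel \<Otimes>\<^sub>M lborel) borel (\<lambda>(y :: real ^ 2, t). y $ 1 *\<^sub>R u + y $ 2 *\<^sub>R v + t *\<^sub>R n) = lborel"
proof -
  \<comment> \<open>The coordinate axes are treated first, where a box is a product of boxes; a
    general orthonormal frame is their image under the orthogonal map \<open>T\<close>
    below.\<close>
  let ?J = "\<lambda>(y :: real ^ 2, t). vector [y $ 1, y $ 2, t] :: momentum"
  have Jeq: "?J = (\<lambda>z. fst z $ 1 *\<^sub>R axis 1 1 + fst z $ 2 *\<^sub>R axis 2 1 + snd z *\<^sub>R axis 3 1)"
    by (simp add: fun_eq_iff vec_eq_iff forall_3 axis_def split: prod.split)
  have J[measurable]: "?J \<in> borel_measurable (borel \<Otimes>\<^sub>M borel)"
    unfolding Jeq borel_prod by (intro borel_measurable_continuous_onI continuous_intros)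
  have "distr (lborel \<Otimes>\<^sub>M lborel) borel ?J = lborel"
  proof (rule lborel_eqI[symmetric])
    fix l r :: momentum
    assume lr: "\<And>b. b \<in> Basis \<Longrightarrow> l \<bullet> b \<le> r \<bullet> b"
    then have lr': "l $ i \<le> r $ i" for i
      using lr[of "axis i 1"] by (simp add: cart_eq_inner_axis axis_in_Basis_iff)
    have "?J -` box l r = box (vector [l $ 1, l $ 2]) (vector [r $ 1, r $ 2]) \<times> {l $ 3<..<r $ 3}"
      by (auto simp: mem_box_cart forall_3 forall_2)
    then have "emeasure (distr (lborel \<Otimes>\<^sub>M lborel) borel ?J) (box l r) =
        emeasure lborel (box (vector [l $ 1, l $ 2]) (vector [r $ 1, r $ 2] :: real ^ 2)) * emeasure lborel {l $ 3<..<r $ 3}"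
      by (subst emeasure_distr) (simp_all add: space_pair_measure lborel.emeasure_pair_measure_Times)
    also have "emeasure lborel (box (vector [l $ 1, l $ 2]) (vector [r $ 1, r $ 2] :: real ^ 2)) =
        ennreal ((r $ 1 - l $ 1) * (r $ 2 - l $ 2))"
    proof (subst emeasure_lborel_box)
      show "vector [l $ 1, l $ 2] \<bullet> b \<le> (vector [r $ 1, r $ 2] :: real ^ 2) \<bullet> b" if bB: "b \<in> Basis" for b
      proof -
        obtain i where b: "b = axis i 1" using bB by (auto simp: Basis_vec_def)
        show ?thesis using lr' exhaust_2[of i] by (auto simp: b simp flip: cart_eq_inner_axis)
      qed
      have B: "(Basis :: (real ^ 2) set) = {axis 1 1, axis 2 1}"
        by (auto simp: Basis_vec_def) (metis exhaust_2)
      have "axis 1 (1::real) \<noteq> (axis 2 1 :: real ^ 2)" by (simp add: axis_eq_axis)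
      then show "ennreal (\<Prod>b\<in>Basis. (vector [r $ 1, r $ 2] - vector [l $ 1, l $ 2] :: real ^ 2) \<bullet> b) =
          ennreal ((r $ 1 - l $ 1) * (r $ 2 - l $ 2))"
        by (simp add: B flip: cart_eq_inner_axis)
    qed
    also have "\<dots> * emeasure lborel {l $ 3<..<r $ 3} = ennreal ((r $ 1 - l $ 1) * (r $ 2 - l $ 2) * (r $ 3 - l $ 3))"
      using lr' by (simp add: ennreal_mult)
    also have "(r $ 1 - l $ 1) * (r $ 2 - l $ 2) * (r $ 3 - l $ 3) = (\<Prod>b\<in>Basis. (r - l) \<bullet> b)"
    proof -
      have B: "(Basis :: momentum set) = {axis 1 1, axis 2 1, axis 3 1}"
        by (auto simp: Basis_vec_def) (metis exhaust_3)
      have "axis 1 (1::real) \<noteq> (axis 2 1 :: momentum)" "axis 1 (1::real) \<noteq> (axis 3 1 :: momentum)"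
        "axis 2 (1::real) \<noteq> (axis 3 1 :: momentum)" by (simp_all add: axis_eq_axis)
      then show ?thesis by (simp add: B flip: cart_eq_inner_axis)
    qed
    finally show "emeasure (distr (lborel \<Otimes>\<^sub>M lborel) borel ?J) (box l r) = ennreal (\<Prod>b\<in>Basis. (r - l) \<bullet> b)" .
  qed simp
  moreover define T where "T = (\<lambda>x::momentum. x $ 1 *\<^sub>R u + x $ 2 *\<^sub>R v + x $ 3 *\<^sub>R n)"
  have T: "orthogonal_transformation T"
    unfolding orthogonal_transformation
  proof
    show "linear T"
      by (rule linearI) (simp_all add: T_def algebra_simps)
    have one: "u \<bullet> u = 1" "v \<bullet> v = 1" "n \<bullet> n = 1" "v \<bullet> u = 0" "n \<bullet> u = 0" "n \<bullet> v = 0"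
      using assms by (simp_all add: dot_square_norm inner_commute)
    have "T x \<bullet> T x = x \<bullet> x" for x
    proof -
      have "x \<bullet> x = x $ 1 * x $ 1 + x $ 2 * x $ 2 + x $ 3 * x $ 3" by (simp add: inner_vec_def sum_3)
      then show ?thesis using one assms(4-6) by (simp add: T_def inner_add_left inner_add_right)
    qed
    then show "\<forall>x. norm (T x) = norm x"
      by (simp add: norm_eq_sqrt_inner)
  qed
  have "distr (distr (lborel \<Otimes>\<^sub>M lborel) borel ?J) borel T = lborel"
    unfolding \<open>distr (lborel \<Otimes>\<^sub>M lborel) borel ?J = lborel\<close> by (rule distr_lborel_orthogonal3[OF T])
  moreover have "distr (distr (lborel \<Otimes>\<^sub>M lborel) borel ?J) borel T =
      distr (lborel \<Otimes>\<^sub>M lborel) borel (T \<circ> ?J)"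
    by (rule distr_distr) (auto intro: borel_measurable_orthogonal[OF T])
  moreover have "T \<circ> ?J = (\<lambda>(y, t). y $ 1 *\<^sub>R u + y $ 2 *\<^sub>R v + t *\<^sub>R n)"
    by (auto simp: T_def)
  ultimately show ?thesis by simp
qed

text \<open>The area depends on the difference of the squared radii alone, which is why the slice
  bound below is uniform in the height of the slice. The bounds \<open>a\<close> and
  \<open>b\<close> may be negative, as happens at heights outside the unit ball.\<close>

lemma emeasure_annulus_le:
  assumes "a \<le> b"
  shows "emeasure lborel {y :: real ^ 2. a \<le> (norm y)\<^sup>2 \<and> (norm y)\<^sup>2 < b} \<le> ennreal (pi * (b - a))"
proof (cases "b \<le> 0")
  case True
  have "{y :: real ^ 2. a \<le> (norm y)\<^sup>2 \<and> (norm y)\<^sup>2 < b} = {}"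
  proof -
    have "\<not> (norm y)\<^sup>2 < b" for y :: "real ^ 2"
      using True zero_le_power2[of "norm y"] by linarith
    then show ?thesis by simp
  qed
  then show ?thesis by (simp only: emeasure_empty) simp
next
  case b: False
  have ball: "emeasure lborel (ball (0 :: real ^ 2) (sqrt c)) = ennreal (pi * c)" if "0 \<le> c" for c
    using that by (simp add: emeasure_ball unit_ball_vol_2)
  have lt: "(norm y)\<^sup>2 < c \<longleftrightarrow> y \<in> ball 0 (sqrt c)" for y :: "real ^ 2" and c
    by (simp add: real_less_rsqrt) (metis abs_norm_cancel real_sqrt_abs real_sqrt_less_iff)
  show ?thesis
  proof (cases "a \<le> 0")
    case True
    have "emeasure lborel {y :: real ^ 2. a \<le> (norm y)\<^sup>2 \<and> (norm y)\<^sup>2 < b} \<le> emeasure lborel (ball (0 :: real ^ 2) (sqrt b))"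
      by (intro emeasure_mono) (auto simp: lt)
    also have "\<dots> \<le> ennreal (pi * (b - a))"
      using b True by (subst ball) (auto intro!: ennreal_leI)
    finally show ?thesis .
  next
    case False
    have "{y :: real ^ 2. a \<le> (norm y)\<^sup>2 \<and> (norm y)\<^sup>2 < b} = ball 0 (sqrt b) - ball 0 (sqrt a)"
      unfolding lt[symmetric] Diff_iff set_eq_iff by (auto simp: lt[symmetric])
    moreover have "ball (0 :: real ^ 2) (sqrt a) \<subseteq> ball 0 (sqrt b)"
      using assms by (intro subset_ball) simp
    ultimately have "emeasure lborel {y :: real ^ 2. a \<le> (norm y)\<^sup>2 \<and> (norm y)\<^sup>2 < b} = ennreal (pi * b) - ennreal (pi * a)"
      using b False by (simp add: emeasure_Diff ball)
    also have "\<dots> = ennreal (pi * (b - a))"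
      using b False by (simp add: ennreal_minus algebra_simps)
    finally show ?thesis by simp
  qed
qed

text \<open>The slice \<open>{\<omega>. \<bar>\<omega> $ 3 - c\<bar> < \<delta>}\<close> of the sphere, thickened radially by \<open>\<delta>\<close>, is contained in a
  slab of width \<open>4 * \<delta>\<close> whose cross sections are annuli of area at most \<open>2 * pi * \<delta>\<close>.\<close>

lemma emeasure_sphere_slice_axis:
  assumes d: "0 < \<delta>" "\<delta> \<le> 1"
  shows "emeasure sphere_measure {\<omega>. \<bar>\<omega> $ 3 - c\<bar> < \<delta>} \<le> ennreal (24 * pi * \<delta>)"
proof -
  define A where "A = {\<omega> :: momentum. \<bar>\<omega> $ 3 - c\<bar> < \<delta>}"
  have A[measurable]: "A \<in> sets borel" unfolding A_def by measurable
  have V[measurable]: "{x. norm x < r \<and> sgn x \<in> A} \<in> sets borel" for r by measurable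
  let ?X = "\<lambda>r. {x. norm x < r \<and> sgn x \<in> A}"
  define S where "S = measure sphere_measure A"
  have S: "emeasure sphere_measure A = ennreal S"
    by (simp add: S_def sphere_measure.emeasure_eq_measure)
  define Y where "Y = {x :: momentum. \<bar>x $ 3 - c\<bar> < 2 * \<delta> \<and> 
     (1 - \<delta>)\<^sup>2 - (x $ 3)\<^sup>2 \<le> (x $ 1)\<^sup>2 + (x $ 2)\<^sup>2 \<and> (x $ 1)\<^sup>2 + (x $ 2)\<^sup>2 < 1 - (x $ 3)\<^sup>2}"
  have Y[measurable]: "Y \<in> sets borel" unfolding Y_def by measurable
  have norm3: "(norm x)\<^sup>2 = (x $ 1)\<^sup>2 + (x $ 2)\<^sup>2 + (x $ 3)\<^sup>2" for x :: momentum
    unfolding power2_norm_eq_inner by (simp add: inner_vec_def sum_3 power2_eq_square)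
  have norm2: "(norm x)\<^sup>2 = (x $ 1)\<^sup>2 + (x $ 2)\<^sup>2" for x :: "real ^ 2"
    unfolding power2_norm_eq_inner by (simp add: inner_vec_def sum_2 power2_eq_square)
  have "?X 1 - ?X (1 - \<delta>) \<subseteq> Y"
  proof
    fix x assume "x \<in> ?X 1 - ?X (1 - \<delta>)"
    then have x: "norm x < 1" "1 - \<delta> \<le> norm x" "\<bar>sgn x $ 3 - c\<bar> < \<delta>"
      by (auto simp: A_def)
    \<comment> \<open>Radial projection to the sphere moves the third coordinate by at most
      \<open>1 - norm x\<close>, hence by at most \<open>\<delta>\<close>; this doubles the
      half-width of the slice.\<close>
    have "x = norm x *\<^sub>R sgn x" by (cases "x = 0") (simp_all add: sgn_div_norm)
    then have "x $ 3 = norm x * sgn x $ 3" by (metis vector_scaleR_component real_scaleR_def)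
    moreover have "\<bar>sgn x $ 3\<bar> \<le> 1"
      using component_le_norm_cart[of "sgn x" 3] by (simp add: norm_sgn split: if_splits)
    ultimately have "\<bar>x $ 3 - sgn x $ 3\<bar> \<le> \<bar>norm x - 1\<bar> * 1"
      by (metis abs_ge_zero abs_mult left_diff_distrib mult_1 mult_left_mono)
    also have "\<dots> \<le> \<delta>" using x by simp
    finally have "\<bar>x $ 3 - c\<bar> < 2 * \<delta>" using x(3) by linarith
    moreover have "(1 - \<delta>)\<^sup>2 \<le> (norm x)\<^sup>2" "(norm x)\<^sup>2 < 1"
      using x d by (auto intro: power_mono simp: power_less_one_iff abs_square_less_1)
    ultimately show "x \<in> Y" by (simp add: Y_def norm3)
  qed
  then have "emeasure lborel (?X 1 - ?X (1 - \<delta>)) \<le> emeasure lborel Y"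
    by (intro emeasure_mono) auto
  also have "\<dots> \<le> ennreal (4 * \<delta> * (2 * pi * \<delta>))"
  proof -
    let ?F = "\<lambda>(y :: real ^ 2, t). y $ 1 *\<^sub>R axis 1 1 + y $ 2 *\<^sub>R axis 2 1 + t *\<^sub>R (axis 3 1 :: momentum)"
    have F: "?F (y, t) $ 1 = y $ 1" "?F (y, t) $ 2 = y $ 2" "?F (y, t) $ 3 = t" for y t
      by (simp_all add: axis_def)
    have mem: "?F (y, t) \<in> Y \<longleftrightarrow> \<bar>t - c\<bar> < 2 * \<delta> \<and> (1 - \<delta>)\<^sup>2 - t\<^sup>2 \<le> (norm y)\<^sup>2 \<and> (norm y)\<^sup>2 < 1 - t\<^sup>2" for y t
      by (simp only: Y_def mem_Collect_eq F norm2)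
    note borel_measurable_frame3[measurable]
    have "emeasure lborel Y = (\<integral>\<^sup>+x. indicator Y x \<partial>distr (lborel \<Otimes>\<^sub>M lborel) borel ?F)"
      by (subst distr_lborel_frame3) (auto simp: inner_axis_axis)
    also have "\<dots> = (\<integral>\<^sup>+z. indicator Y (?F z) \<partial>(lborel \<Otimes>\<^sub>M lborel))"
      by (subst nn_integral_distr) auto
    also have "\<dots> = (\<integral>\<^sup>+t. \<integral>\<^sup>+y. indicator Y (?F (y, t)) \<partial>lborel \<partial>lborel)"
      by (subst lborel_pair.nn_integral_snd[symmetric]) auto
    also have "\<dots> \<le> (\<integral>\<^sup>+t. ennreal (2 * pi * \<delta>) * indicator {c - 2 * \<delta><..<c + 2 * \<delta>} t \<partial>lborel)"
    proof (intro nn_integral_mono)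
      fix t
      let ?R = "{y :: real ^ 2. (1 - \<delta>)\<^sup>2 - t\<^sup>2 \<le> (norm y)\<^sup>2 \<and> (norm y)\<^sup>2 < 1 - t\<^sup>2}"
      have "(\<integral>\<^sup>+y. indicator Y (?F (y, t)) \<partial>lborel) \<le>
          (\<integral>\<^sup>+y. indicator {c - 2 * \<delta><..<c + 2 * \<delta>} t * indicator ?R y \<partial>lborel)"
        by (intro nn_integral_mono) (unfold indicator_def mem, auto)
      also have "\<dots> = indicator {c - 2 * \<delta><..<c + 2 * \<delta>} t * emeasure lborel ?R"
        by (subst nn_integral_cmult_indicator) auto
      also have "\<dots> \<le> ennreal (2 * pi * \<delta>) * indicator {c - 2 * \<delta><..<c + 2 * \<delta>} t"
      proof -
        have "emeasure lborel ?R \<le> ennreal (pi * ((1 - t\<^sup>2) - ((1 - \<delta>)\<^sup>2 - t\<^sup>2)))"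
          using d by (intro emeasure_annulus_le) (simp add: power_le_one)
        also have "\<dots> \<le> ennreal (pi * (2 * \<delta>))"
          by (intro ennreal_leI mult_left_mono) (simp_all add: power2_eq_square algebra_simps)
        finally have R: "emeasure lborel ?R \<le> ennreal (2 * pi * \<delta>)" by (simp add: mult_ac)
        show ?thesis by (subst mult.commute) (rule mult_right_mono[OF R], simp)
      qed
      finally show "(\<integral>\<^sup>+y. indicator Y (?F (y, t)) \<partial>lborel) \<le>
          ennreal (2 * pi * \<delta>) * indicator {c - 2 * \<delta><..<c + 2 * \<delta>} t" .
    qed
    also have "\<dots> = ennreal (2 * pi * \<delta>) * ennreal (4 * \<delta>)"
      using d by (subst nn_integral_cmult_indicator) auto
    also have "\<dots> = ennreal (4 * \<delta> * (2 * pi * \<delta>))"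
      using d by (simp add: mult.commute flip: ennreal_mult)
    finally show ?thesis .
  qed
  also have "emeasure lborel (?X 1 - ?X (1 - \<delta>)) = emeasure lborel (?X 1) - emeasure lborel (?X (1 - \<delta>))"
  proof (rule emeasure_Diff)
    show "emeasure lborel (?X (1 - \<delta>)) \<noteq> \<infinity>"
      using d by (simp add: emeasure_cone[OF A] S ennreal_mult_eq_top_iff)
  qed (use d in auto)
  also have "\<dots> = ennreal (1 / 3 * S - (1 - \<delta>) ^ 3 / 3 * S)"
    using d by (simp add: emeasure_cone[OF A] S S_def ennreal_minus flip: ennreal_mult)
  finally have "1 / 3 * S - (1 - \<delta>) ^ 3 / 3 * S \<le> 4 * \<delta> * (2 * pi * \<delta>)"
    using d by (subst (asm) ennreal_le_iff) auto
  \<comment> \<open>The shell over the slice has volume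
    \<open>(1 - (1 - \<delta>) ^ 3) * S / 3\<close>, which is at least
    \<open>\<delta> * S / 3\<close>. Comparison with the upper bound
    \<open>8 * pi * \<delta>\<^sup>2\<close> yields the constant 24.\<close>
  moreover have "\<delta> / 3 * S \<le> (1 / 3 - (1 - \<delta>) ^ 3 / 3) * S"
  proof (rule mult_right_mono)
    have "(1 - \<delta>) ^ 3 \<le> (1 - \<delta>) ^ 1" using d by (intro power_decreasing) auto
    then show "\<delta> / 3 \<le> 1 / 3 - (1 - \<delta>) ^ 3 / 3" by simp
  qed (simp add: S_def)
  ultimately have "\<delta> * S \<le> \<delta> * (24 * pi * \<delta>)" by (simp add: algebra_simps)
  then have "S \<le> 24 * pi * \<delta>" using d by simp
  then show ?thesis unfolding A_def[symmetric] S by (rule ennreal_leI)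
qed

text \<open>Division by \<open>norm b\<close>, which is at least 1, only narrows the strip, and
  rotation invariance brings \<open>b\<close> to the third axis. For \<open>\<delta> > 1\<close> the
  total mass \<open>4 * pi\<close> is small enough.\<close>

lemma emeasure_sphere_slice:
  assumes b: "1 \<le> norm b" and d: "0 < \<delta>"
  shows "emeasure sphere_measure {\<omega>. \<bar>b \<bullet> \<omega> - c\<bar> < \<delta>} \<le> ennreal (24 * pi * \<delta>)"
proof (cases "\<delta> \<le> 1")
  case True
  define k where "k = (1 / norm b) *\<^sub>R b"
  have b0: "norm b > 0" using b by linarith
  then have k: "norm k = 1" by (simp add: k_def)
  have eq: "b \<bullet> \<omega> - c = norm b * (k \<bullet> \<omega> - c / norm b)" for \<omega>
    using b0 by (simp add: k_def field_simps)
  have sub: "\<bar>k \<bullet> \<omega> - c / norm b\<bar> < \<delta>" if "\<bar>b \<bullet> \<omega> - c\<bar> < \<delta>" for \<omega>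
  proof -
    have "1 * \<bar>k \<bullet> \<omega> - c / norm b\<bar> \<le> norm b * \<bar>k \<bullet> \<omega> - c / norm b\<bar>"
      using b by (intro mult_right_mono) auto
    then show ?thesis using that unfolding eq abs_mult by simp
  qed
  let ?I = "{t. \<bar>t - c / norm b\<bar> < \<delta>}"
  have [measurable]: "?I \<in> sets borel" by measurable
  have "emeasure sphere_measure {\<omega>. \<bar>b \<bullet> \<omega> - c\<bar> < \<delta>} = (\<integral>\<^sup>+\<omega>. indicator {\<omega>. \<bar>b \<bullet> \<omega> - c\<bar> < \<delta>} \<omega> \<partial>sphere_measure)"
    by (subst nn_integral_indicator) auto
  also have "\<dots> \<le> (\<integral>\<^sup>+\<omega>. indicator ?I (k \<bullet> \<omega>) \<partial>sphere_measure)"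
    using sub by (intro nn_integral_mono) (auto split: split_indicator)
  also have "\<dots> = (\<integral>\<^sup>+\<omega>. indicator ?I (axis 3 1 \<bullet> \<omega>) \<partial>sphere_measure)"
    using k by (intro nn_integral_sphere_measure_inner) auto
  also have "\<dots> = (\<integral>\<^sup>+\<omega>. indicator {\<omega>. \<bar>\<omega> $ 3 - c / norm b\<bar> < \<delta>} \<omega> \<partial>sphere_measure)"
    by (intro nn_integral_cong) (auto simp: inner_axis' split: split_indicator)
  also have "\<dots> \<le> ennreal (24 * pi * \<delta>)"
    using emeasure_sphere_slice_axis[OF d True] by (subst nn_integral_indicator) auto
  finally show ?thesis .
next
  case False
  have "emeasure sphere_measure {\<omega>. \<bar>b \<bullet> \<omega> - c\<bar> < \<delta>} \<le> emeasure sphere_measure UNIV"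
    by (intro emeasure_mono) auto
  also have "\<dots> \<le> ennreal (24 * pi * \<delta>)"
    using False by (auto simp: emeasure_sphere_measure_UNIV intro!: ennreal_leI)
  finally show ?thesis .
qed

section \<open>Jacobian of the centre-of-mass coordinates\<close>

lemma distr_lborel_change_of_variables:
  fixes f :: "momentum \<Rightarrow> momentum"
  assumes der: "\<And>x. (f has_derivative f' x) (at x)" and "inj f" "surj f"
    and J: "\<And>x. J x = \<bar>det (matrix (f' x))\<bar>" and [measurable]: "J \<in> borel_measurable borel"
  shows "distr (density lborel (\<lambda>x. ennreal (J x))) borel f = lborel"
proof (rule lborel_eqI[symmetric])
  fix l u :: momentum
  assume lu: "\<And>b. b \<in> Basis \<Longrightarrow> l \<bullet> b \<le> u \<bullet> b"
  have [measurable]: "f \<in> borel_measurable borel"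
    using der by (intro borel_measurable_continuous_onI continuous_at_imp_continuous_on)
      (auto intro: has_derivative_continuous)
  let ?S = "f -` box l u"
  have S[measurable]: "?S \<in> sets borel" using measurable_sets[of f borel borel "box l u"] by simp
  have img: "f ` ?S = box l u" using assms(3) by (simp add: surj_image_vimage_eq)
  have "((\<lambda>x. \<bar>det (matrix (f' x))\<bar>) has_integral measure lebesgue (box l u)) ?S"
  proof (subst has_measure_differentiable_image[symmetric])
    show "?S \<in> sets lebesgue" using S by auto
    show "(f has_derivative f' x) (at x within ?S)" for x
      using der by (rule has_derivative_at_withinI)
    show "inj_on f ?S" using assms(2) by (rule inj_on_subset) simp
  qed (simp_all add: img assms(3))
  then have "(J has_integral measure lebesgue (box l u)) ?S"
    by (simp add: J[abs_def])
  then have "(\<integral>\<^sup>+x. indicator ?S x * J x \<partial>lborel) = ennreal (measure lebesgue (box l u))"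
    by (intro nn_integral_has_integral_lebesgue) (simp add: J)
  also have "(\<integral>\<^sup>+x. indicator ?S x * J x \<partial>lborel) = (\<integral>\<^sup>+x. ennreal (J x) * indicator ?S x \<partial>lborel)"
    by (intro nn_integral_cong) (auto split: split_indicator)
  finally show "emeasure (distr (density lborel (\<lambda>x. ennreal (J x))) borel f) (box l u) = ennreal (\<Prod>b\<in>Basis. (u - l) \<bullet> b)"
    using lu by (simp add: emeasure_distr emeasure_density measure_lborel_box_eq inner_diff_left)
qed simp

lemma cm_map_has_derivative:
  "(cm_map P has_derivative (\<lambda>h. h + (cm_coeff P (norm \<xi>) * (P \<bullet> h) +
      - 4 / ((sqrt (cm_s (norm \<xi>))) ^ 3 * cm_energy P (norm \<xi>)) * (\<xi> \<bullet> h) * (P \<bullet> \<xi>)) *\<^sub>R P)) (at \<xi>)"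
proof -
  define S where "S = (\<lambda>x::momentum. 4 + 4 * (x \<bullet> x))"
  define N where "N = (norm P)\<^sup>2"
  have c: "cm_coeff P (norm x) = inverse (sqrt (S x) * (sqrt (S x + N) + sqrt (S x)))" for x
    by (simp add: cm_coeff_def cm_energy_def cm_s_def S_def N_def power2_norm_eq_inner divide_inverse)
  have S0: "S \<xi> > 0" "S \<xi> + N > 0" by (auto simp: S_def N_def intro!: add_pos_nonneg)
  have dS: "(S has_derivative (\<lambda>h. 8 * (\<xi> \<bullet> h))) (at \<xi>)"
    unfolding S_def by (auto intro!: derivative_eq_intros simp: inner_commute[of _ \<xi>])
  define t e where "t = sqrt (S \<xi>)" and "e = sqrt (S \<xi> + N)"
  have te: "t > 0" "e > 0" unfolding t_def e_def by (rule real_sqrt_gt_zero[OF S0(1)], rule real_sqrt_gt_zero[OF S0(2)])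
  have sq: "((\<lambda>x. sqrt (f x)) has_derivative (\<lambda>h. D h / (2 * sqrt (f \<xi>)))) (at \<xi>)"
    if "(f has_derivative D) (at \<xi>)" "f \<xi> > 0" for f :: "momentum \<Rightarrow> real" and D
  proof -
    have "((\<lambda>x. sqrt (f x)) has_derivative (\<lambda>h. D h * (inverse (sqrt (f \<xi>)) / 2))) (at \<xi>)"
      by (rule DERIV_compose_FDERIV[OF DERIV_real_sqrt[OF that(2)] that(1)])
    moreover have "D h * (inverse (sqrt (f \<xi>)) / 2) = D h / (2 * sqrt (f \<xi>))" for h
      by (simp add: field_simps)
    ultimately show ?thesis by (simp only:)
  qed
  have dt: "((\<lambda>x. sqrt (S x)) has_derivative (\<lambda>h. (8 * (\<xi> \<bullet> h)) / (2 * t))) (at \<xi>)"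
    unfolding t_def by (rule sq[OF dS S0(1)])
  have "((\<lambda>x. S x + N) has_derivative (\<lambda>h. 8 * (\<xi> \<bullet> h) + 0)) (at \<xi>)"
    by (intro has_derivative_add dS has_derivative_const)
  then have de: "((\<lambda>x. sqrt (S x + N)) has_derivative (\<lambda>h. (8 * (\<xi> \<bullet> h)) / (2 * e))) (at \<xi>)"
    unfolding e_def using sq[of "\<lambda>x. S x + N" "\<lambda>h. 8 * (\<xi> \<bullet> h) + 0"] S0(2) by simp
  have "e + t > 0" using te by linarith
  then have nz: "t * (e + t) \<noteq> 0" using te by simp
  have "((\<lambda>x. cm_coeff P (norm x)) has_derivative
      (\<lambda>h. - (inverse (t * (e + t)) * (t * ((8 * (\<xi> \<bullet> h)) / (2 * e) + (8 * (\<xi> \<bullet> h)) / (2 * t)) + (8 * (\<xi> \<bullet> h)) / (2 * t) * (e + t)) * inverse (t * (e + t))))) (at \<xi>)"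
    unfolding c
    using Deriv.has_derivative_inverse[OF _ has_derivative_mult[OF dt has_derivative_add[OF de dt]]] nz
    by (simp add: t_def e_def)
  moreover have "- (inverse (t * (e + t)) * (t * ((8 * a) / (2 * e) + (8 * a) / (2 * t)) + (8 * a) / (2 * t) * (e + t)) * inverse (t * (e + t))) =
     - 4 / (t ^ 3 * e) * a" for a
  proof -
    \<comment> \<open>The squares of \<open>t\<close> and \<open>e\<close> differ by the constant
      \<open>N\<close>, so their derivatives are \<open>4 * a / t\<close> and
      \<open>4 * a / e\<close> with \<open>a = \<xi> \<bullet> h\<close>. The derivative of
      \<open>t * (e + t)\<close> therefore contains \<open>(e + t)\<^sup>2\<close>, which cancels
      when the reciprocal is differentiated.\<close>
    have "t * ((8 * a) / (2 * e) + (8 * a) / (2 * t)) + (8 * a) / (2 * t) * (e + t) = 4 * a * (e + t)\<^sup>2 / (t * e)"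
      using te(1,2) by (simp add: field_simps power2_eq_square)
    moreover have "- (inverse (t * m) * (4 * a * m\<^sup>2 / (t * e)) * inverse (t * m)) = - 4 / (t ^ 3 * e) * a"
      if "m \<noteq> 0" for m
      using te that by (simp add: field_simps power2_eq_square power3_eq_cube)
    ultimately show ?thesis using \<open>e + t > 0\<close> by (metis less_irrefl)
  qed
  ultimately have dc: "((\<lambda>x. cm_coeff P (norm x)) has_derivative (\<lambda>h. - 4 / (t ^ 3 * e) * (\<xi> \<bullet> h))) (at \<xi>)"
    by simp
  have "((\<lambda>x. (1 / 2) *\<^sub>R P + x + (cm_coeff P (norm x) * (P \<bullet> x)) *\<^sub>R P) has_derivative
     (\<lambda>h. 0 + h + (cm_coeff P (norm \<xi>) * (P \<bullet> h) + (- 4 / (t ^ 3 * e) * (\<xi> \<bullet> h)) * (P \<bullet> \<xi>)) *\<^sub>R P)) (at \<xi>)"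
    by (intro has_derivative_add has_derivative_const has_derivative_ident
        has_derivative_scaleR_left has_derivative_mult dc has_derivative_inner_right)
  moreover have "t = sqrt (cm_s (norm \<xi>))" "e = cm_energy P (norm \<xi>)"
    by (simp_all add: t_def e_def S_def N_def cm_s_def cm_energy_def power2_norm_eq_inner)
  ultimately show ?thesis
    by (simp add: cm_map_def[abs_def])
qed

text \<open>The matrix determinant lemma; the derivative of \<open>cm_map P\<close> is such a
  rank-one perturbation of the identity.\<close>

lemma det_rank_one_update:
  fixes P w :: momentum
  shows "det (matrix (\<lambda>h. h + (w \<bullet> h) *\<^sub>R P)) = 1 + w \<bullet> P"
  by (simp add: det_3 matrix_def axis_def inner_vec_def sum_3 algebra_simps)

text \<open>In this form, with the energies of the two particles, the determinant is visibly
  positive and its numerator cancels the denominator of \<open>moller\<close>.\<close>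

definition cm_jacobian :: "momentum \<Rightarrow> momentum \<Rightarrow> real" where
  "cm_jacobian P \<xi> = 4 * energy (cm_map P \<xi>) * energy (P - cm_map P \<xi>) /
     (cm_energy P (norm \<xi>) * sqrt (cm_s (norm \<xi>)))"

lemma cm_jacobian_pos: "0 < cm_jacobian P \<xi>"
  by (simp add: cm_jacobian_def)

lemma borel_measurable_cm [measurable]:
  "energy \<in> borel_measurable borel"
  "cm_s \<in> borel_measurable borel"
  "(\<lambda>(P, r). cm_energy P r) \<in> borel_measurable (borel \<Otimes>\<^sub>M borel)"
  "(\<lambda>(P, r). cm_coeff P r) \<in> borel_measurable (borel \<Otimes>\<^sub>M borel)"
  "(\<lambda>(P, \<xi>). cm_map P \<xi>) \<in> borel_measurable (borel \<Otimes>\<^sub>M borel)"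
  unfolding energy_def[abs_def] cm_s_def[abs_def] cm_energy_def cm_coeff_def cm_map_def by measurable

lemma distr_cm_map:
  "distr (density lborel (\<lambda>\<xi>. ennreal (cm_jacobian P \<xi>))) borel (cm_map P) = lborel"
proof (rule distr_lborel_change_of_variables[OF cm_map_has_derivative cm_map_inj cm_map_surj])
  fix \<xi> :: momentum
  let ?e = "cm_energy P (norm \<xi>)" and ?t = "sqrt (cm_s (norm \<xi>))"
  define a where "a = - 4 / (?t ^ 3 * ?e)"
  define w where "w = cm_coeff P (norm \<xi>) *\<^sub>R P + (a * (P \<bullet> \<xi>)) *\<^sub>R \<xi>"
  have "(\<lambda>h. h + (cm_coeff P (norm \<xi>) * (P \<bullet> h) + a * (\<xi> \<bullet> h) * (P \<bullet> \<xi>)) *\<^sub>R P) = (\<lambda>h. h + (w \<bullet> h) *\<^sub>R P)"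
    by (simp add: w_def inner_add_left mult_ac)
  then have "det (matrix (\<lambda>h. h + (cm_coeff P (norm \<xi>) * (P \<bullet> h) + a * (\<xi> \<bullet> h) * (P \<bullet> \<xi>)) *\<^sub>R P)) = 1 + w \<bullet> P"
    by (simp add: det_rank_one_update)
  also have "\<dots> = (1 + cm_coeff P (norm \<xi>) * (norm P)\<^sup>2) + a * (P \<bullet> \<xi>)\<^sup>2"
    by (simp add: w_def inner_add_left dot_square_norm inner_commute[of \<xi> P]) (simp add: power2_eq_square)
  also have "\<dots> = ?e / ?t + a * (P \<bullet> \<xi>)\<^sup>2" by (simp add: cm_coeff_gamma)
  also have "\<dots> = cm_jacobian P \<xi>"
  proof -
    have E: "energy (P - cm_map P \<xi>) = ?e / 2 - P \<bullet> \<xi> / ?t"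
      using energy_cm_map[of P "- \<xi>"] by (simp add: cm_map_minus)
    \<comment> \<open>Up to the factor \<open>1 / (?e * ?t)\<close> the determinant is a difference
      of two squares, whose factors are twice the energies of the pair.\<close>
    have "?e / ?t + a * x\<^sup>2 = 4 * (?e / 2 + x / ?t) * (?e / 2 - x / ?t) / (?e * ?t)" for x
    proof -
      have "e / t + - 4 / (t ^ 3 * e) * x\<^sup>2 = 4 * (e / 2 + x / t) * (e / 2 - x / t) / (e * t)"
        if "e > 0" "t > 0" for e t :: real
      proof -
        have "4 * (e / 2 + x / t) * (e / 2 - x / t) = e * e - 4 * x\<^sup>2 / (t * t)"
          by (simp add: power2_eq_square algebra_simps)
        then show ?thesis using that by (simp add: diff_divide_distrib power3_eq_cube mult_ac)
      qed
      from this[of ?e ?t] show ?thesis unfolding a_def by simp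
    qed
    then show ?thesis unfolding cm_jacobian_def energy_cm_map E .
  qed
  finally show "cm_jacobian P \<xi> = \<bar>det (matrix (\<lambda>h. h + (cm_coeff P (norm \<xi>) * (P \<bullet> h) +
      - 4 / (?t ^ 3 * ?e) * (\<xi> \<bullet> h) * (P \<bullet> \<xi>)) *\<^sub>R P))\<bar>"
    using cm_jacobian_pos[of P \<xi>] unfolding a_def by simp
next
  show "cm_jacobian P \<in> borel_measurable borel"
    unfolding cm_jacobian_def[abs_def] by measurable
qed

lemma nn_integral_cm_map:
  assumes [measurable]: "h \<in> borel_measurable borel"
  shows "(\<integral>\<^sup>+p. h p \<partial>lborel) = (\<integral>\<^sup>+\<xi>. ennreal (cm_jacobian P \<xi>) * h (cm_map P \<xi>) \<partial>lborel)"
proof -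
  have [measurable]: "cm_jacobian P \<in> borel_measurable borel"
    unfolding cm_jacobian_def[abs_def] by measurable
  have "(\<integral>\<^sup>+p. h p \<partial>lborel) = (\<integral>\<^sup>+p. h p \<partial>distr (density lborel (\<lambda>\<xi>. ennreal (cm_jacobian P \<xi>))) borel (cm_map P))"
    by (simp add: distr_cm_map)
  also have "\<dots> = (\<integral>\<^sup>+\<xi>. ennreal (cm_jacobian P \<xi>) * h (cm_map P \<xi>) \<partial>lborel)"
    by (subst nn_integral_distr, simp, simp, subst nn_integral_density) auto
  finally show ?thesis .
qed

subsection \<open>Collision integrals over planes\<close>

lemma borel_measurable_kinematics [measurable (raw)]:
  assumes [measurable]: "p \<in> borel_measurable M" "q \<in> borel_measurable M" "\<omega> \<in> borel_measurable M"
  shows "(\<lambda>x. rel_momentum (p x) (q x)) \<in> borel_measurable M"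
    "(\<lambda>x. moller (p x) (q x)) \<in> borel_measurable M"
    "(\<lambda>x. post_p (p x) (q x) (\<omega> x)) \<in> borel_measurable M"
    "(\<lambda>x. post_q (p x) (q x) (\<omega> x)) \<in> borel_measurable M"
  unfolding moller_def post_p_def post_q_def deflection_def gamma_cm_def s_inv_def rel_momentum_def
  by measurable

lemma borel_measurable_cm_raw [measurable (raw)]:
  assumes [measurable]: "P \<in> borel_measurable M" "r \<in> borel_measurable M" "\<xi> \<in> borel_measurable M"
  shows "(\<lambda>x. cm_energy (P x) (r x)) \<in> borel_measurable M"
    "(\<lambda>x. cm_map (P x) (\<xi> x)) \<in> borel_measurable M"
    "(\<lambda>x. cm_jacobian (P x) (\<xi> x)) \<in> borel_measurable M"
  unfolding cm_jacobian_def cm_map_def cm_coeff_def cm_energy_def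
  by measurable

lemma post_p_eq_cm_map:
  assumes "norm \<omega> = 1"
  shows "post_p p q \<omega> = cm_map (p + q) ((rel_momentum p q / 2) *\<^sub>R \<omega>)"
proof -
  obtain P \<xi> where P: "p = cm_map P \<xi>" "q = P - cm_map P \<xi>" "P = p + q" "norm \<xi> = rel_momentum p q / 2"
    by (rule cm_map_cases)
  have "post_p p q \<omega> = cm_map P (norm \<xi> *\<^sub>R \<omega>)"
    using post_p_cm_map[OF assms, of P \<xi>] P(1,2) by metis
  then show ?thesis unfolding P(4) P(3) .
qed

lemma tendsto_rel_momentum [tendsto_intros]:
  assumes "(p \<longlongrightarrow> a) F"
  shows "((\<lambda>x. rel_momentum (p x) q) \<longlongrightarrow> rel_momentum a q) F"
  unfolding rel_momentum_def energy_def by (intro tendsto_intros assms)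

lemma tendsto_moller:
  assumes "(p \<longlongrightarrow> a) F"
  shows "((\<lambda>x. moller (p x) q) \<longlongrightarrow> moller a q) F"
  unfolding moller_def s_inv_def
  by (intro tendsto_intros assms) (auto simp: energy_def intro!: tendsto_intros assms less_imp_neq[symmetric] add_pos_nonneg)

text \<open>Continuity is needed at \<open>a + q = 0\<close> too, where \<open>deflection\<close>
  divides by zero. In the form given by \<open>post_p_eq_cm_map\<close> the denominators never
  vanish.\<close>

lemma tendsto_post_p:
  assumes "(p \<longlongrightarrow> a) F" and \<omega>: "norm \<omega> = 1"
  shows "((\<lambda>x. post_p (p x) q \<omega>) \<longlongrightarrow> post_p a q \<omega>) F"
proof -
  have nz: "sqrt (cm_s r) * (cm_energy P r + sqrt (cm_s r)) \<noteq> 0" for P r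
    using cm_coeff_pos[of P r] unfolding cm_coeff_def by auto
  show ?thesis
    unfolding post_p_eq_cm_map[OF \<omega>] cm_map_def cm_coeff_def cm_energy_def cm_s_def
    by (intro tendsto_intros assms nz[unfolded cm_energy_def cm_s_def]) simp_all
qed

lemma nn_integral_lborel_diff:
  fixes c :: momentum
  assumes [measurable]: "h \<in> borel_measurable borel"
  shows "(\<integral>\<^sup>+q. h q \<partial>lborel) = (\<integral>\<^sup>+P. h (P - c) \<partial>lborel)"
proof -
  have "(\<integral>\<^sup>+q. h q \<partial>lborel) = (\<integral>\<^sup>+q. h q \<partial>distr lborel borel ((+) (- c)))"
    by (simp add: lborel_distr_plus)
  also have "\<dots> = (\<integral>\<^sup>+P. h (P - c) \<partial>lborel)"
    by (subst nn_integral_distr) auto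
  finally show ?thesis .
qed

lemma jacobian_moller:
  "cm_jacobian P \<xi> * (moller (cm_map P \<xi>) (P - cm_map P \<xi>) * rel_momentum (cm_map P \<xi>) (P - cm_map P \<xi>)) =
     16 * (norm \<xi>)\<^sup>2 / cm_energy P (norm \<xi>)"
proof -
  have "4 * a * b / (e * t) * (2 * r * t / (a * b) * (2 * r)) = 16 * r\<^sup>2 / e"
    if "a > 0" "b > 0" "t > 0" for a b e t r :: real
    using that by (simp add: power2_eq_square)
  from this[of "energy (cm_map P \<xi>)" "energy (P - cm_map P \<xi>)" "sqrt (cm_s (norm \<xi>))"
      "cm_energy P (norm \<xi>)" "norm \<xi>"]
  show ?thesis
    by (simp add: cm_jacobian_def moller_def rel_momentum_cm_map s_inv_cm_map)
qed

text \<open>In the coordinates \<open>P = p + q\<close>, \<open>\<xi>\<close> the collision replaces the direction of \<open>\<xi>\<close> by \<open>\<omega>\<close>, and the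
  weight depends on \<open>P\<close> and \<open>norm \<xi>\<close> only.\<close>

lemma collision_integral_cm:
  fixes \<Phi> :: "momentum \<Rightarrow> momentum \<Rightarrow> momentum \<Rightarrow> momentum \<Rightarrow> ennreal"
  assumes \<Phi>: "(\<lambda>(p, q, p', q'). \<Phi> p q p' q') \<in> borel_measurable (borel \<Otimes>\<^sub>M borel \<Otimes>\<^sub>M borel \<Otimes>\<^sub>M borel)"
  shows "(\<integral>\<^sup>+p. \<integral>\<^sup>+q. \<integral>\<^sup>+\<omega>. ennreal (moller p q * rel_momentum p q) *
        \<Phi> p q (post_p p q \<omega>) (post_q p q \<omega>) \<partial>sphere_measure \<partial>lborel \<partial>lborel) =
    (\<integral>\<^sup>+P. \<integral>\<^sup>+\<xi>. \<integral>\<^sup>+\<omega>. ennreal (16 * (norm \<xi>)\<^sup>2 / cm_energy P (norm \<xi>)) *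
        \<Phi> (cm_map P (norm \<xi> *\<^sub>R sgn \<xi>)) (P - cm_map P (norm \<xi> *\<^sub>R sgn \<xi>))
          (cm_map P (norm \<xi> *\<^sub>R \<omega>)) (P - cm_map P (norm \<xi> *\<^sub>R \<omega>)) \<partial>sphere_measure \<partial>lborel \<partial>lborel)"
proof -
  have [measurable (raw)]: "(\<lambda>x. \<Phi> (a x) (b x) (c x) (d x)) \<in> borel_measurable M"
    if "a \<in> borel_measurable M" "b \<in> borel_measurable M" "c \<in> borel_measurable M" "d \<in> borel_measurable M"
    for a b c d and M :: "'z measure"
    using measurable_compose[OF measurable_Pair[OF that(1) measurable_Pair[OF that(2) measurable_Pair[OF that(3,4)]]] \<Phi>]
    by simp
  define I where "I = (\<lambda>p q. \<integral>\<^sup>+\<omega>. ennreal (moller p q * rel_momentum p q) *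
        \<Phi> p q (post_p p q \<omega>) (post_q p q \<omega>) \<partial>sphere_measure)"
  have [measurable (raw)]: "(\<lambda>x. I (a x) (b x)) \<in> borel_measurable M"
    if [measurable]: "a \<in> borel_measurable M" "b \<in> borel_measurable M" for a b and M :: "'z measure"
    unfolding I_def by measurable
  \<comment> \<open>The variable \<open>P = p + q\<close> replaces \<open>q\<close> and is moved
    outside, because the substitution \<open>p = cm_map P \<xi>\<close> is made at fixed
    \<open>P\<close>.\<close>
  have "(\<integral>\<^sup>+p. \<integral>\<^sup>+q. I p q \<partial>lborel \<partial>lborel) = (\<integral>\<^sup>+p. \<integral>\<^sup>+P. I p (P - p) \<partial>lborel \<partial>lborel)"
    by (intro nn_integral_cong nn_integral_lborel_diff) measurable
  also have "\<dots> = (\<integral>\<^sup>+P. \<integral>\<^sup>+p. I p (P - p) \<partial>lborel \<partial>lborel)"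
    by (rule lborel_pair.Fubini'[symmetric]) measurable
  also have "\<dots> = (\<integral>\<^sup>+P. \<integral>\<^sup>+\<xi>. ennreal (cm_jacobian P \<xi>) * I (cm_map P \<xi>) (P - cm_map P \<xi>) \<partial>lborel \<partial>lborel)"
    by (intro nn_integral_cong nn_integral_cm_map) measurable
  also have "\<dots> = (\<integral>\<^sup>+P. \<integral>\<^sup>+\<xi>. \<integral>\<^sup>+\<omega>. ennreal (16 * (norm \<xi>)\<^sup>2 / cm_energy P (norm \<xi>)) *
        \<Phi> (cm_map P (norm \<xi> *\<^sub>R sgn \<xi>)) (P - cm_map P (norm \<xi> *\<^sub>R sgn \<xi>))
          (cm_map P (norm \<xi> *\<^sub>R \<omega>)) (P - cm_map P (norm \<xi> *\<^sub>R \<omega>)) \<partial>sphere_measure \<partial>lborel \<partial>lborel)"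
  proof (intro nn_integral_cong)
    fix P \<xi> :: momentum
    \<comment> \<open>The pre-collisional pair is expressed through \<open>norm \<xi>\<close> and
      \<open>sgn \<xi>\<close> so that \<open>nn_integral_swap_direction\<close> becomes
      applicable.\<close>
    have sgn: "norm \<xi> *\<^sub>R sgn \<xi> = \<xi>" by (cases "\<xi> = 0") (simp_all add: sgn_div_norm)
    have "ennreal (cm_jacobian P \<xi>) * I (cm_map P \<xi>) (P - cm_map P \<xi>) =
        (\<integral>\<^sup>+\<omega>. ennreal (cm_jacobian P \<xi>) * (ennreal (moller (cm_map P \<xi>) (P - cm_map P \<xi>) *
          rel_momentum (cm_map P \<xi>) (P - cm_map P \<xi>)) *
        \<Phi> (cm_map P \<xi>) (P - cm_map P \<xi>) (post_p (cm_map P \<xi>) (P - cm_map P \<xi>) \<omega>)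
          (post_q (cm_map P \<xi>) (P - cm_map P \<xi>) \<omega>)) \<partial>sphere_measure)"
      unfolding I_def by (subst nn_integral_cmult) auto
    also have "\<dots> = (\<integral>\<^sup>+\<omega>. ennreal (16 * (norm \<xi>)\<^sup>2 / cm_energy P (norm \<xi>)) *
        \<Phi> (cm_map P \<xi>) (P - cm_map P \<xi>) (cm_map P (norm \<xi> *\<^sub>R \<omega>)) (P - cm_map P (norm \<xi> *\<^sub>R \<omega>)) \<partial>sphere_measure)"
      using AE_sphere_measure
      by (intro nn_integral_cong_AE, eventually_elim)
        (simp add: post_p_cm_map post_q_eq jacobian_moller less_imp_le[OF cm_jacobian_pos]
          flip: mult.assoc ennreal_mult jacobian_moller)
    finally show "ennreal (cm_jacobian P \<xi>) * I (cm_map P \<xi>) (P - cm_map P \<xi>) =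
      (\<integral>\<^sup>+\<omega>. ennreal (16 * (norm \<xi>)\<^sup>2 / cm_energy P (norm \<xi>)) *
        \<Phi> (cm_map P (norm \<xi> *\<^sub>R sgn \<xi>)) (P - cm_map P (norm \<xi> *\<^sub>R sgn \<xi>))
          (cm_map P (norm \<xi> *\<^sub>R \<omega>)) (P - cm_map P (norm \<xi> *\<^sub>R \<omega>)) \<partial>sphere_measure)"
      unfolding sgn .
  qed
  finally show ?thesis unfolding I_def .
qed

text \<open>In centre-of-mass coordinates the two sides differ by the exchange of
  \<open>sgn \<xi>\<close> and \<open>\<omega>\<close>.\<close>

lemma collision_symmetry:
  fixes \<Phi> :: "momentum \<Rightarrow> momentum \<Rightarrow> momentum \<Rightarrow> momentum \<Rightarrow> ennreal"
  assumes \<Phi>: "(\<lambda>(p, q, p', q'). \<Phi> p q p' q') \<in> borel_measurable (borel \<Otimes>\<^sub>M borel \<Otimes>\<^sub>M borel \<Otimes>\<^sub>M borel)"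
  shows "(\<integral>\<^sup>+p. \<integral>\<^sup>+q. \<integral>\<^sup>+\<omega>. ennreal (moller p q * rel_momentum p q) *
        \<Phi> p q (post_p p q \<omega>) (post_q p q \<omega>) \<partial>sphere_measure \<partial>lborel \<partial>lborel) =
    (\<integral>\<^sup>+p. \<integral>\<^sup>+q. \<integral>\<^sup>+\<omega>. ennreal (moller p q * rel_momentum p q) *
        \<Phi> (post_p p q \<omega>) (post_q p q \<omega>) p q \<partial>sphere_measure \<partial>lborel \<partial>lborel)"
proof -
  have m[measurable (raw)]: "(\<lambda>x. \<Phi> (a x) (b x) (c x) (d x)) \<in> borel_measurable M"
    if "a \<in> borel_measurable M" "b \<in> borel_measurable M" "c \<in> borel_measurable M" "d \<in> borel_measurable M"
    for a b c d and M :: "'z measure"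
    using measurable_compose[OF measurable_Pair[OF that(1) measurable_Pair[OF that(2) measurable_Pair[OF that(3,4)]]] \<Phi>]
    by simp
  have \<Phi>': "(\<lambda>(p, q, p', q'). \<Phi> p' q' p q) \<in> borel_measurable (borel \<Otimes>\<^sub>M borel \<Otimes>\<^sub>M borel \<Otimes>\<^sub>M borel)"
    by measurable
  show ?thesis
    unfolding collision_integral_cm[OF \<Phi>] collision_integral_cm[OF \<Phi>']
    by (intro nn_integral_cong nn_integral_swap_direction) measurable
qed

text \<open>On the sphere \<open>n \<bullet> post_p p q \<omega>\<close> is affine in
  \<open>\<omega>\<close> with linear part \<open>(g / 2) * (b \<bullet> \<omega>)\<close>. The
  vector \<open>b\<close> is \<open>n\<close> stretched along \<open>P\<close>, so
  \<open>norm b \<ge> 1\<close> and the slab cuts out a slice of half-width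
  \<open>2 * \<epsilon> / g\<close>. The factor \<open>g\<close> of the kernel cancels this
  \<open>1 / g\<close>, and \<open>moller p q \<le> 4\<close> gives the constant
  \<open>4 * 24 * 2 = 192\<close>.\<close>

lemma emeasure_post_p_slab:
  assumes n: "norm n = 1" and e: "0 < \<epsilon>"
  shows "ennreal (moller p q * rel_momentum p q) *
      emeasure sphere_measure {\<omega>. \<bar>n \<bullet> post_p p q \<omega>\<bar> < \<epsilon>} \<le> ennreal (192 * pi * \<epsilon>)"
proof (cases "rel_momentum p q = 0")
  case False
  define g where "g = rel_momentum p q"
  have g: "g > 0" using False by (simp add: g_def less_le)
  define P where "P = p + q"
  define c where "c = cm_coeff P (g / 2)"
  define b where "b = n + (c * (n \<bullet> P)) *\<^sub>R P"
  have "(norm b)\<^sup>2 = 1 + (2 * c + c\<^sup>2 * (norm P)\<^sup>2) * (n \<bullet> P)\<^sup>2"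
  proof -
    have "n \<bullet> n = 1" using n by (simp add: dot_square_norm)
    then show ?thesis
      unfolding power2_norm_eq_inner b_def
      by (simp add: inner_add_left inner_add_right inner_commute[of P n] power2_eq_square algebra_simps)
  qed
  moreover have "0 \<le> (2 * c + c\<^sup>2 * (norm P)\<^sup>2) * (n \<bullet> P)\<^sup>2"
    by (intro mult_nonneg_nonneg add_nonneg_nonneg) (simp_all add: c_def less_imp_le)
  ultimately have "1\<^sup>2 \<le> (norm b)\<^sup>2" by simp
  then have b: "1 \<le> norm b" by (rule power2_le_imp_le) simp
  have post: "n \<bullet> post_p p q \<omega> = (g / 2) * (b \<bullet> \<omega> - (- (n \<bullet> P) / g))" if \<omega>: "norm \<omega> = 1" for \<omega>
  proof -
    have "norm ((g / 2) *\<^sub>R \<omega>) = g / 2" using \<omega> g by simp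
    then have "post_p p q \<omega> = (1 / 2) *\<^sub>R P + (g / 2) *\<^sub>R \<omega> + (c * (P \<bullet> ((g / 2) *\<^sub>R \<omega>))) *\<^sub>R P"
      unfolding post_p_eq_cm_map[OF \<omega>] g_def[symmetric] P_def[symmetric] cm_map_def c_def by simp
    then have "n \<bullet> post_p p q \<omega> = (1 / 2) * (n \<bullet> P) + (g / 2) * (n \<bullet> \<omega>) + c * (g / 2) * (P \<bullet> \<omega>) * (n \<bullet> P)"
      by (simp add: inner_add_right)
    also have "\<dots> = (g / 2) * (b \<bullet> \<omega> - (- (n \<bullet> P) / g))"
      using g by (simp add: b_def inner_add_left field_simps)
    finally show ?thesis .
  qed
  have "emeasure sphere_measure {\<omega>. \<bar>n \<bullet> post_p p q \<omega>\<bar> < \<epsilon>} \<le>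
      emeasure sphere_measure {\<omega>. \<bar>b \<bullet> \<omega> - (- (n \<bullet> P) / g)\<bar> < 2 * \<epsilon> / g}"
  proof (rule emeasure_mono_AE)
    show "AE \<omega> in sphere_measure. \<omega> \<in> {\<omega>. \<bar>n \<bullet> post_p p q \<omega>\<bar> < \<epsilon>} \<longrightarrow>
        \<omega> \<in> {\<omega>. \<bar>b \<bullet> \<omega> - (- (n \<bullet> P) / g)\<bar> < 2 * \<epsilon> / g}"
      using AE_sphere_measure
    proof eventually_elim
      case (elim \<omega>)
      show ?case
        unfolding mem_Collect_eq post[OF elim] abs_mult using g by (simp add: field_simps)
    qed
  qed measurable
  also have "\<dots> \<le> ennreal (24 * pi * (2 * \<epsilon> / g))"
    using b e g by (intro emeasure_sphere_slice) auto
  finally have "ennreal (moller p q * g) * emeasure sphere_measure {\<omega>. \<bar>n \<bullet> post_p p q \<omega>\<bar> < \<epsilon>} \<le>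
      ennreal (4 * g) * ennreal (24 * pi * (2 * \<epsilon> / g))"
    using moller_le[of p q] g by (intro mult_mono) (auto intro!: ennreal_leI)
  also have "\<dots> = ennreal (192 * pi * \<epsilon>)"
    using g e by (simp flip: ennreal_mult)
  finally show ?thesis by (simp add: g_def)
qed simp

section \<open>From slabs to planes\<close>

lemma slab_collision_integral_le:
  fixes n :: momentum and U :: "(momentum \<times> momentum) set"
  assumes n: "norm n = 1" and e: "0 < \<epsilon>" and U[measurable]: "U \<in> sets borel"
  shows "(\<integral>\<^sup>+p. indicator {p. \<bar>n \<bullet> p\<bar> < \<epsilon>} p * (\<integral>\<^sup>+q. \<integral>\<^sup>+\<omega>. ennreal (moller p q * rel_momentum p q) *
      indicator U (post_p p q \<omega>, post_q p q \<omega>) \<partial>sphere_measure \<partial>lborel) \<partial>lborel) \<le>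
    ennreal (192 * pi * \<epsilon>) * emeasure lborel U"
proof -
  let ?S = "{p. \<bar>n \<bullet> p\<bar> < \<epsilon>}"
  let ?\<Phi> = "\<lambda>p q p' q'. indicator ?S p * indicator U (p', q') :: ennreal"
  have U'[measurable]: "U \<in> sets (borel \<Otimes>\<^sub>M borel)" using U unfolding borel_prod .
  have S[measurable]: "?S \<in> sets borel" by measurable
  have \<Phi>: "(\<lambda>(p, q, p', q'). ?\<Phi> p q p' q') \<in> borel_measurable (borel \<Otimes>\<^sub>M borel \<Otimes>\<^sub>M borel \<Otimes>\<^sub>M borel)"
    by measurable
  have "(\<integral>\<^sup>+p. indicator ?S p * (\<integral>\<^sup>+q. \<integral>\<^sup>+\<omega>. ennreal (moller p q * rel_momentum p q) *
      indicator U (post_p p q \<omega>, post_q p q \<omega>) \<partial>sphere_measure \<partial>lborel) \<partial>lborel) =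
    (\<integral>\<^sup>+p. \<integral>\<^sup>+q. \<integral>\<^sup>+\<omega>. ennreal (moller p q * rel_momentum p q) *
        ?\<Phi> p q (post_p p q \<omega>) (post_q p q \<omega>) \<partial>sphere_measure \<partial>lborel \<partial>lborel)"
    by (intro nn_integral_cong) (auto simp: indicator_def)
  \<comment> \<open>The exchange moves the slab condition to the post-collisional momentum and the
    set \<open>U\<close> to \<open>(p, q)\<close>, so that only the slab condition involves
    \<open>\<omega>\<close>.\<close>
  also have "\<dots> = (\<integral>\<^sup>+p. \<integral>\<^sup>+q. \<integral>\<^sup>+\<omega>. ennreal (moller p q * rel_momentum p q) *
        ?\<Phi> (post_p p q \<omega>) (post_q p q \<omega>) p q \<partial>sphere_measure \<partial>lborel \<partial>lborel)"
    by (rule collision_symmetry[OF \<Phi>])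
  also have "\<dots> \<le> (\<integral>\<^sup>+p. \<integral>\<^sup>+q. ennreal (192 * pi * \<epsilon>) * indicator U (p, q) \<partial>lborel \<partial>lborel)"
  proof (intro nn_integral_mono)
    fix p q :: momentum
    have "(\<integral>\<^sup>+\<omega>. ennreal (moller p q * rel_momentum p q) * ?\<Phi> (post_p p q \<omega>) (post_q p q \<omega>) p q \<partial>sphere_measure) =
        (\<integral>\<^sup>+\<omega>. indicator U (p, q) * (ennreal (moller p q * rel_momentum p q) * indicator {\<omega>. \<bar>n \<bullet> post_p p q \<omega>\<bar> < \<epsilon>} \<omega>) \<partial>sphere_measure)"
      by (intro nn_integral_cong) (auto simp: indicator_def)
    also have "\<dots> = indicator U (p, q) * (ennreal (moller p q * rel_momentum p q) *
        emeasure sphere_measure {\<omega>. \<bar>n \<bullet> post_p p q \<omega>\<bar> < \<epsilon>})"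
      by (subst nn_integral_cmult) (auto simp: nn_integral_cmult_indicator)
    also have "\<dots> \<le> indicator U (p, q) * ennreal (192 * pi * \<epsilon>)"
      by (intro mult_left_mono emeasure_post_p_slab n e) simp
    finally show "(\<integral>\<^sup>+\<omega>. ennreal (moller p q * rel_momentum p q) * ?\<Phi> (post_p p q \<omega>) (post_q p q \<omega>) p q \<partial>sphere_measure) \<le>
        ennreal (192 * pi * \<epsilon>) * indicator U (p, q)"
      by (simp add: mult.commute)
  qed
  also have "\<dots> = (\<integral>\<^sup>+z. ennreal (192 * pi * \<epsilon>) * indicator U z \<partial>(lborel \<Otimes>\<^sub>M lborel))"
    by (subst lborel.nn_integral_fst[symmetric]) auto
  also have "\<dots> = ennreal (192 * pi * \<epsilon>) * emeasure lborel U"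
    by (subst nn_integral_cmult_indicator) (auto simp: lborel_prod)
  finally show ?thesis .
qed

text \<open>\<open>I t\<close> is the integral over the plane translated by
  \<open>t *\<^sub>R n\<close>. Its mean over \<open>\<bar>t\<bar> < \<epsilon>\<close> is at most
  \<open>D\<close>, so arbitrarily close to the plane there are translates with
  \<open>I t \<le> D + \<delta>\<close>. As \<open>U\<close> is open, the integrand is lower
  semicontinuous in \<open>t\<close>, and Fatou's lemma carries the bound to
  \<open>t = 0\<close>.\<close>

lemma collision_plane_open:
  fixes u v n :: momentum and U :: "(momentum \<times> momentum) set"
  assumes on: "norm u = 1" "norm v = 1" "norm n = 1" "u \<bullet> v = 0" "u \<bullet> n = 0" "v \<bullet> n = 0"
    and U: "open U"
  shows "(\<integral>\<^sup>+y. \<integral>\<^sup>+q. \<integral>\<^sup>+\<omega>. ennreal (moller (y $ 1 *\<^sub>R u + y $ 2 *\<^sub>R v) q * rel_momentum (y $ 1 *\<^sub>R u + y $ 2 *\<^sub>R v) q) *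
      indicator U (post_p (y $ 1 *\<^sub>R u + y $ 2 *\<^sub>R v) q \<omega>, post_q (y $ 1 *\<^sub>R u + y $ 2 *\<^sub>R v) q \<omega>)
      \<partial>sphere_measure \<partial>lborel \<partial>(lborel :: (real ^ 2) measure)) \<le> ennreal (96 * pi) * emeasure lborel U"
proof -
  note borel_measurable_frame3[measurable]
  have Ub[measurable]: "U \<in> sets borel" using U by simp
  have U'[measurable]: "U \<in> sets (borel \<Otimes>\<^sub>M borel)" using Ub unfolding borel_prod .
  define p where "p = (\<lambda>(y :: real ^ 2) t. y $ 1 *\<^sub>R u + y $ 2 *\<^sub>R v + t *\<^sub>R n)"
  have [measurable]: "(\<lambda>x. p (fst x) (snd x)) \<in> borel_measurable (borel \<Otimes>\<^sub>M borel)"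
    using borel_measurable_frame3[of u v n] by (simp add: p_def case_prod_beta)
  have pm[measurable (raw)]: "(\<lambda>x. p (a x) (b x)) \<in> borel_measurable M"
    if [measurable]: "a \<in> borel_measurable M" "b \<in> borel_measurable M" for a b and M :: "'z measure"
    using measurable_compose[OF measurable_Pair[OF that] \<open>(\<lambda>x. p (fst x) (snd x)) \<in> borel_measurable (borel \<Otimes>\<^sub>M borel)\<close>]
    by simp
  define K where "K = (\<lambda>p q \<omega>. ennreal (moller p q * rel_momentum p q) * indicator U (post_p p q \<omega>, post_q p q \<omega>))"
  have [measurable (raw)]: "(\<lambda>x. K (a x) (b x) (c x)) \<in> borel_measurable M"
    if [measurable]: "a \<in> borel_measurable M" "b \<in> borel_measurable M" "c \<in> borel_measurable M" for a b c and M :: "'z measure"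
    unfolding K_def by measurable
  define I where "I = (\<lambda>t. \<integral>\<^sup>+y. \<integral>\<^sup>+q. \<integral>\<^sup>+\<omega>. K (p y t) q \<omega> \<partial>sphere_measure \<partial>lborel \<partial>lborel)"
  \<comment> \<open>The slab has thickness \<open>2 * \<epsilon>\<close>, which halves the constant
    192.\<close>
  define D where "D = ennreal (96 * pi) * emeasure lborel U"
  have avg: "(\<integral>\<^sup>+t. indicator {-\<epsilon><..<\<epsilon>} t * I t \<partial>lborel) \<le> ennreal (2 * \<epsilon>) * D" if e: "\<epsilon> > 0" for \<epsilon>
  proof -
    let ?H = "\<lambda>x. indicator {x. \<bar>n \<bullet> x\<bar> < \<epsilon>} x * (\<integral>\<^sup>+q. \<integral>\<^sup>+\<omega>. K x q \<omega> \<partial>sphere_measure \<partial>lborel)"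
    have np: "n \<bullet> p y t = t" for y t
      using on by (simp add: p_def inner_add_right inner_commute[of n] dot_square_norm)
    have "(\<integral>\<^sup>+t. indicator {-\<epsilon><..<\<epsilon>} t * I t \<partial>lborel) =
        (\<integral>\<^sup>+t. \<integral>\<^sup>+y. ?H (p y t) \<partial>lborel \<partial>lborel)"
      unfolding I_def by (intro nn_integral_cong, subst nn_integral_cmult[symmetric])
        (auto simp: np indicator_def intro!: nn_integral_cong)
    also have "\<dots> = (\<integral>\<^sup>+z. ?H (p (fst z) (snd z)) \<partial>(lborel \<Otimes>\<^sub>M lborel))"
      by (subst lborel_pair.nn_integral_snd[symmetric]) auto
    also have "\<dots> = (\<integral>\<^sup>+x. ?H x \<partial>distr (lborel \<Otimes>\<^sub>M lborel) borel (\<lambda>(y :: real ^ 2, t). y $ 1 *\<^sub>R u + y $ 2 *\<^sub>R v + t *\<^sub>R n))"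
      by (subst nn_integral_distr) (auto simp: p_def case_prod_beta)
    also have "\<dots> = (\<integral>\<^sup>+x. ?H x \<partial>lborel)"
      by (simp add: distr_lborel_frame3[OF on])
    also have "\<dots> \<le> ennreal (192 * pi * \<epsilon>) * emeasure lborel U"
      unfolding K_def by (rule slab_collision_integral_le[OF on(3) e Ub])
    also have "\<dots> = ennreal (2 * \<epsilon>) * D"
      using e by (simp add: D_def mult_ac flip: mult.assoc ennreal_mult)
    finally show ?thesis .
  qed
  have "I 0 \<le> D"
  proof (rule ennreal_le_epsilon)
    \<comment> \<open>\<open>D\<close> may be taken finite here; otherwise exceeding it by
      \<open>\<delta>\<close> would be no contradiction.\<close>
    fix \<delta> :: real assume D: "D < top" and \<delta>: "0 < \<delta>"
    have "\<exists>t. \<bar>t\<bar> < \<epsilon> \<and> I t \<le> D + ennreal \<delta>" if e: "\<epsilon> > 0" for \<epsilon>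
    proof (rule ccontr)
      assume "\<not> ?thesis"
      then have gt: "D + ennreal \<delta> \<le> I t" if "t \<in> {-\<epsilon><..<\<epsilon>}" for t
        using that by (metis abs_less_iff greaterThanLessThan_iff minus_less_iff linear)
      have "ennreal (2 * \<epsilon>) * (D + ennreal \<delta>) = (\<integral>\<^sup>+t. (D + ennreal \<delta>) * indicator {-\<epsilon><..<\<epsilon>} t \<partial>lborel)"
        using e by (subst nn_integral_cmult_indicator) (auto simp: mult.commute)
      also have "\<dots> \<le> (\<integral>\<^sup>+t. indicator {-\<epsilon><..<\<epsilon>} t * I t \<partial>lborel)"
        using gt by (intro nn_integral_mono) (auto simp: indicator_def)
      also have "\<dots> \<le> ennreal (2 * \<epsilon>) * D" by (rule avg[OF e])
      finally have "ennreal (2 * \<epsilon>) * (D + ennreal \<delta>) \<le> ennreal (2 * \<epsilon>) * D" .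
      then have "D + ennreal \<delta> \<le> D"
        using e by (subst (asm) ennreal_mult_le_mult_iff) auto
      then show False
        using D \<delta> by (cases D rule: ennreal_cases) (auto simp flip: ennreal_plus)
    qed
    then have "\<forall>j. \<exists>t. \<bar>t\<bar> < inverse (real (Suc j)) \<and> I t \<le> D + ennreal \<delta>" by simp
    then obtain t where t: "\<And>j. \<bar>t j\<bar> < inverse (real (Suc j))" "\<And>j. I (t j) \<le> D + ennreal \<delta>" by metis
    have t0: "t \<longlonglongrightarrow> 0"
    proof (rule tendsto_norm_zero_cancel)
      show "(\<lambda>j. norm (t j)) \<longlonglongrightarrow> 0"
        by (rule tendsto_sandwich[OF _ _ tendsto_const LIMSEQ_inverse_real_of_nat])
          (use less_imp_le[OF t(1)] in \<open>auto intro!: always_eventually simp: add.commute\<close>)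
    qed
    let ?M = "(lborel :: (real ^ 2) measure) \<Otimes>\<^sub>M ((lborel :: momentum measure) \<Otimes>\<^sub>M sphere_measure)"
    interpret qs: pair_sigma_finite "lborel :: momentum measure" sphere_measure ..
    interpret yqs: pair_sigma_finite "lborel :: (real ^ 2) measure" "(lborel :: momentum measure) \<Otimes>\<^sub>M sphere_measure" ..
    have Iprod: "I s = (\<integral>\<^sup>+z. K (p (fst z) s) (fst (snd z)) (snd (snd z)) \<partial>?M)" for s
    proof -
      have "(\<integral>\<^sup>+z. K (p (fst z) s) (fst (snd z)) (snd (snd z)) \<partial>?M) =
          (\<integral>\<^sup>+y. \<integral>\<^sup>+w. K (p y s) (fst w) (snd w) \<partial>(lborel \<Otimes>\<^sub>M sphere_measure) \<partial>lborel)"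
        by (subst qs.P.nn_integral_fst[symmetric]) auto
      also have "\<dots> = I s"
        unfolding I_def by (intro nn_integral_cong, subst sphere_measure.nn_integral_fst[symmetric]) auto
      finally show ?thesis ..
    qed
    have AEn: "AE z in ?M. norm (snd (snd z)) = 1"
    proof -
      have 1: "AE w in (lborel :: momentum measure) \<Otimes>\<^sub>M sphere_measure. norm (snd w) = 1"
        by (rule qs.AE_pair_measure) (measurable, simp add: AE_sphere_measure)
      show ?thesis
        by (rule yqs.AE_pair_measure) (measurable, simp add: 1)
    qed
    have "I 0 \<le> (\<integral>\<^sup>+z. liminf (\<lambda>j. K (p (fst z) (t j)) (fst (snd z)) (snd (snd z))) \<partial>?M)"
      unfolding Iprod using AEn
    proof (intro nn_integral_mono_AE, eventually_elim)
      case (elim z)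
      obtain y q \<omega> where z: "z = (y, q, \<omega>)" by (cases z) auto
      have \<omega>: "norm \<omega> = 1" using elim z by simp
      have lim: "(\<lambda>j. p y (t j)) \<longlonglongrightarrow> p y 0"
        unfolding p_def by (intro tendsto_intros t0)
      show ?case
      \<comment> \<open>Outside \<open>U\<close> the value at \<open>t = 0\<close> is 0 and nothing
        is claimed. Inside, openness keeps the indicator at 1 for all late \<open>j\<close>, and
        only the continuous kernel varies.\<close>
      proof (cases "(post_p (p y 0) q \<omega>, post_q (p y 0) q \<omega>) \<in> U")
        case True
        have "(\<lambda>j. (post_p (p y (t j)) q \<omega>, post_q (p y (t j)) q \<omega>)) \<longlonglongrightarrow> (post_p (p y 0) q \<omega>, post_q (p y 0) q \<omega>)"
          unfolding post_q_eq by (intro tendsto_intros lim tendsto_post_p \<omega>)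
        then have "\<forall>\<^sub>F j in sequentially. (post_p (p y (t j)) q \<omega>, post_q (p y (t j)) q \<omega>) \<in> U"
          using U True by (rule topological_tendstoD)
        then have ev: "\<forall>\<^sub>F j in sequentially. ennreal (moller (p y (t j)) q * rel_momentum (p y (t j)) q) = K (p y (t j)) q \<omega>"
          by eventually_elim (simp add: K_def)
        have "(\<lambda>j. ennreal (moller (p y (t j)) q * rel_momentum (p y (t j)) q)) \<longlonglongrightarrow>
            ennreal (moller (p y 0) q * rel_momentum (p y 0) q)"
          by (intro tendsto_ennrealI tendsto_mult tendsto_moller tendsto_rel_momentum lim)
        then have "(\<lambda>j. K (p y (t j)) q \<omega>) \<longlonglongrightarrow> K (p y 0) q \<omega>"
          using True by (subst tendsto_cong[OF ev, symmetric]) (simp add: K_def)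
        then have "liminf (\<lambda>j. K (p y (t j)) q \<omega>) = K (p y 0) q \<omega>"
          by (rule lim_imp_Liminf[OF sequentially_bot])
        then show ?thesis by (simp add: z)
      qed (simp add: z K_def)
    qed
    also have "\<dots> \<le> liminf (\<lambda>j. I (t j))"
      unfolding Iprod by (rule nn_integral_liminf) measurable
    also have "\<dots> \<le> liminf (\<lambda>_::nat. D + ennreal \<delta>)"
      by (intro Liminf_mono always_eventually allI t(2))
    also have "\<dots> = D + ennreal \<delta>" by (rule Liminf_const) simp
    finally show "I 0 \<le> D + ennreal \<delta>" .
  qed
  then show ?thesis unfolding I_def D_def K_def p_def scaleR_zero_left add_0_right .
qed

text \<open>A Borel set has open supersets of nearly the same Lebesgue measure, so domination on
  open sets is domination of measures, and hence of integrals.\<close>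

lemma nn_integral_le_lborel_of_open:
  fixes M :: "'a::euclidean_space measure"
  assumes M: "sets M = sets borel" and C: "0 \<le> C"
    and le: "\<And>U. open U \<Longrightarrow> emeasure M U \<le> ennreal C * emeasure lborel U"
    and [measurable]: "h \<in> borel_measurable borel"
  shows "(\<integral>\<^sup>+x. h x \<partial>M) \<le> ennreal C * (\<integral>\<^sup>+x. h x \<partial>lborel)"
proof -
  have S_le: "emeasure M S \<le> ennreal C * emeasure lborel S" if S: "S \<in> sets borel" for S
  proof (rule ennreal_le_epsilon)
    fix e :: real assume e: "0 < e"
    \<comment> \<open>The denominator \<open>C + 1\<close> also covers \<open>C = 0\<close>.\<close>
    define e' where "e' = e / (C + 1)"
    have e': "e' > 0" "C * e' \<le> e" using e C by (auto simp: e'_def field_simps)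
    obtain U where U: "open U" "S \<subseteq> U" "emeasure lborel (U - S) < e'"
      by (rule outer_regular_lborel[OF S e'(1)])
    have "emeasure M S \<le> emeasure M U" using U S by (intro emeasure_mono) (auto simp: M)
    also have "\<dots> \<le> ennreal C * emeasure lborel U" by (rule le[OF U(1)])
    also have "emeasure lborel U = emeasure lborel S + emeasure lborel (U - S)"
      using U S by (subst plus_emeasure) (auto intro!: arg_cong2[where f=emeasure])
    also have "ennreal C * \<dots> \<le> ennreal C * (emeasure lborel S + ennreal e')"
      using U(3) by (intro mult_left_mono add_left_mono) auto
    also have "\<dots> \<le> ennreal C * emeasure lborel S + ennreal e"
      using e' C e by (simp add: distrib_left add_left_mono flip: ennreal_mult)
    finally show "emeasure M S \<le> ennreal C * emeasure lborel S + ennreal e" .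
  qed
  \<comment> \<open>The order on measures compares \<open>emeasure\<close> on all sets; off the
    Borel sets both sides are 0 by convention.\<close>
  have "emeasure M S \<le> ennreal C * emeasure lborel S" for S
    using S_le M by (cases "S \<in> sets borel") (auto simp: emeasure_notin_sets)
  then have "M \<le> scale_measure (ennreal C) lborel"
    using M sets_eq_imp_space_eq[OF M]
    by (simp add: le_measure_iff le_fun_def space_scale_measure)
  then have "(\<integral>\<^sup>+x. h x \<partial>M) \<le> (\<integral>\<^sup>+x. h x \<partial>scale_measure (ennreal C) lborel)"
    using M by (intro nn_integral_mono_measure) auto
  then show ?thesis by (simp add: nn_integral_scale_measure)
qed

text \<open>\<open>N\<close> is the image of the weighted measure on the plane under the collision
  map. Bounds for its values on open sets, passed through
  \<open>nn_integral_le_lborel_of_open\<close>, give the estimate for every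
  \<open>h\<close>.\<close>

lemma collision_plane_integral_le:
  fixes u v n :: momentum and h :: "momentum \<Rightarrow> momentum \<Rightarrow> ennreal"
  assumes on: "norm u = 1" "norm v = 1" "norm n = 1" "u \<bullet> v = 0" "u \<bullet> n = 0" "v \<bullet> n = 0"
    and h: "(\<lambda>(p, q). h p q) \<in> borel_measurable (borel \<Otimes>\<^sub>M borel)"
  shows "(\<integral>\<^sup>+y. \<integral>\<^sup>+q. \<integral>\<^sup>+\<omega>. ennreal (moller (y $ 1 *\<^sub>R u + y $ 2 *\<^sub>R v) q * rel_momentum (y $ 1 *\<^sub>R u + y $ 2 *\<^sub>R v) q) *
      h (post_p (y $ 1 *\<^sub>R u + y $ 2 *\<^sub>R v) q \<omega>) (post_q (y $ 1 *\<^sub>R u + y $ 2 *\<^sub>R v) q \<omega>)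
      \<partial>sphere_measure \<partial>lborel \<partial>(lborel :: (real ^ 2) measure)) \<le>
    ennreal (96 * pi) * (\<integral>\<^sup>+p. \<integral>\<^sup>+q. h p q \<partial>lborel \<partial>lborel)"
proof -
  interpret qs: pair_sigma_finite "lborel :: momentum measure" sphere_measure ..
  let ?M = "(lborel :: (real ^ 2) measure) \<Otimes>\<^sub>M (lborel \<Otimes>\<^sub>M sphere_measure)"
  define p where "p = (\<lambda>y :: real ^ 2. y $ 1 *\<^sub>R u + y $ 2 *\<^sub>R v)"
  have [measurable]: "p \<in> borel_measurable borel" unfolding p_def by measurable
  have h2[measurable]: "(\<lambda>z. h (fst z) (snd z)) \<in> borel_measurable (borel \<Otimes>\<^sub>M borel)"
    using h by (simp add: case_prod_beta)
  let ?W = "\<lambda>z. ennreal (moller (p (fst z)) (fst (snd z)) * rel_momentum (p (fst z)) (fst (snd z)))"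
  let ?T = "\<lambda>z. (post_p (p (fst z)) (fst (snd z)) (snd (snd z)), post_q (p (fst z)) (fst (snd z)) (snd (snd z)))"
  define N where "N = distr (density ?M ?W) (borel \<Otimes>\<^sub>M borel) ?T"
  have Nint: "(\<integral>\<^sup>+z. k z \<partial>N) = (\<integral>\<^sup>+y. \<integral>\<^sup>+q. \<integral>\<^sup>+\<omega>. ennreal (moller (p y) q * rel_momentum (p y) q) *
      k (post_p (p y) q \<omega>, post_q (p y) q \<omega>) \<partial>sphere_measure \<partial>lborel \<partial>lborel)"
    if [measurable]: "k \<in> borel_measurable (borel \<Otimes>\<^sub>M borel)" for k
  proof -
    have "(\<integral>\<^sup>+z. k z \<partial>N) = (\<integral>\<^sup>+z. ?W z * k (?T z) \<partial>?M)"
      unfolding N_def by (subst nn_integral_distr, simp, simp, subst nn_integral_density) auto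
    also have "\<dots> = (\<integral>\<^sup>+y. \<integral>\<^sup>+w. ?W (y, w) * k (?T (y, w)) \<partial>(lborel \<Otimes>\<^sub>M sphere_measure) \<partial>lborel)"
      by (subst qs.P.nn_integral_fst[symmetric]) auto
    also have "\<dots> = (\<integral>\<^sup>+y. \<integral>\<^sup>+q. \<integral>\<^sup>+\<omega>. ennreal (moller (p y) q * rel_momentum (p y) q) *
      k (post_p (p y) q \<omega>, post_q (p y) q \<omega>) \<partial>sphere_measure \<partial>lborel \<partial>lborel)"
      by (intro nn_integral_cong, subst sphere_measure.nn_integral_fst[symmetric]) auto
    finally show ?thesis .
  qed
  have "(\<integral>\<^sup>+z. h (fst z) (snd z) \<partial>N) \<le> ennreal (96 * pi) * (\<integral>\<^sup>+z. h (fst z) (snd z) \<partial>lborel)"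
  proof (rule nn_integral_le_lborel_of_open)
    show "sets N = sets borel" by (simp add: N_def borel_prod)
    show "(\<lambda>z. h (fst z) (snd z)) \<in> borel_measurable borel" using h2 by (simp add: borel_prod)
    fix U :: "(momentum \<times> momentum) set" assume U: "open U"
    then have [measurable]: "U \<in> sets (borel \<Otimes>\<^sub>M borel)" unfolding borel_prod by (rule borel_open)
    have "emeasure N U = (\<integral>\<^sup>+z. indicator U z \<partial>N)"
      by (simp add: N_def)
    also have "\<dots> \<le> ennreal (96 * pi) * emeasure lborel U"
      using collision_plane_open[OF on U] by (subst Nint) (simp_all add: p_def)
    finally show "emeasure N U \<le> ennreal (96 * pi) * emeasure lborel U" .
  qed simp
  also have "(\<integral>\<^sup>+z. h (fst z) (snd z) \<partial>lborel) = (\<integral>\<^sup>+p. \<integral>\<^sup>+q. h p q \<partial>lborel \<partial>lborel)"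
    by (subst lborel_prod[symmetric], subst lborel.nn_integral_fst[symmetric]) auto
  finally show ?thesis
    by (subst (asm) Nint) (simp_all add: p_def)
qed

subsection \<open>Collision frequency and gain term\<close>

text \<open>\<open>energy q - norm q\<close> is the reciprocal of \<open>energy q + norm q\<close>,
  so for \<open>q\<close> in a bounded set \<open>s_inv p q\<close> grows at least linearly in
  \<open>energy p\<close>. This settles large \<open>p\<close> in
  \<open>nn_integral_kernel_ge\<close>.\<close>

lemma s_inv_ge_ratio: "energy p / energy q \<le> s_inv p q"
proof -
  have q: "(energy q - norm q) * (energy q + norm q) = 1"
    using energy_sq[of q] by (simp add: power2_eq_square algebra_simps)
  have pos: "0 < energy q + norm q" using energy_pos[of q] norm_ge_zero[of q] by linarith
  have "1 / (2 * energy q) \<le> 1 / (energy q + norm q)"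
    using pos norm_le_energy[of q] by (intro divide_left_mono) auto
  also have "\<dots> = energy q - norm q" using q pos by (simp add: field_simps)
  finally have "energy p * (1 / (2 * energy q)) \<le> energy p * (energy q - norm q)"
    by (intro mult_left_mono) (auto intro: less_imp_le)
  moreover have "p \<bullet> q \<le> energy p * norm q"
    using Cauchy_Schwarz_ineq2[of p q] mult_right_mono[OF norm_le_energy[of p], of "norm q"] by simp
  ultimately show ?thesis
    by (simp add: s_inv_def rel_momentum_sq right_diff_distrib)
qed

text \<open>The double integral \<open>Y\<close> does not involve \<open>p\<close>, and the triangle
  inequality through \<open>p\<close> bounds it by \<open>4 * m * X p\<close>. It is nonzero because
  points are Lebesgue null: the mass of \<open>\<rho>\<close> cannot sit at a single
  \<open>q\<close>.\<close>

lemma nn_integral_dist_sq_ge: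
  fixes \<rho> :: "'a::euclidean_space \<Rightarrow> ennreal"
  assumes [measurable]: "\<rho> \<in> borel_measurable borel"
    and pos: "(\<integral>\<^sup>+q. \<rho> q \<partial>lborel) \<noteq> 0" and fin: "(\<integral>\<^sup>+q. \<rho> q \<partial>lborel) < \<infinity>"
  obtains c :: real where "0 < c" "\<And>p. ennreal c \<le> (\<integral>\<^sup>+q. ennreal ((norm (p - q))\<^sup>2) * \<rho> q \<partial>lborel)"
proof -
  define m where "m = (\<integral>\<^sup>+q. \<rho> q \<partial>lborel)"
  define X where "X = (\<lambda>p. \<integral>\<^sup>+q. ennreal ((norm (p - q))\<^sup>2) * \<rho> q \<partial>lborel)"
  define Y where "Y = (\<integral>\<^sup>+q. \<integral>\<^sup>+q'. ennreal ((norm (q - q'))\<^sup>2) * \<rho> q * \<rho> q' \<partial>lborel \<partial>lborel)"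
  have [measurable]: "X \<in> borel_measurable borel" unfolding X_def by measurable
  have le: "Y \<le> 4 * m * X p" for p
  proof -
    have "Y \<le> (\<integral>\<^sup>+q. \<integral>\<^sup>+q'. 2 * \<rho> q' * (ennreal ((norm (p - q))\<^sup>2) * \<rho> q) + 2 * \<rho> q * (ennreal ((norm (p - q'))\<^sup>2) * \<rho> q') \<partial>lborel \<partial>lborel)"
      unfolding Y_def
    proof (intro nn_integral_mono)
      fix q q' :: 'a
      have "norm (q - q') \<le> norm (p - q) + norm (p - q')"
        using norm_triangle_ineq4[of "p - q'" "p - q"] by simp
      then have "(norm (q - q'))\<^sup>2 \<le> (norm (p - q) + norm (p - q'))\<^sup>2" by (intro power_mono) auto
      also have "\<dots> \<le> 2 * (norm (p - q))\<^sup>2 + 2 * (norm (p - q'))\<^sup>2"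
        using sum_squares_bound[of "norm (p - q)" "norm (p - q')"] by (simp add: power2_sum)
      finally have sq: "(norm (q - q'))\<^sup>2 \<le> 2 * (norm (p - q))\<^sup>2 + 2 * (norm (p - q'))\<^sup>2" .
      have "ennreal ((norm (q - q'))\<^sup>2) \<le> 2 * ennreal ((norm (p - q))\<^sup>2) + 2 * ennreal ((norm (p - q'))\<^sup>2)"
      proof -
        have "2 * ennreal a = ennreal (2 * a)" if "0 \<le> a" for a
          using that by (simp add: ennreal_mult)
        then show ?thesis
          using sq by (simp add: ennreal_leI flip: ennreal_plus)
      qed
      then have "ennreal ((norm (q - q'))\<^sup>2) * (\<rho> q * \<rho> q') \<le>
          (2 * ennreal ((norm (p - q))\<^sup>2) + 2 * ennreal ((norm (p - q'))\<^sup>2)) * (\<rho> q * \<rho> q')"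
        by (rule mult_right_mono) simp
      then show "ennreal ((norm (q - q'))\<^sup>2) * \<rho> q * \<rho> q' \<le>
          2 * \<rho> q' * (ennreal ((norm (p - q))\<^sup>2) * \<rho> q) + 2 * \<rho> q * (ennreal ((norm (p - q'))\<^sup>2) * \<rho> q')"
        by (simp add: distrib_right distrib_left mult_ac)
    qed
    also have "\<dots> = (\<integral>\<^sup>+q. 2 * m * (ennreal ((norm (p - q))\<^sup>2) * \<rho> q) + 2 * X p * \<rho> q \<partial>lborel)"
    proof (intro nn_integral_cong)
      fix q
      have "(\<integral>\<^sup>+q'. 2 * \<rho> q' * (ennreal ((norm (p - q))\<^sup>2) * \<rho> q) \<partial>lborel) = 2 * m * (ennreal ((norm (p - q))\<^sup>2) * \<rho> q)"
        by (simp add: nn_integral_multc nn_integral_cmult m_def)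
      moreover have "(\<integral>\<^sup>+q'. 2 * \<rho> q * (ennreal ((norm (p - q'))\<^sup>2) * \<rho> q') \<partial>lborel) = 2 * \<rho> q * X p"
        by (subst nn_integral_cmult) (auto simp: X_def)
      ultimately show "(\<integral>\<^sup>+q'. 2 * \<rho> q' * (ennreal ((norm (p - q))\<^sup>2) * \<rho> q) + 2 * \<rho> q * (ennreal ((norm (p - q'))\<^sup>2) * \<rho> q') \<partial>lborel) =
          2 * m * (ennreal ((norm (p - q))\<^sup>2) * \<rho> q) + 2 * X p * \<rho> q"
        by (subst nn_integral_add) (auto simp: mult_ac)
    qed
    also have "\<dots> = 2 * m * X p + 2 * X p * m"
      by (subst nn_integral_add) (auto simp: nn_integral_cmult m_def X_def)
    also have "\<dots> = (2 + 2) * (m * X p)"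
      unfolding distrib_right by (simp add: mult_ac)
    also have "\<dots> = 4 * m * X p" by (simp add: mult.assoc)
    finally show ?thesis by simp
  qed
  have "Y \<noteq> 0"
  proof
    assume "Y = 0"
    then have "AE q in lborel. (\<integral>\<^sup>+q'. ennreal ((norm (q - q'))\<^sup>2) * \<rho> q * \<rho> q' \<partial>lborel) = 0"
      unfolding Y_def by (subst (asm) nn_integral_0_iff_AE) auto
    moreover have "\<not> (AE q in lborel. \<rho> q = 0)"
      using pos by (subst (asm) nn_integral_0_iff_AE) auto
    ultimately obtain q where q: "\<rho> q \<noteq> 0" "(\<integral>\<^sup>+q'. ennreal ((norm (q - q'))\<^sup>2) * \<rho> q * \<rho> q' \<partial>lborel) = 0"
      by (metis (mono_tags, lifting) eventually_mono)
    from q(2) have "AE q' in lborel. ennreal ((norm (q - q'))\<^sup>2) * \<rho> q * \<rho> q' = 0"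
      by (subst (asm) nn_integral_0_iff_AE) auto
    with AE_lborel_singleton[of q] have "AE q' in lborel. \<rho> q' = 0"
      by eventually_elim (use q(1) in auto)
    then show False using \<open>\<not> (AE q in lborel. \<rho> q = 0)\<close> by simp
  qed
  define b where "b = Y / (4 * m)"
  have m: "4 * m \<noteq> 0" "4 * m \<noteq> top"
    using pos fin by (auto simp: m_def ennreal_mult_eq_top_iff)
  have "b \<noteq> 0" using \<open>Y \<noteq> 0\<close> m by (simp add: b_def ennreal_divide_eq_0_iff)
  \<comment> \<open>\<open>Y\<close> may be infinite, so a number strictly between 0 and
    \<open>b\<close> is chosen to get a real constant.\<close>
  then obtain z where z: "0 < z" "z < b" using dense[of 0 b] by (auto simp: zero_less_iff_neq_zero)
  then obtain c where c: "z = ennreal c" "0 < c"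
    by (cases z rule: ennreal_cases) auto
  have "ennreal c \<le> X p" for p
  proof -
    have "ennreal c \<le> Y / (4 * m)" using z c by (simp add: b_def)
    also have "\<dots> \<le> (4 * m * X p) / (4 * m)" by (intro divide_right_mono_ennreal le)
    also have "\<dots> = X p" using m by (metis ennreal_mult_divide_eq mult.commute)
    finally show ?thesis .
  qed
  then show ?thesis using that[OF c(2)] by (simp add: X_def)
qed

text \<open>For bounded \<open>p\<close> the kernel is bounded below by a multiple of \<open>(norm (p - q))\<^sup>2\<close>, whose integral
  against a measure without atoms stays away from \<open>0\<close>; for large \<open>p\<close> the kernel itself is bounded below.\<close>

lemma nn_integral_kernel_ge:
  fixes \<rho> :: "momentum \<Rightarrow> ennreal"
  assumes [measurable]: "\<rho> \<in> borel_measurable borel"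
    and pos: "(\<integral>\<^sup>+q. \<rho> q \<partial>lborel) \<noteq> 0" and fin: "(\<integral>\<^sup>+q. \<rho> q \<partial>lborel) < \<infinity>"
    and supp: "\<And>q. \<rho> q \<noteq> 0 \<Longrightarrow> energy q \<le> R"
  obtains c :: real where "0 < c" "\<And>p. ennreal c \<le> (\<integral>\<^sup>+q. ennreal (moller p q * rel_momentum p q) * \<rho> q \<partial>lborel)"
proof -
  obtain c where c: "0 < c" "\<And>p. ennreal c \<le> (\<integral>\<^sup>+q. ennreal ((norm (p - q))\<^sup>2) * \<rho> q \<partial>lborel)"
    using nn_integral_dist_sq_ge[OF assms(1-3)] by metis
  obtain m where m: "(\<integral>\<^sup>+q. \<rho> q \<partial>lborel) = ennreal m" "0 < m"
    using pos fin by (cases "\<integral>\<^sup>+q. \<rho> q \<partial>lborel" rule: ennreal_cases) (auto simp: less_le)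
  have "\<exists>q. \<rho> q \<noteq> 0"
    using pos by (metis (mono_tags, lifting) nn_integral_0_iff_AE assms(1) eventuallyI measurable_lborel2)
  then obtain q0 where "\<rho> q0 \<noteq> 0" ..
  then have R: "1 \<le> R" using supp[of q0] energy_ge_1[of q0] by linarith
  \<comment> \<open>The first entry serves \<open>energy p > 8 * R\<close>, the second
    \<open>energy p \<le> 8 * R\<close>, where \<open>energy p * energy q \<le> 8 * R * R\<close> on
    the support of \<open>\<rho>\<close>.\<close>
  define d where "d = min (m / R\<^sup>2) (2 / (8 * R * R) ^ 3 * c)"
  have "d > 0" using R c m by (simp add: d_def)
  moreover have "ennreal d \<le> (\<integral>\<^sup>+q. ennreal (moller p q * rel_momentum p q) * \<rho> q \<partial>lborel)" for p
  proof (cases "energy p \<le> 8 * R")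
    case True
    have "ennreal d \<le> ennreal (2 / (8 * R * R) ^ 3) * ennreal c"
      using R c by (simp add: d_def flip: ennreal_mult)
    also have "\<dots> \<le> ennreal (2 / (8 * R * R) ^ 3) * (\<integral>\<^sup>+q. ennreal ((norm (p - q))\<^sup>2) * \<rho> q \<partial>lborel)"
      by (intro mult_left_mono c) simp
    also have "\<dots> = (\<integral>\<^sup>+q. ennreal (2 / (8 * R * R) ^ 3) * (ennreal ((norm (p - q))\<^sup>2) * \<rho> q) \<partial>lborel)"
      by (subst nn_integral_cmult) auto
    also have "\<dots> \<le> (\<integral>\<^sup>+q. ennreal (moller p q * rel_momentum p q) * \<rho> q \<partial>lborel)"
    proof (intro nn_integral_mono)
      fix q
      show "ennreal (2 / (8 * R * R) ^ 3) * (ennreal ((norm (p - q))\<^sup>2) * \<rho> q) \<le>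
          ennreal (moller p q * rel_momentum p q) * \<rho> q"
      proof (cases "\<rho> q = 0")
        case False
        have "2 / (8 * R * R) ^ 3 * (norm (p - q))\<^sup>2 = 2 * (norm (p - q))\<^sup>2 / (8 * R * R) ^ 3" by simp
        also have "\<dots> \<le> 2 * (norm (p - q))\<^sup>2 / (energy p * energy q) ^ 3"
          using True supp[OF False] R
          by (intro divide_left_mono power_mono mult_mono) (auto intro: less_imp_le)
        also have "\<dots> \<le> moller p q * rel_momentum p q" by (rule moller_rel_momentum_ge)
        finally have "ennreal (2 / (8 * R * R) ^ 3) * ennreal ((norm (p - q))\<^sup>2) \<le> ennreal (moller p q * rel_momentum p q)"
          using R by (simp add: ennreal_leI flip: ennreal_mult)
        then show ?thesis unfolding mult.assoc[symmetric] by (intro mult_right_mono) auto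
      qed simp
    qed
    finally show ?thesis .
  next
    case False
    have "ennreal d \<le> ennreal (1 / R\<^sup>2) * ennreal m"
      using R m by (simp add: d_def flip: ennreal_mult)
    also have "\<dots> = (\<integral>\<^sup>+q. ennreal (1 / R\<^sup>2) * \<rho> q \<partial>lborel)"
      using m by (subst nn_integral_cmult) auto
    also have "\<dots> \<le> (\<integral>\<^sup>+q. ennreal (moller p q * rel_momentum p q) * \<rho> q \<partial>lborel)"
    proof (intro nn_integral_mono)
      fix q
      show "ennreal (1 / R\<^sup>2) * \<rho> q \<le> ennreal (moller p q * rel_momentum p q) * \<rho> q"
      proof (cases "\<rho> q = 0")
        case nz: False
        have q: "energy q \<le> R" by (rule supp[OF nz])
        have "energy p / R \<le> energy p / energy q"
          using q R by (intro divide_left_mono) (auto intro: less_imp_le)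
        then have s: "energy p / R \<le> s_inv p q" using s_inv_ge_ratio[of p q] by linarith
        \<comment> \<open>The threshold 8 makes room for the 4 in \<open>g\<^sup>2 = s - 4\<close>:
          at least half of \<open>energy p / R\<close> remains after the subtraction.\<close>
        have "8 \<le> energy p / R" using False R by (simp add: field_simps)
        then have "energy p / (2 * R) \<le> (rel_momentum p q)\<^sup>2"
          using s by (simp add: s_inv_def)
        moreover have "2 \<le> sqrt (s_inv p q)" using s_inv_ge_4[of p q] by (intro real_le_rsqrt) auto
        ultimately have "energy p / (2 * R) * 2 \<le> (rel_momentum p q)\<^sup>2 * sqrt (s_inv p q)"
          by (intro mult_mono) auto
        then have "energy p / (2 * R) * 2 / (energy p * energy q) \<le>
            (rel_momentum p q)\<^sup>2 * sqrt (s_inv p q) / (energy p * energy q)"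
          by (rule divide_right_mono) (simp add: less_imp_le)
        then have "energy p / R / (energy p * energy q) \<le> moller p q * rel_momentum p q"
          by (simp add: moller_def power2_eq_square mult_ac)
        moreover have "1 / R\<^sup>2 \<le> energy p / R / (energy p * energy q)"
        proof -
          have "energy p \<noteq> 0" using energy_pos[of p] by linarith
          moreover have "1 / (R * R) \<le> 1 / (R * energy q)"
            using q R by (intro divide_left_mono mult_left_mono) auto
          ultimately show ?thesis by (simp add: power2_eq_square)
        qed
        ultimately show ?thesis by (intro mult_right_mono ennreal_leI) auto
      qed simp
    qed
    finally show ?thesis .
  qed
  ultimately show ?thesis by (rule that)
qed

section \<open>Essential supremum in the space variable\<close>

lemma Linf_x_le_iff:
  assumes f: "(\<lambda>(x, p). f x p) \<in> borel_measurable (restrict_space borel ({0..1} \<times> UNIV))"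
  shows "Linf_x f p \<le> c \<longleftrightarrow> (AE x in lborel. x \<in> {0..1} \<longrightarrow> f x p \<le> c)"
proof -
  have "(\<lambda>x. (x, p)) \<in> measurable (restrict_space lborel {0..1}) (restrict_space borel ({0..1} \<times> UNIV))"
    by (rule measurable_restrict_space2)
      (auto simp: space_restrict_space simp flip: borel_prod intro!: measurable_restrict_space1)
  from measurable_compose[OF this f]
  have m: "(\<lambda>x. f x p) \<in> borel_measurable (restrict_space lborel {0..1})" by simp
  have "(AE x in restrict_space lborel {0..1}. f x p \<le> c) \<longleftrightarrow> (AE x in lborel. x \<in> {0..1} \<longrightarrow> f x p \<le> c)"
    by (rule AE_restrict_space_iff) simp
  moreover have "Linf_x f p \<le> c \<longleftrightarrow> (AE x in restrict_space lborel {0..1}. f x p \<le> c)"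
    unfolding Linf_x_def
    using esssup_AE[of "\<lambda>x. f x p" "restrict_space lborel {0..1}"] esssup_I[OF m, of c]
    by (auto elim: eventually_mono order_trans)
  ultimately show ?thesis by simp
qed

context
  fixes f :: "real \<Rightarrow> momentum \<Rightarrow> ennreal"
  assumes f: "(\<lambda>(x, p). f x p) \<in> borel_measurable (restrict_space borel ({0..1} \<times> UNIV))"
begin

text \<open>Nothing is known of \<open>f x\<close> for \<open>x\<close> outside the unit interval;
  the cut-off gives a function that is jointly measurable on the whole space, as Fubini
  requires.\<close>

lemma borel_measurable_extend: "(\<lambda>z. f (fst z) (snd z) * indicator {0..1} (fst z)) \<in> borel_measurable (borel \<Otimes>\<^sub>M borel)"
proof -
  have "{0..1} \<times> UNIV \<in> sets (borel :: (real \<times> momentum) measure)"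
    by (simp add: closed_Times borel_closed)
  then have "(\<lambda>z. (case z of (x, p) \<Rightarrow> f x p) * indicator ({0..1} \<times> UNIV) z) \<in> borel_measurable borel"
    using f by (subst (asm) borel_measurable_restrict_space_iff_ennreal) auto
  then show ?thesis
    unfolding borel_prod by (rule measurable_cong[THEN iffD1, rotated]) (auto simp: indicator_def split: prod.split)
qed

text \<open>By \<open>Linf_x_le_iff\<close> a sublevel set consists of the \<open>p\<close> for
  which the slice where \<open>f\<close> exceeds \<open>c\<close> is null, and the measure of a
  slice is measurable in \<open>p\<close>.\<close>

lemma borel_measurable_Linf_x: "Linf_x f \<in> borel_measurable borel"
proof (rule borel_measurableI_le)
  fix c
  note borel_measurable_extend[measurable]
  define k where "k = (\<lambda>p. \<integral>\<^sup>+x. indicator {z. \<not> f (fst z) (snd z) * indicator {0..1} (fst z) \<le> c} (x, p) \<partial>lborel)"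
  have [measurable]: "{z. \<not> f (fst z) (snd z) * indicator {0..1} (fst z) \<le> c} \<in> sets (borel \<Otimes>\<^sub>M borel)"
  proof -
    have "{z \<in> space (borel \<Otimes>\<^sub>M borel). \<not> f (fst z) (snd z) * indicator {0..1} (fst z) \<le> c} \<in> sets (borel \<Otimes>\<^sub>M borel)"
      by measurable
    then show ?thesis by (simp add: space_pair_measure)
  qed
  have [measurable]: "k \<in> borel_measurable borel" unfolding k_def by measurable
  have "Linf_x f p \<le> c \<longleftrightarrow> k p = 0" for p
    unfolding Linf_x_le_iff[OF f] k_def
    by (subst nn_integral_0_iff_AE, measurable) (auto simp: indicator_def intro!: AE_cong)
  then show "{p \<in> space borel. Linf_x f p \<le> c} \<in> sets borel" by simp
qed

text \<open>The null set of \<open>x\<close> where the bound fails depends on the momentum; Fubini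
  exchanges the quantifiers. The general map \<open>m\<close> allows use along \<open>post_p\<close>
  and \<open>post_q\<close> with no knowledge of how these maps treat null sets.\<close>

lemma AE_le_Linf_x:
  assumes "sigma_finite_measure N" and m[measurable]: "m \<in> borel_measurable N"
  shows "AE x in lborel. x \<in> {0..1} \<longrightarrow> (AE w in N. f x (m w) \<le> Linf_x f (m w))"
proof -
  interpret N: sigma_finite_measure N by fact
  interpret NL: pair_sigma_finite N "lborel :: real measure" ..
  note borel_measurable_extend[measurable] borel_measurable_Linf_x[measurable]
  have [measurable (raw)]: "(\<lambda>z. f (a z) (b z) * indicator {0..1} (a z)) \<in> borel_measurable M"
    if "a \<in> borel_measurable M" "b \<in> borel_measurable M" for a b and M :: "'z measure"
    using measurable_compose[OF measurable_Pair[OF that] borel_measurable_extend] by simp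
  have "AE w in N. AE x in lborel. f x (m w) * indicator {0..1} x \<le> Linf_x f (m w)"
  proof (rule AE_I2)
    fix w
    have "AE x in lborel. x \<in> {0..1} \<longrightarrow> f x (m w) \<le> Linf_x f (m w)"
      using Linf_x_le_iff[OF f] by blast
    then show "AE x in lborel. f x (m w) * indicator {0..1} x \<le> Linf_x f (m w)"
      by eventually_elim (auto simp: indicator_def)
  qed
  then have "AE x in lborel. AE w in N. f x (m w) * indicator {0..1} x \<le> Linf_x f (m w)"
    by (subst (asm) NL.AE_commute) measurable
  then show ?thesis by eventually_elim (auto simp: indicator_def)
qed

end

section \<open>Damping by the collision frequency\<close>

lemma exp_neg_antimono: "s \<le> t \<Longrightarrow> exp_neg t \<le> exp_neg s"
  by (cases s rule: ennreal_cases; cases t rule: ennreal_cases)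
    (auto simp: exp_neg_def ennreal_le_iff top_unique intro!: ennreal_leI)

lemma exp_neg_ennreal: "0 \<le> t \<Longrightarrow> exp_neg (ennreal t) = ennreal (exp (- t))"
  by (simp add: exp_neg_def)

lemma exp_neg_le_1: "exp_neg t \<le> 1"
  by (simp add: exp_neg_def)

text \<open>The bound is independent of \<open>a\<close>, which will be
  \<open>1 / \<bar>phat1 p\<bar>\<close>: the damping compensates the factor in front of the gain
  term, however small \<open>p $ 1\<close> is.\<close>

lemma scaled_exp_integral_le:
  fixes a b c d \<nu> :: real
  assumes pos: "0 < a" "0 < \<nu>" and "c \<le> d"
  shows "ennreal a * (\<integral>\<^sup>+z\<in>{c..d}. ennreal (exp (- (a * \<nu> * (d - z)))) \<partial>lborel) \<le> ennreal (1 / \<nu>)"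
    and "ennreal a * (\<integral>\<^sup>+z\<in>{c..d}. ennreal (exp (- (a * \<nu> * (z - c)))) \<partial>lborel) \<le> ennreal (1 / \<nu>)"
proof -
  have k: "a * \<nu> \<noteq> 0" using pos by simp
  have r: "a * (x / (a * \<nu>)) = x / \<nu>" for x using pos by simp
  have "(\<integral>\<^sup>+z. ennreal (exp (- (a * \<nu> * (d - z)))) * indicator {c..d} z \<partial>lborel) =
      ennreal (exp (- (a * \<nu> * (d - d))) / (a * \<nu>) - exp (- (a * \<nu> * (d - c))) / (a * \<nu>))"
    using assms(3) k by (intro nn_integral_FTC_Icc) (auto intro!: derivative_eq_intros)
  also have "\<dots> \<le> ennreal (1 / (a * \<nu>))" using pos by (intro ennreal_leI) simp
  finally have "ennreal a * (\<integral>\<^sup>+z\<in>{c..d}. ennreal (exp (- (a * \<nu> * (d - z)))) \<partial>lborel) \<le> ennreal a * ennreal (1 / (a * \<nu>))"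
    by (rule mult_left_mono) simp
  then show "ennreal a * (\<integral>\<^sup>+z\<in>{c..d}. ennreal (exp (- (a * \<nu> * (d - z)))) \<partial>lborel) \<le> ennreal (1 / \<nu>)"
    using pos by (simp add: r flip: ennreal_mult)
  have "(\<integral>\<^sup>+z. ennreal (exp (- (a * \<nu> * (z - c)))) * indicator {c..d} z \<partial>lborel) =
      ennreal (- exp (- (a * \<nu> * (d - c))) / (a * \<nu>) - - exp (- (a * \<nu> * (c - c))) / (a * \<nu>))"
    using assms(3) k by (intro nn_integral_FTC_Icc) (auto intro!: derivative_eq_intros)
  also have "\<dots> \<le> ennreal (1 / (a * \<nu>))" using pos by (intro ennreal_leI) simp
  finally have "ennreal a * (\<integral>\<^sup>+z\<in>{c..d}. ennreal (exp (- (a * \<nu> * (z - c)))) \<partial>lborel) \<le> ennreal a * ennreal (1 / (a * \<nu>))"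
    by (rule mult_left_mono) simp
  then show "ennreal a * (\<integral>\<^sup>+z\<in>{c..d}. ennreal (exp (- (a * \<nu> * (z - c)))) \<partial>lborel) \<le> ennreal (1 / \<nu>)"
    using pos by (simp add: r flip: ennreal_mult)
qed

section \<open>The gain term on planes and the weight\<close>

definition gain :: "(momentum \<Rightarrow> ennreal) \<Rightarrow> momentum \<Rightarrow> ennreal" where
  "gain F p = (\<integral>\<^sup>+q. \<integral>\<^sup>+\<omega>. ennreal (moller p q * rel_momentum p q) *
     (F (post_p p q \<omega>) * F (post_q p q \<omega>)) \<partial>sphere_measure \<partial>lborel)"

lemma borel_measurable_gain [measurable]:
  assumes [measurable]: "F \<in> borel_measurable borel"
  shows "gain F \<in> borel_measurable borel"
  unfolding gain_def by measurable

lemma kernel_le: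
  assumes up: "\<And>g \<theta>. 0 \<le> g \<Longrightarrow> \<theta> \<in> {0..pi} \<Longrightarrow> \<sigma> g \<theta> \<le> B * (g * \<sigma>0 \<theta>)"
    and s0: "\<And>\<theta>. \<theta> \<in> {0..pi} \<Longrightarrow> 0 \<le> \<sigma>0 \<theta> \<and> \<sigma>0 \<theta> \<le> 1 / (4 * pi)" and B: "0 < B"
    and \<omega>: "norm \<omega> = 1"
  shows "moller p q * \<sigma> (rel_momentum p q) (scatter_angle p q \<omega>) \<le>
    B / (4 * pi) * (moller p q * rel_momentum p q)"
proof -
  let ?\<theta> = "scatter_angle p q \<omega>"
  have \<theta>: "?\<theta> \<in> {0..pi}" by (rule scatter_angle_range[OF \<omega>])
  have "\<sigma> (rel_momentum p q) ?\<theta> \<le> B * (rel_momentum p q * \<sigma>0 ?\<theta>)" using up[OF _ \<theta>] by simp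
  also have "\<dots> \<le> B * (rel_momentum p q * (1 / (4 * pi)))"
    using s0[OF \<theta>] B by (intro mult_left_mono) auto
  finally have "moller p q * \<sigma> (rel_momentum p q) ?\<theta> \<le> moller p q * (B * (rel_momentum p q * (1 / (4 * pi))))"
    by (intro mult_left_mono) auto
  then show ?thesis by (simp add: mult_ac)
qed

text \<open>Both post-collisional energies are at least 1, so their sum is at most twice their
  product; hence the \<open>sqrt 2\<close>. The product form lets the double integral over
  \<open>(p', q')\<close> split into a square.\<close>

lemma weight_le:
  assumes \<omega>: "norm \<omega> = 1" and k: "0 \<le> k"
  defines "w \<equiv> \<lambda>p. energy p powr (1 / 2) * phi k p"
  shows "w p \<le> sqrt 2 * (w (post_p p q \<omega>) * w (post_q p q \<omega>))"
proof -
  let ?a = "energy (post_p p q \<omega>)" and ?b = "energy (post_q p q \<omega>)"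
  have le: "energy p \<le> ?a + ?b" using energy_post[OF \<omega>, of p q] energy_pos[of q] by linarith
  have "?a * 1 \<le> ?a * ?b" "1 * ?b \<le> ?a * ?b"
    using energy_ge_1 by (intro mult_mono; simp add: less_imp_le)+
  then have "energy p \<le> 2 * (?a * ?b)" using le by linarith
  then have "energy p powr (1 / 2) \<le> (2 * (?a * ?b)) powr (1 / 2)"
    by (intro powr_mono2) (auto simp: less_imp_le)
  also have "\<dots> = sqrt 2 * (?a powr (1 / 2) * ?b powr (1 / 2))"
    by (simp add: powr_half_sqrt real_sqrt_mult less_imp_le)
  finally have 1: "energy p powr (1 / 2) \<le> sqrt 2 * (?a powr (1 / 2) * ?b powr (1 / 2))" .
  have "phi k p \<le> phi k (post_p p q \<omega>) * phi k (post_q p q \<omega>)"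
    using mult_left_mono[OF le k] by (simp add: phi_def distrib_left flip: exp_add)
  then have "energy p powr (1 / 2) * phi k p \<le>
      (sqrt 2 * (?a powr (1 / 2) * ?b powr (1 / 2))) * (phi k (post_p p q \<omega>) * phi k (post_q p q \<omega>))"
    using 1 by (intro mult_mono) (auto simp: phi_def)
  then show ?thesis by (simp add: w_def mult_ac)
qed

lemma norm_hyp_gain_le:
  assumes F[measurable]: "F \<in> borel_measurable borel" and k: "0 \<le> k"
  shows "norm_hyp k (gain F) \<le> ennreal (sqrt 2 * (96 * pi)) * (norm_w k F)\<^sup>2"
  unfolding norm_hyp_def
proof (rule SUP_least)
  fix E assume E: "E \<in> planes"
  define w where "w = (\<lambda>p. energy p powr (1 / 2) * phi k p)"
  have [measurable]: "w \<in> borel_measurable borel" unfolding w_def phi_def by measurable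
  have w0: "0 \<le> w p" for p by (simp add: w_def phi_def)
  obtain u v where fr: "orthonormal_frame E (u, v)" using ex_orthonormal_frame[OF E] by auto
  then have uv: "norm u = 1" "norm v = 1" "u \<bullet> v = 0" and span: "span {u, v} = E"
    by (auto simp: orthonormal_frame_def)
  \<comment> \<open>\<open>collision_plane_integral_le\<close> requires a unit normal of the plane,
    which exists because the span is a proper subspace.\<close>
  have "dim {u, v} < DIM(momentum)"
    using dim_span[of "{u, v}"] E by (simp add: span planes_def)
  then obtain x where x: "x \<noteq> 0" "\<And>y. y \<in> span {u, v} \<Longrightarrow> orthogonal x y"
    by (rule orthogonal_to_subspace_exists) auto
  define n where "n = sgn x"
  have n: "norm n = 1" "u \<bullet> n = 0" "v \<bullet> n = 0"
    using x(1) x(2)[of u] x(2)[of v]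
    by (auto simp: n_def norm_sgn sgn_div_norm orthogonal_def span_base inner_commute)
  define p where "p = (\<lambda>y :: real ^ 2. y $ 1 *\<^sub>R u + y $ 2 *\<^sub>R v)"
  have [measurable]: "p \<in> borel_measurable borel" unfolding p_def by measurable
  define h where "h = (\<lambda>a b. ennreal (sqrt 2) * ((ennreal (w a) * F a) * (ennreal (w b) * F b)))"
  have "(\<integral>\<^sup>+x. ennreal (w x) * gain F x \<partial>plane_measure E) = (\<integral>\<^sup>+y. ennreal (w (p y)) * gain F (p y) \<partial>lborel)"
    unfolding plane_measure_eq[OF fr] frame_measure_def prod.case
    by (subst nn_integral_distr) (auto simp: p_def)
  also have "\<dots> \<le> (\<integral>\<^sup>+y. \<integral>\<^sup>+q. \<integral>\<^sup>+\<omega>. ennreal (moller (p y) q * rel_momentum (p y) q) *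
      h (post_p (p y) q \<omega>) (post_q (p y) q \<omega>) \<partial>sphere_measure \<partial>lborel \<partial>lborel)"
  proof (rule nn_integral_mono)
    fix y
    have "ennreal (w (p y)) * gain F (p y) =
        (\<integral>\<^sup>+q. \<integral>\<^sup>+\<omega>. ennreal (w (p y)) * (ennreal (moller (p y) q * rel_momentum (p y) q) *
          (F (post_p (p y) q \<omega>) * F (post_q (p y) q \<omega>))) \<partial>sphere_measure \<partial>lborel)"
      unfolding gain_def by (simp add: nn_integral_cmult)
    also have "\<dots> \<le> (\<integral>\<^sup>+q. \<integral>\<^sup>+\<omega>. ennreal (moller (p y) q * rel_momentum (p y) q) *
      h (post_p (p y) q \<omega>) (post_q (p y) q \<omega>) \<partial>sphere_measure \<partial>lborel)"
    proof (rule nn_integral_mono)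
      fix q
      show "(\<integral>\<^sup>+\<omega>. ennreal (w (p y)) * (ennreal (moller (p y) q * rel_momentum (p y) q) *
          (F (post_p (p y) q \<omega>) * F (post_q (p y) q \<omega>))) \<partial>sphere_measure) \<le>
        (\<integral>\<^sup>+\<omega>. ennreal (moller (p y) q * rel_momentum (p y) q) *
          h (post_p (p y) q \<omega>) (post_q (p y) q \<omega>) \<partial>sphere_measure)"
        using AE_sphere_measure
      proof (intro nn_integral_mono_AE, eventually_elim)
        case (elim \<omega>)
        let ?p' = "post_p (p y) q \<omega>" and ?q' = "post_q (p y) q \<omega>"
        have "ennreal (w (p y)) \<le> ennreal (sqrt 2) * (ennreal (w ?p') * ennreal (w ?q'))"
        proof -
          have "w (p y) \<le> sqrt 2 * (w ?p' * w ?q')" unfolding w_def by (rule weight_le[OF elim(2) k])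
          then show ?thesis using w0 by (simp add: ennreal_leI flip: ennreal_mult)
        qed
        then have "ennreal (w (p y)) * (ennreal (moller (p y) q * rel_momentum (p y) q) * (F ?p' * F ?q')) \<le>
            ennreal (sqrt 2) * (ennreal (w ?p') * ennreal (w ?q')) *
              (ennreal (moller (p y) q * rel_momentum (p y) q) * (F ?p' * F ?q'))"
          by (rule mult_right_mono) simp
        then show ?case by (simp add: h_def mult_ac)
      qed
    qed
    finally show "ennreal (w (p y)) * gain F (p y) \<le> (\<integral>\<^sup>+q. \<integral>\<^sup>+\<omega>. ennreal (moller (p y) q * rel_momentum (p y) q) *
      h (post_p (p y) q \<omega>) (post_q (p y) q \<omega>) \<partial>sphere_measure \<partial>lborel)" .
  qed
  also have "\<dots> \<le> ennreal (96 * pi) * (\<integral>\<^sup>+a. \<integral>\<^sup>+b. h a b \<partial>lborel \<partial>lborel)"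
    unfolding p_def
    by (rule collision_plane_integral_le[OF uv(1,2) n(1) uv(3) n(2,3)]) (simp add: h_def, measurable)
  also have "(\<integral>\<^sup>+a. \<integral>\<^sup>+b. h a b \<partial>lborel \<partial>lborel) = ennreal (sqrt 2) * (norm_w k F)\<^sup>2"
  proof -
    have "norm_w k F = (\<integral>\<^sup>+a. ennreal (w a) * F a \<partial>lborel)" by (simp add: norm_w_def w_def)
    then show ?thesis by (simp add: h_def nn_integral_cmult nn_integral_multc power2_eq_square)
  qed
  also have "ennreal (96 * pi) * (ennreal (sqrt 2) * (norm_w k F)\<^sup>2) = ennreal (sqrt 2 * (96 * pi)) * (norm_w k F)\<^sup>2"
    by (subst ennreal_mult) (simp_all add: mult_ac)
  finally show "(\<integral>\<^sup>+p. ennreal (energy p powr (1 / 2) * phi k p) * gain F p \<partial>plane_measure E) \<le>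
      ennreal (sqrt 2 * (96 * pi)) * (norm_w k F)\<^sup>2"
    by (simp add: w_def)
qed

text \<open>For fixed \<open>p\<close> the exceptional \<open>z\<close> form a null set that may
  depend on \<open>p\<close>. This suffices, since the mild formulation integrates over
  \<open>z\<close> at fixed \<open>p\<close>.\<close>

lemma Q_plus_le_gain:
  assumes f: "(\<lambda>(x, p). f x p) \<in> borel_measurable (restrict_space borel ({0..1} \<times> UNIV))"
    and ker: "\<And>p q \<omega>. norm \<omega> = 1 \<Longrightarrow> moller p q * \<sigma> (rel_momentum p q) (scatter_angle p q \<omega>) \<le>
      b * (moller p q * rel_momentum p q)" and b: "0 \<le> b"
  shows "AE z in lborel. z \<in> {0..1} \<longrightarrow> Q_plus \<sigma> f f z p \<le> ennreal b * gain (Linf_x f) p"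
proof -
  let ?F = "Linf_x f"
  note borel_measurable_Linf_x[OF f, measurable]
  interpret qs: pair_sigma_finite "lborel :: momentum measure" sphere_measure ..
  let ?N = "(lborel :: momentum measure) \<Otimes>\<^sub>M sphere_measure"
  have N: "sigma_finite_measure ?N" ..
  have "AE z in lborel. z \<in> {0..1} \<longrightarrow>
      (AE w in ?N. f z (post_p p (fst w) (snd w)) \<le> ?F (post_p p (fst w) (snd w)))"
    by (rule AE_le_Linf_x[OF f N]) measurable
  moreover have "AE z in lborel. z \<in> {0..1} \<longrightarrow>
      (AE w in ?N. f z (post_q p (fst w) (snd w)) \<le> ?F (post_q p (fst w) (snd w)))"
    by (rule AE_le_Linf_x[OF f N]) measurable
  ultimately show ?thesis
  proof eventually_elim
    case (elim z)
    show ?case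
    proof
      assume z: "z \<in> {0..1}"
      have "AE w in ?N. f z (post_p p (fst w) (snd w)) \<le> ?F (post_p p (fst w) (snd w)) \<and>
          f z (post_q p (fst w) (snd w)) \<le> ?F (post_q p (fst w) (snd w))"
        using elim z by auto
      from qs.AE_pair[OF this]
      have AE: "AE q in lborel. AE \<omega> in sphere_measure. f z (post_p p q \<omega>) \<le> ?F (post_p p q \<omega>) \<and>
          f z (post_q p q \<omega>) \<le> ?F (post_q p q \<omega>)" by simp
      have "Q_plus \<sigma> f f z p \<le> (\<integral>\<^sup>+q. \<integral>\<^sup>+\<omega>. ennreal b * (ennreal (moller p q * rel_momentum p q) *
         (?F (post_p p q \<omega>) * ?F (post_q p q \<omega>))) \<partial>sphere_measure \<partial>lborel)"
        unfolding Q_plus_def using AE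
      proof (intro nn_integral_mono_AE, eventually_elim)
        case (elim q)
        show ?case
          using elim(2) AE_sphere_measure
        proof (intro nn_integral_mono_AE, eventually_elim)
          case (elim \<omega>)
          have "ennreal (moller p q * \<sigma> (rel_momentum p q) (scatter_angle p q \<omega>)) \<le>
              ennreal b * ennreal (moller p q * rel_momentum p q)"
            using ker[of \<omega> p q] elim b by (simp add: ennreal_leI flip: ennreal_mult)
          then have "ennreal (moller p q * \<sigma> (rel_momentum p q) (scatter_angle p q \<omega>)) *
              (f z (post_p p q \<omega>) * f z (post_q p q \<omega>)) * indicator (sphere 0 1) \<omega> \<le>
            ennreal b * ennreal (moller p q * rel_momentum p q) * (?F (post_p p q \<omega>) * ?F (post_q p q \<omega>)) * 1"
            using elim by (intro mult_mono) (auto simp: indicator_def)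
          then show ?case by (simp add: mult_ac)
        qed
      qed
      also have "\<dots> = ennreal b * gain ?F p"
        unfolding gain_def by (simp add: nn_integral_cmult)
      finally show "Q_plus \<sigma> f f z p \<le> ennreal b * gain ?F p" .
    qed
  qed
qed

text \<open>Up to \<open>b\<close> the kernel is at most
  \<open>8 * sqrt (energy p) * sqrt (energy q)\<close>. The factor in \<open>q\<close> is the power
  weight of \<open>norm_w\<close>, \<open>phi k q\<close> is at least 1, and the sphere contributes
  \<open>4 * pi\<close>.\<close>

lemma coll_freq_le:
  assumes f: "(\<lambda>(x, p). f x p) \<in> borel_measurable (restrict_space borel ({0..1} \<times> UNIV))"
    and ker: "\<And>p q \<omega>. norm \<omega> = 1 \<Longrightarrow> moller p q * \<sigma> (rel_momentum p q) (scatter_angle p q \<omega>) \<le>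
      b * (moller p q * rel_momentum p q)" and b: "0 \<le> b" and k: "0 \<le> k"
  shows "AE z in lborel. z \<in> {0..1} \<longrightarrow> coll_freq \<sigma> f z p \<le>
    ennreal (32 * pi * b * sqrt (energy p)) * norm_w k (Linf_x f)"
proof -
  let ?F = "Linf_x f"
  note borel_measurable_Linf_x[OF f, measurable]
  have [measurable]: "(\<lambda>q. ennreal (energy q powr (1 / 2) * phi k q)) \<in> borel_measurable borel"
    unfolding phi_def by measurable
  have "AE z in lborel. z \<in> {0..1} \<longrightarrow> (AE q in lborel. f z q \<le> ?F q)"
    by (rule AE_le_Linf_x[OF f sigma_finite_lborel, of "\<lambda>q. q"]) simp
  then show ?thesis
  proof eventually_elim
    case (elim z)
    show ?case
    proof
      assume "z \<in> {0..1}"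
      with elim have AE: "AE q in lborel. f z q \<le> ?F q" by simp
      define c where "c = 8 * b * sqrt (energy p)"
      have c: "0 \<le> c" using b by (simp add: c_def less_imp_le)
      have "coll_freq \<sigma> f z p \<le> (\<integral>\<^sup>+q. \<integral>\<^sup>+\<omega>. ennreal c * (ennreal (energy q powr (1 / 2) * phi k q) * ?F q) \<partial>sphere_measure \<partial>lborel)"
        unfolding coll_freq_def using AE
      proof (intro nn_integral_mono_AE, eventually_elim)
        case (elim q)
        note fF = elim(2)
        show ?case
          using AE_sphere_measure
        proof (intro nn_integral_mono_AE, eventually_elim)
          case (elim \<omega>)
          have "moller p q * \<sigma> (rel_momentum p q) (scatter_angle p q \<omega>) \<le> b * (8 * (sqrt (energy p) * sqrt (energy q)))"
            using ker[OF elim(2), of p q] mult_left_mono[OF moller_rel_momentum_le[of p q] b] by linarith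
          also have "\<dots> = c * (energy q powr (1 / 2) * 1)"
            by (simp add: c_def powr_half_sqrt less_imp_le)
          also have "\<dots> \<le> c * (energy q powr (1 / 2) * phi k q)"
            using c k by (intro mult_left_mono) (auto simp: phi_def less_imp_le)
          finally have "ennreal (moller p q * \<sigma> (rel_momentum p q) (scatter_angle p q \<omega>)) \<le>
              ennreal c * ennreal (energy q powr (1 / 2) * phi k q)"
            using c by (simp add: ennreal_leI phi_def flip: ennreal_mult)
          then have "ennreal (moller p q * \<sigma> (rel_momentum p q) (scatter_angle p q \<omega>)) * f z q * indicator (sphere 0 1) \<omega> \<le>
            ennreal c * ennreal (energy q powr (1 / 2) * phi k q) * ?F q * 1"
            using fF by (intro mult_mono) (auto simp: indicator_def)
          then show ?case by (simp add: mult_ac)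
        qed
      qed
      also have "\<dots> = ennreal c * norm_w k ?F * ennreal (4 * pi)"
        by (simp add: norm_w_def nn_integral_cmult nn_integral_multc emeasure_sphere_measure_UNIV)
      also have "\<dots> = ennreal (c * (4 * pi)) * norm_w k ?F"
        using c by (simp add: ennreal_mult mult_ac)
      also have "c * (4 * pi) = 32 * pi * b * sqrt (energy p)" by (simp add: c_def)
      finally show "coll_freq \<sigma> f z p \<le> ennreal (32 * pi * b * sqrt (energy p)) * norm_w k ?F" .
    qed
  qed
qed

text \<open>The scattering angle between \<open>\<omega>\<close> and the fixed direction of \<open>cos_scatter_eq\<close> is distributed like the
  polar angle of \<open>\<omega>\<close>, so the mass of \<open>\<sigma>0\<close> over the sphere does not depend on \<open>p\<close> and \<open>q\<close>.\<close>

lemma coll_freq_ge: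
  assumes low: "\<And>g \<theta>. 0 \<le> g \<Longrightarrow> \<theta> \<in> {0..pi} \<Longrightarrow> a * (g * \<sigma>0 \<theta>) \<le> \<sigma> g \<theta>" and a: "0 \<le> a"
    and \<sigma>0: "\<sigma>0 \<in> borel_measurable (restrict_space borel {0..pi})" "\<And>\<theta>. \<theta> \<in> {0..pi} \<Longrightarrow> 0 \<le> \<sigma>0 \<theta>"
    and \<rho>[measurable]: "\<rho> \<in> borel_measurable borel" and le: "\<And>q. \<rho> q \<le> f z q"
  shows "ennreal a * (\<integral>\<^sup>+\<omega>\<in>sphere 0 1. ennreal (\<sigma>0 (arccos (\<omega> $ 3))) \<partial>sphere_measure) *
      (\<integral>\<^sup>+q. ennreal (moller p q * rel_momentum p q) * \<rho> q \<partial>lborel) \<le> coll_freq \<sigma> f z p"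
proof -
  \<comment> \<open>\<open>\<sigma>0\<close> is known to be measurable on \<open>{0..pi}\<close>
    only; the extension by 0 outside \<open>{-1..1}\<close> gives a Borel function of the cosine on
    the whole line.\<close>
  define h where "h = (\<lambda>t. if t \<in> {-1..1} then ennreal (\<sigma>0 (arccos t)) else 0)"
  have [measurable]: "h \<in> borel_measurable borel"
  proof -
    have "arccos \<in> measurable (restrict_space borel {-1..1}) (restrict_space borel {0..pi})"
      by (rule measurable_restrict_space2)
        (auto simp: space_restrict_space arccos_lbound arccos_ubound
          intro!: borel_measurable_continuous_on_restrict continuous_on_arccos')
    from measurable_compose[OF this \<sigma>0(1)]
    have "(\<lambda>t. ennreal (\<sigma>0 (arccos t))) \<in> borel_measurable (restrict_space borel {-1..1})" by simp
    then show ?thesis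
      unfolding h_def by (subst (asm) measurable_restrict_space_iff[where c = 0]) auto
  qed
  define S where "S = (\<integral>\<^sup>+\<omega>\<in>sphere 0 1. ennreal (\<sigma>0 (arccos (\<omega> $ 3))) \<partial>sphere_measure)"
  have S: "S = (\<integral>\<^sup>+\<omega>. h (axis 3 1 \<bullet> \<omega>) \<partial>sphere_measure)"
    unfolding S_def using AE_sphere_measure
  proof (intro nn_integral_cong_AE, eventually_elim)
    case (elim \<omega>)
    then have "\<omega> $ 3 \<in> {-1..1}" using component_le_norm_cart[of \<omega> 3] by (auto simp: abs_le_iff)
    then show ?case using elim by (simp add: h_def inner_axis')
  qed
  have "ennreal a * S * (\<integral>\<^sup>+q. ennreal (moller p q * rel_momentum p q) * \<rho> q \<partial>lborel) =
      (\<integral>\<^sup>+q. ennreal a * S * (ennreal (moller p q * rel_momentum p q) * \<rho> q) \<partial>lborel)"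
    by (simp add: nn_integral_cmult)
  also have "\<dots> \<le> coll_freq \<sigma> f z p"
    unfolding coll_freq_def
  proof (rule nn_integral_mono)
    fix q
    show "ennreal a * S * (ennreal (moller p q * rel_momentum p q) * \<rho> q) \<le>
      (\<integral>\<^sup>+\<omega>\<in>sphere 0 1. ennreal (moller p q * \<sigma> (rel_momentum p q) (scatter_angle p q \<omega>)) * f z q \<partial>sphere_measure)"
    proof (cases "p = q")
      case True
      then show ?thesis by (simp add: rel_momentum_def)
    next
      case False
      then obtain l where l: "norm l = 1" "\<And>\<omega>. norm \<omega> = 1 \<Longrightarrow> cos_scatter p q \<omega> = l \<bullet> \<omega>"
        using cos_scatter_eq by metis
      have "S = (\<integral>\<^sup>+\<omega>. h (l \<bullet> \<omega>) \<partial>sphere_measure)"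
        unfolding S by (rule nn_integral_sphere_measure_inner) (simp_all add: l)
      then have "ennreal a * S * (ennreal (moller p q * rel_momentum p q) * \<rho> q) =
          (\<integral>\<^sup>+\<omega>. ennreal a * h (l \<bullet> \<omega>) * (ennreal (moller p q * rel_momentum p q) * \<rho> q) \<partial>sphere_measure)"
        by (simp add: nn_integral_cmult nn_integral_multc)
      also have "\<dots> \<le> (\<integral>\<^sup>+\<omega>\<in>sphere 0 1. ennreal (moller p q * \<sigma> (rel_momentum p q) (scatter_angle p q \<omega>)) * f z q \<partial>sphere_measure)"
        using AE_sphere_measure
      proof (intro nn_integral_mono_AE, eventually_elim)
        case (elim \<omega>)
        let ?\<theta> = "scatter_angle p q \<omega>"
        have \<theta>: "?\<theta> \<in> {0..pi}" by (rule scatter_angle_range[OF elim(2)])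
        have "l \<bullet> \<omega> \<in> {-1..1}" using abs_cos_scatter_le[OF elim(2), of p q] l(2)[OF elim(2)] by (auto simp: abs_le_iff)
        then have h: "h (l \<bullet> \<omega>) = ennreal (\<sigma>0 ?\<theta>)" by (simp add: h_def scatter_angle_def l(2)[OF elim(2)])
        have "moller p q * (a * (rel_momentum p q * \<sigma>0 ?\<theta>)) \<le> moller p q * \<sigma> (rel_momentum p q) ?\<theta>"
          by (intro mult_left_mono low \<theta>) auto
        then have "ennreal a * ennreal (\<sigma>0 ?\<theta>) * ennreal (moller p q * rel_momentum p q) \<le>
            ennreal (moller p q * \<sigma> (rel_momentum p q) ?\<theta>)"
          using a \<sigma>0(2)[OF \<theta>] by (simp add: ennreal_leI mult_ac flip: ennreal_mult)
        then have "ennreal a * ennreal (\<sigma>0 ?\<theta>) * ennreal (moller p q * rel_momentum p q) * \<rho> q \<le>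
            ennreal (moller p q * \<sigma> (rel_momentum p q) ?\<theta>) * f z q"
          using le by (intro mult_mono) auto
        then show ?case using elim(2) by (simp add: h mult.assoc)
      qed
      finally show ?thesis .
    qed
  qed
  finally show ?thesis unfolding S_def .
qed

subsection \<open>Steady states\<close>

text \<open>The lower bound \<open>\<nu>\<close> turns the damping into an explicit exponential, and
  after integration \<open>1 / phat1 p\<close> has disappeared from the estimate. For
  \<open>p $ 1 = 0\<close> the mild formulation gives \<open>f x p = 0\<close>, so no momentum is
  excluded.\<close>

lemma steady_state_Linf_le:
  assumes f: "(\<lambda>(x, p). f x p) \<in> borel_measurable (restrict_space borel ({0..1} \<times> UNIV))"
    and mild: "\<And>x. x \<in> {0..1} \<Longrightarrow> f x p = mild_rhs \<sigma> fL fR f x p"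
    and \<nu>: "0 < \<nu>" "\<And>z. z \<in> {0..1} \<Longrightarrow> ennreal \<nu> \<le> coll_freq \<sigma> f z p"
    and Q: "AE z in lborel. z \<in> {0..1} \<longrightarrow> Q_plus \<sigma> f f z p \<le> G"
  shows "Linf_x f p \<le> ennreal \<bar>inflow fL fR p\<bar> + ennreal (1 / \<nu>) * G"
  unfolding Linf_x_le_iff[OF f]
proof (intro AE_I2 impI)
  fix x :: real assume x: "x \<in> {0..1}"
  have damp: "exp_neg (ennreal a * (\<integral>\<^sup>+z'\<in>{c..d}. coll_freq \<sigma> f z' p \<partial>lborel)) \<le> ennreal (exp (- (a * \<nu> * (d - c))))"
    if "0 < a" "0 \<le> c" "c \<le> d" "d \<le> 1" for a c d
  proof -
    have "ennreal \<nu> * ennreal (d - c) = (\<integral>\<^sup>+z'. ennreal \<nu> * indicator {c..d} z' \<partial>lborel)"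
      using that by (subst nn_integral_cmult_indicator) auto
    also have "\<dots> \<le> (\<integral>\<^sup>+z'\<in>{c..d}. coll_freq \<sigma> f z' p \<partial>lborel)"
      using \<nu>(2) that by (intro nn_integral_mono) (auto simp: indicator_def)
    finally have "ennreal a * (ennreal \<nu> * ennreal (d - c)) \<le> ennreal a * (\<integral>\<^sup>+z'\<in>{c..d}. coll_freq \<sigma> f z' p \<partial>lborel)"
      by (rule mult_left_mono) simp
    then have "exp_neg (ennreal a * (\<integral>\<^sup>+z'\<in>{c..d}. coll_freq \<sigma> f z' p \<partial>lborel)) \<le> exp_neg (ennreal a * (ennreal \<nu> * ennreal (d - c)))"
      by (rule exp_neg_antimono)
    also have "ennreal a * (ennreal \<nu> * ennreal (d - c)) = ennreal (a * \<nu> * (d - c))"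
      using that \<nu>(1) by (simp add: mult.assoc flip: ennreal_mult)
    also have "exp_neg \<dots> = ennreal (exp (- (a * \<nu> * (d - c))))"
      using that \<nu>(1) by (intro exp_neg_ennreal) simp
    finally show ?thesis .
  qed
  have in_le: "ennreal t * exp_neg s \<le> ennreal \<bar>t\<bar>" for t s
  proof -
    have "ennreal t * exp_neg s \<le> ennreal \<bar>t\<bar> * 1"
      by (intro mult_mono exp_neg_le_1 ennreal_leI) auto
    then show ?thesis by simp
  qed
  consider "0 < p $ 1" | "p $ 1 < 0" | "p $ 1 = 0" by linarith
  then show "f x p \<le> ennreal \<bar>inflow fL fR p\<bar> + ennreal (1 / \<nu>) * G"
  proof cases
    case 1
    define a where "a = 1 / phat1 p"
    have a: "a > 0" using 1 by (simp add: a_def phat1_def)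
    have "(\<integral>\<^sup>+z\<in>{0..x}. exp_neg (ennreal a * (\<integral>\<^sup>+z'\<in>{z..x}. coll_freq \<sigma> f z' p \<partial>lborel)) * Q_plus \<sigma> f f z p \<partial>lborel) \<le>
        (\<integral>\<^sup>+z. (ennreal (exp (- (a * \<nu> * (x - z)))) * indicator {0..x} z) * G \<partial>lborel)"
      using Q
    proof (intro nn_integral_mono_AE, eventually_elim)
      case (elim z)
      show ?case
      proof (cases "z \<in> {0..x}")
        case True
        then show ?thesis
          using elim(2) x damp[OF a, of z x] by (auto intro!: mult_mono)
      qed simp
    qed
    also have "\<dots> = (\<integral>\<^sup>+z\<in>{0..x}. ennreal (exp (- (a * \<nu> * (x - z)))) \<partial>lborel) * G"
      by (rule nn_integral_multc) measurable
    finally have "ennreal a * (\<integral>\<^sup>+z\<in>{0..x}. exp_neg (ennreal a * (\<integral>\<^sup>+z'\<in>{z..x}. coll_freq \<sigma> f z' p \<partial>lborel)) * Q_plus \<sigma> f f z p \<partial>lborel) \<le>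
        ennreal a * ((\<integral>\<^sup>+z\<in>{0..x}. ennreal (exp (- (a * \<nu> * (x - z)))) \<partial>lborel) * G)"
      by (rule mult_left_mono) simp
    also have "\<dots> \<le> ennreal (1 / \<nu>) * G"
      unfolding mult.assoc[symmetric]
      using x by (intro mult_right_mono scaled_exp_integral_le a \<nu>) auto
    finally have "ennreal a * (\<integral>\<^sup>+z\<in>{0..x}. exp_neg (ennreal a * (\<integral>\<^sup>+z'\<in>{z..x}. coll_freq \<sigma> f z' p \<partial>lborel)) * Q_plus \<sigma> f f z p \<partial>lborel) \<le>
        ennreal (1 / \<nu>) * G" .
    moreover have "f x p = ennreal (fL p) * exp_neg (ennreal a * (\<integral>\<^sup>+z\<in>{0..x}. coll_freq \<sigma> f z p \<partial>lborel)) +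
        ennreal a * (\<integral>\<^sup>+z\<in>{0..x}. exp_neg (ennreal a * (\<integral>\<^sup>+z'\<in>{z..x}. coll_freq \<sigma> f z' p \<partial>lborel)) * Q_plus \<sigma> f f z p \<partial>lborel)"
      unfolding mild[OF x] mild_rhs_def a_def using 1 by simp
    moreover have "inflow fL fR p = fL p" using 1 by (simp add: inflow_def)
    ultimately show ?thesis using add_mono[OF in_le] by simp
  next
    case 2
    define a where "a = - (1 / phat1 p)"
    have a: "a > 0" using 2 by (simp add: a_def phat1_def divide_pos_neg)
    have "(\<integral>\<^sup>+z\<in>{x..1}. exp_neg (ennreal a * (\<integral>\<^sup>+z'\<in>{x..z}. coll_freq \<sigma> f z' p \<partial>lborel)) * Q_plus \<sigma> f f z p \<partial>lborel) \<le>
        (\<integral>\<^sup>+z. (ennreal (exp (- (a * \<nu> * (z - x)))) * indicator {x..1} z) * G \<partial>lborel)"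
      using Q
    proof (intro nn_integral_mono_AE, eventually_elim)
      case (elim z)
      show ?case
      proof (cases "z \<in> {x..1}")
        case True
        then show ?thesis
          using elim(2) x damp[OF a, of x z] by (auto intro!: mult_mono)
      qed simp
    qed
    also have "\<dots> = (\<integral>\<^sup>+z\<in>{x..1}. ennreal (exp (- (a * \<nu> * (z - x)))) \<partial>lborel) * G"
      by (rule nn_integral_multc) measurable
    finally have "ennreal a * (\<integral>\<^sup>+z\<in>{x..1}. exp_neg (ennreal a * (\<integral>\<^sup>+z'\<in>{x..z}. coll_freq \<sigma> f z' p \<partial>lborel)) * Q_plus \<sigma> f f z p \<partial>lborel) \<le>
        ennreal a * ((\<integral>\<^sup>+z\<in>{x..1}. ennreal (exp (- (a * \<nu> * (z - x)))) \<partial>lborel) * G)"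
      by (rule mult_left_mono) simp
    also have "\<dots> \<le> ennreal (1 / \<nu>) * G"
      unfolding mult.assoc[symmetric]
      using x by (intro mult_right_mono scaled_exp_integral_le a \<nu>) auto
    finally have "ennreal a * (\<integral>\<^sup>+z\<in>{x..1}. exp_neg (ennreal a * (\<integral>\<^sup>+z'\<in>{x..z}. coll_freq \<sigma> f z' p \<partial>lborel)) * Q_plus \<sigma> f f z p \<partial>lborel) \<le>
        ennreal (1 / \<nu>) * G" .
    moreover have "f x p = ennreal (fR p) * exp_neg (ennreal a * (\<integral>\<^sup>+z\<in>{x..1}. coll_freq \<sigma> f z p \<partial>lborel)) +
        ennreal a * (\<integral>\<^sup>+z\<in>{x..1}. exp_neg (ennreal a * (\<integral>\<^sup>+z'\<in>{x..z}. coll_freq \<sigma> f z' p \<partial>lborel)) * Q_plus \<sigma> f f z p \<partial>lborel)"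
      unfolding mild[OF x] mild_rhs_def a_def using 2 by simp
    moreover have "inflow fL fR p = fR p" using 2 by (simp add: inflow_def)
    ultimately show ?thesis using add_mono[OF in_le] by simp
  next
    case 3
    then have "f x p = 0" unfolding mild[OF x] mild_rhs_def by simp
    then show ?thesis by simp
  qed
qed

text \<open>The gain term is dropped. The damping is uncontrolled for momenta nearly parallel to the
  walls; \<open>r \<le> p $ 1\<close> and \<open>energy p \<le> R\<close> keep
  \<open>1 / phat1 p\<close> below \<open>R / r\<close>.\<close>

lemma steady_state_ge_inflow:
  assumes mild: "f x p = mild_rhs \<sigma> fL fR f x p" and x: "x \<in> {0..1}"
    and p: "0 < r" "r \<le> p $ 1" "energy p \<le> R"
    and le: "AE z in lborel. z \<in> {0..1} \<longrightarrow> coll_freq \<sigma> f z p \<le> ennreal T" and T: "0 \<le> T"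
  shows "ennreal (exp (- (R / r * T))) * ennreal (fL p) \<le> f x p"
proof -
  have p1: "0 < p $ 1" using p by linarith
  have R: "0 \<le> R" using p(3) energy_pos[of p] by linarith
  have "(\<integral>\<^sup>+z\<in>{0..x}. coll_freq \<sigma> f z p \<partial>lborel) \<le> (\<integral>\<^sup>+z. ennreal T * indicator {0..1 :: real} z \<partial>lborel)"
    using le
  proof (intro nn_integral_mono_AE, eventually_elim)
    case (elim z)
    then show ?case using x by (auto simp: indicator_def)
  qed
  also have "\<dots> = ennreal T" by (subst nn_integral_cmult_indicator) auto
  finally have "(\<integral>\<^sup>+z\<in>{0..x}. coll_freq \<sigma> f z p \<partial>lborel) \<le> ennreal T" .
  moreover have "1 / phat1 p \<le> R / r"
    using p p1 R by (simp add: phat1_def frac_le less_imp_le)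
  ultimately have "ennreal (1 / phat1 p) * (\<integral>\<^sup>+z\<in>{0..x}. coll_freq \<sigma> f z p \<partial>lborel) \<le> ennreal (R / r) * ennreal T"
    by (intro mult_mono ennreal_leI) auto
  also have "\<dots> = ennreal (R / r * T)" using p R T by (simp flip: ennreal_mult)
  finally have "exp_neg (ennreal (R / r * T)) \<le> exp_neg (ennreal (1 / phat1 p) * (\<integral>\<^sup>+z\<in>{0..x}. coll_freq \<sigma> f z p \<partial>lborel))"
    by (rule exp_neg_antimono)
  moreover have "exp_neg (ennreal (R / r * T)) = ennreal (exp (- (R / r * T)))"
    using p R T by (intro exp_neg_ennreal) simp
  ultimately have "ennreal (fL p) * ennreal (exp (- (R / r * T))) \<le>
      ennreal (fL p) * exp_neg (ennreal (1 / phat1 p) * (\<integral>\<^sup>+z\<in>{0..x}. coll_freq \<sigma> f z p \<partial>lborel))"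
    by (intro mult_left_mono) simp_all
  also have "\<dots> \<le> f x p"
    unfolding mild mild_rhs_def using p1 by (simp add: add_increasing2)
  finally show ?thesis by (simp add: mult.commute)
qed

theorem theorem1p2:
  fixes \<sigma> :: "real \<Rightarrow> real \<Rightarrow> real" and \<sigma>0 :: "real \<Rightarrow> real"
  assumes "hard_sphere_kernel \<sigma> \<sigma>0"
  shows "\<exists>k0>0. \<forall>k\<ge>k0. \<forall>fL fR f.
           boundary_condition k fL fR \<longrightarrow>
           steady_state \<sigma> k fL fR f \<longrightarrow>
           norm_hyp k (\<lambda>p. ennreal \<bar>inflow fL fR p\<bar>) < \<infinity> \<longrightarrow>
           norm_hyp k (Linf_x f) < \<infinity>"
proof -
  from assms obtain A B c0 where
    A: "0 < A" "\<And>g \<theta>. 0 \<le> g \<Longrightarrow> \<theta> \<in> {0..pi} \<Longrightarrow> A * (g * \<sigma>0 \<theta>) \<le> \<sigma> g \<theta>"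
    and B: "0 < B" "\<And>g \<theta>. 0 \<le> g \<Longrightarrow> \<theta> \<in> {0..pi} \<Longrightarrow> \<sigma> g \<theta> \<le> B * (g * \<sigma>0 \<theta>)"
    and \<sigma>0: "\<sigma>0 \<in> borel_measurable (restrict_space borel {0..pi})"
      "\<And>\<theta>. \<theta> \<in> {0..pi} \<Longrightarrow> 0 \<le> \<sigma>0 \<theta> \<and> \<sigma>0 \<theta> \<le> 1 / (4 * pi)"
    and c0: "0 < c0" "(LINT \<omega>:sphere 0 1|sphere_measure. \<sigma>0 (arccos (\<omega> $ 3))) = c0"
    unfolding hard_sphere_kernel_def by blast
  define b where "b = B / (4 * pi)"
  have b: "0 < b" using B(1) by (simp add: b_def)
  have ker: "moller p q * \<sigma> (rel_momentum p q) (scatter_angle p q \<omega>) \<le> b * (moller p q * rel_momentum p q)"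
    if "norm \<omega> = 1" for p q \<omega>
    unfolding b_def by (rule kernel_le[OF B(2) \<sigma>0(2) B(1) that])
  have S0: "(\<integral>\<^sup>+\<omega>\<in>sphere 0 1. ennreal (\<sigma>0 (arccos (\<omega> $ 3))) \<partial>sphere_measure) = ennreal c0"
  proof -
    let ?g = "\<lambda>\<omega> :: momentum. indicator (sphere 0 1) \<omega> *\<^sub>R \<sigma>0 (arccos (\<omega> $ 3))"
    have int: "integral\<^sup>L sphere_measure ?g = c0"
      using c0(2) by (simp add: set_lebesgue_integral_def)
    \<comment> \<open>A non-integrable function would have integral 0, contrary to
      \<open>0 < c0\<close>.\<close>
    then have "integrable sphere_measure ?g"
      using c0(1) not_integrable_integral_eq by force
    moreover have "0 \<le> ?g \<omega>" for \<omega>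
    proof (cases "\<omega> \<in> sphere 0 1")
      case True
      then have "- 1 \<le> \<omega> $ 3" "\<omega> $ 3 \<le> 1" using component_le_norm_cart[of \<omega> 3] by (auto simp: abs_le_iff)
      from arccos_bounded[OF this] show ?thesis using \<sigma>0(2) by simp
    qed simp
    ultimately have "(\<integral>\<^sup>+\<omega>. ennreal (?g \<omega>) \<partial>sphere_measure) = ennreal c0"
      using int by (subst nn_integral_eq_integral) auto
    moreover have "(\<integral>\<^sup>+\<omega>. ennreal (?g \<omega>) \<partial>sphere_measure) =
        (\<integral>\<^sup>+\<omega>\<in>sphere 0 1. ennreal (\<sigma>0 (arccos (\<omega> $ 3))) \<partial>sphere_measure)"
      by (intro nn_integral_cong) (auto simp: indicator_def)
    ultimately show ?thesis by simp
  qed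
  have "norm_hyp k (Linf_x f) < \<infinity>"
    if k: "1 \<le> k" and bc: "boundary_condition k fL fR" and ss: "steady_state \<sigma> k fL fR f"
      and hyp: "norm_hyp k (\<lambda>p. ennreal \<bar>inflow fL fR p\<bar>) < \<infinity>"
    for k fL fR f
  proof -
    from k have k0: "0 \<le> k" by simp
    from ss have f: "(\<lambda>(x, p). f x p) \<in> borel_measurable (restrict_space borel ({0..1} \<times> UNIV))"
      and fin: "norm_w k (Linf_x f) < \<infinity>"
      and mild: "\<And>x p. x \<in> {0..1} \<Longrightarrow> f x p = mild_rhs \<sigma> fL fR f x p"
      by (auto simp: steady_state_def)
    from bc obtain r1 r2 where r: "0 < r1" "r1 < r2"
      and int: "set_integrable lborel (Q_right r1 r2) fL" "0 < (LINT q:Q_right r1 r2|lborel. fL q)"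
      and in_m[measurable]: "inflow fL fR \<in> borel_measurable borel" and in_nn: "\<And>p. 0 \<le> inflow fL fR p"
      by (auto simp: boundary_condition_def)
    note borel_measurable_Linf_x[OF f, measurable]
    obtain N where N: "norm_w k (Linf_x f) = ennreal N" "0 \<le> N"
      using fin by (cases "norm_w k (Linf_x f)" rule: ennreal_cases) auto
    define R where "R = sqrt (1 + r2\<^sup>2)"
    have R: "0 \<le> R" by (simp add: R_def)
    have enR: "energy q \<le> R" if "q \<in> Q_right r1 r2" for q
      using that by (auto simp: energy_def R_def Q_right_def intro!: power_mono)
    define T where "T = 32 * pi * b * sqrt R * N"
    have T: "0 \<le> T" using b R N by (simp add: T_def)
    have upper: "AE z in lborel. z \<in> {0..1} \<longrightarrow> coll_freq \<sigma> f z p \<le> ennreal T" if p: "energy p \<le> R" for p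
    proof -
      have "AE z in lborel. z \<in> {0..1} \<longrightarrow> coll_freq \<sigma> f z p \<le> ennreal (32 * pi * b * sqrt (energy p)) * norm_w k (Linf_x f)"
        by (rule coll_freq_le[OF f _ less_imp_le[OF b] k0], rule ker)
      then show ?thesis
      proof eventually_elim
        case (elim z)
        have "ennreal (32 * pi * b * sqrt (energy p)) * ennreal N \<le> ennreal T"
        proof -
          have "32 * pi * b * sqrt (energy p) * N \<le> T"
            unfolding T_def using b N(2) p by (intro mult_right_mono mult_left_mono real_sqrt_le_mono) auto
          then show ?thesis using N(2) by (simp add: ennreal_leI flip: ennreal_mult'')
        qed
        then show ?case using elim N by (auto intro: order_trans)
      qed
    qed
    \<comment> \<open>A minorant of \<open>f z\<close> that does not depend on \<open>z\<close>: the
      inflow on \<open>Q_right r1 r2\<close>, damped according to the upper bound \<open>T\<close>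
      for the collision frequency. It has positive finite mass and bounded support, as
      \<open>nn_integral_kernel_ge\<close> demands.\<close>
    define \<rho> where "\<rho> = (\<lambda>q. ennreal (exp (- (R / r1 * T))) * ennreal (indicator (Q_right r1 r2) q *\<^sub>R fL q))"
    have fL_nn: "0 \<le> indicator (Q_right r1 r2) q *\<^sub>R fL q" for q
      using in_nn[of q] r by (auto simp: inflow_def Q_right_def indicator_def split: if_splits)
    have fL_m[measurable]: "(\<lambda>q. indicator (Q_right r1 r2) q *\<^sub>R fL q) \<in> borel_measurable borel"
      using int(1) by (auto simp: set_integrable_def dest!: borel_measurable_integrable)
    have \<rho>[measurable]: "\<rho> \<in> borel_measurable borel"
      unfolding \<rho>_def by measurable
    have \<rho>_le: "\<rho> q \<le> f z q" if z: "z \<in> {0..1}" for z q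
    proof (cases "q \<in> Q_right r1 r2")
      case True
      then have "r1 \<le> q $ 1" by (simp add: Q_right_def)
      from steady_state_ge_inflow[OF mild[OF z] z r(1) this enR[OF True] upper[OF enR[OF True]] T]
      show ?thesis using True by (simp add: \<rho>_def)
    qed (simp add: \<rho>_def)
    have "(\<integral>\<^sup>+q. \<rho> q \<partial>lborel) = ennreal (exp (- (R / r1 * T))) * ennreal (LINT q:Q_right r1 r2|lborel. fL q)"
      unfolding \<rho>_def set_lebesgue_integral_def using int(1) fL_nn
      by (subst nn_integral_cmult) (auto simp: set_integrable_def nn_integral_eq_integral)
    then have \<rho>_pos: "(\<integral>\<^sup>+q. \<rho> q \<partial>lborel) \<noteq> 0" "(\<integral>\<^sup>+q. \<rho> q \<partial>lborel) < \<infinity>"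
      using int(2) by (simp_all add: ennreal_mult_less_top)
    have \<rho>_supp: "energy q \<le> R" if "\<rho> q \<noteq> 0" for q
      using that enR by (cases "q \<in> Q_right r1 r2") (auto simp: \<rho>_def)
    obtain c where c: "0 < c" "\<And>p. ennreal c \<le> (\<integral>\<^sup>+q. ennreal (moller p q * rel_momentum p q) * \<rho> q \<partial>lborel)"
      using nn_integral_kernel_ge[OF \<rho> \<rho>_pos \<rho>_supp] by metis
    \<comment> \<open>\<open>A\<close> comes from the lower bound on \<open>\<sigma>\<close>,
      \<open>c0\<close> from the angular integral and \<open>c\<close> from the kernel integrated
      against \<open>\<rho>\<close>.\<close>
    define \<nu> where "\<nu> = A * c0 * c"
    have \<nu>: "0 < \<nu>" using A c0 c by (simp add: \<nu>_def)
    have lower: "ennreal \<nu> \<le> coll_freq \<sigma> f z p" if z: "z \<in> {0..1}" for z p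
    proof -
      have "ennreal \<nu> = ennreal A * ennreal c0 * ennreal c"
        using A c0 c by (simp add: \<nu>_def ennreal_mult)
      also have "\<dots> \<le> ennreal A * ennreal c0 * (\<integral>\<^sup>+q. ennreal (moller p q * rel_momentum p q) * \<rho> q \<partial>lborel)"
        by (intro mult_left_mono c) simp
      also have "\<dots> \<le> coll_freq \<sigma> f z p"
        unfolding S0[symmetric]
        using A(1) \<sigma>0 by (intro coll_freq_ge A(2) \<rho>_le z \<rho>) auto
      finally show ?thesis .
    qed
    let ?w = "\<lambda>p. ennreal (energy p powr (1 / 2) * phi k p)"
    let ?i = "\<lambda>p. ennreal \<bar>inflow fL fR p\<bar>"
    have [measurable]: "?w \<in> borel_measurable borel" unfolding phi_def by measurable
    have F_le: "Linf_x f p \<le> ?i p + ennreal (b / \<nu>) * gain (Linf_x f) p" for p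
    proof -
      have "Linf_x f p \<le> ?i p + ennreal (1 / \<nu>) * (ennreal b * gain (Linf_x f) p)"
        by (rule steady_state_Linf_le[OF f mild \<nu> lower Q_plus_le_gain[OF f _ less_imp_le[OF b]]])
          (assumption | rule ker)+
      also have "ennreal (1 / \<nu>) * (ennreal b * gain (Linf_x f) p) = ennreal (b / \<nu>) * gain (Linf_x f) p"
        using b \<nu> by (simp add: mult.assoc[symmetric] flip: ennreal_mult)
      finally show ?thesis .
    qed
    have "norm_hyp k (Linf_x f) \<le> norm_hyp k ?i + ennreal (b / \<nu>) * norm_hyp k (gain (Linf_x f))"
      unfolding norm_hyp_def
    proof (rule SUP_least)
      fix E assume E: "E \<in> planes"
      have [measurable_cong]: "sets (plane_measure E) = sets borel"
        using ex_orthonormal_frame[OF E] by (auto simp: plane_measure_eq frame_measure_def split: prod.split)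
      have "(\<integral>\<^sup>+p. ?w p * Linf_x f p \<partial>plane_measure E) \<le>
          (\<integral>\<^sup>+p. ?w p * ?i p + ennreal (b / \<nu>) * (?w p * gain (Linf_x f) p) \<partial>plane_measure E)"
      proof (rule nn_integral_mono)
        fix p
        show "?w p * Linf_x f p \<le> ?w p * ?i p + ennreal (b / \<nu>) * (?w p * gain (Linf_x f) p)"
          using mult_left_mono[OF F_le[of p], of "?w p"] by (simp add: distrib_left mult.left_commute)
      qed
      also have "\<dots> = (\<integral>\<^sup>+p. ?w p * ?i p \<partial>plane_measure E) +
          ennreal (b / \<nu>) * (\<integral>\<^sup>+p. ?w p * gain (Linf_x f) p \<partial>plane_measure E)"
        by (subst nn_integral_add) (auto simp: nn_integral_cmult)
      also have "\<dots> \<le> (SUP E\<in>planes. \<integral>\<^sup>+p. ?w p * ?i p \<partial>plane_measure E) +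
          ennreal (b / \<nu>) * (SUP E\<in>planes. \<integral>\<^sup>+p. ?w p * gain (Linf_x f) p \<partial>plane_measure E)"
        using E by (intro add_mono mult_left_mono SUP_upper) auto
      finally show "(\<integral>\<^sup>+p. ?w p * Linf_x f p \<partial>plane_measure E) \<le> \<dots>" .
    qed
    also have "\<dots> \<le> norm_hyp k ?i + ennreal (b / \<nu>) * (ennreal (sqrt 2 * (96 * pi)) * (norm_w k (Linf_x f))\<^sup>2)"
      by (intro add_left_mono mult_left_mono norm_hyp_gain_le k0) auto
    also have "\<dots> < \<infinity>"
      using hyp by (simp add: N ennreal_mult_less_top ennreal_power)
    finally show ?thesis .
  qed
  \<comment> \<open>The weight estimates use \<open>0 \<le> k\<close>, which the threshold 1
    guarantees.\<close>
  then show ?thesis by (intro exI[of _ 1]) auto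
qed

end
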